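(* Let $(C,b,T_{\mathsf d},T_{\mathsf u})$ be an oriented quantum coalgebra over the field $k$ and let $\mathbf{Inv}_C:\mathbf{Tang}\to C^*$ be the function on oriented $1$--$1$ tangle diagrams defined in the context. If $\mathbf T,\mathbf T'\in\mathbf{Tang}$ are regularly isotopic then $\mathbf{Inv}_C(\mathbf T)=\mathbf{Inv}_C(\mathbf T')$.
   Context: $k$ is a field. For a coalgebra $(C,\Delta,\epsilon)$ over $k$ write $\Delta(c)=c_{(1)}\otimes c_{(2)}$ and, for iterated coproducts, $\Delta^{(m-1)}(c)=c_{(1)}\otimes\cdots\otimes c_{(m)}$ (summation understood). A bilinear form $b:C\times C\to k$ is invertible, with inverse $b^{-1}$, if $b^{-1}(c_{(1)},d_{(1)})b(c_{(2)},d_{(2)})=\epsilon(c)\epsilon(d)=b(c_{(1)},d_{(1)})b^{-1}(c_{(2)},d_{(2)})$ for all $c,d\in C$. $C^*$ is the linear dual of $C$. A linear automorphism $T$ of $C$ is a coalgebra automorphism of $C$ with respect to a set $\mathcal S$ of bilinear forms on $C$ if $\epsilon\circ T=\epsilon$ and $b(T(c_{(1)}),d)\,b'(T(c_{(2)}),e)=b(T(c)_{(1)},d)\,b'(T(c)_{(2)},e)$ and $b(d,T(c_{(1)}))\,b'(e,T(c_{(2)}))=b(d,T(c)_{(1)})\,b'(e,T(c)_{(2)})$ for all $b,b'\in\mathcal S$ and $c,d,e\in C$. An oriented quantum coalgebra over $k$ is a quadruple $(C,b,T_{\mathsf d},T_{\mathsf u})$ where $C$ is a coalgebra over $k$, $b:C\times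 C\to k$ is an invertible bilinear form and $T_{\mathsf d},T_{\mathsf u}$ are commuting coalgebra automorphisms of $C$ with respect to $\{b,b^{-1}\}$ such that for all $c,d,e\in C$: (qc.1) $b(c_{(1)},T_{\mathsf u}(d_{(2)}))\,b^{-1}(T_{\mathsf d}(c_{(2)}),d_{(1)})=\epsilon(c)\epsilon(d)$ and $b^{-1}(T_{\mathsf d}(c_{(1)}),d_{(2)})\,b(c_{(2)},T_{\mathsf u}(d_{(1)}))=\epsilon(c)\epsilon(d)$; (qc.2) $b(c,d)=b(T_{\mathsf d}(c),T_{\mathsf d}(d))=b(T_{\mathsf u}(c),T_{\mathsf u}(d))$; (qc.3) $b(c_{(1)},d_{(1)})b(c_{(2)},e_{(1)})b(d_{(2)},e_{(2)})=b(c_{(2)},d_{(2)})b(c_{(1)},e_{(2)})b(d_{(1)},e_{(1)})$. Tangle diagrams. $\mathbf{Tang}$ is the set of oriented $1$--$1$ tangle diagrams: planar diagrams, drawn with respect to the vertical direction, of a single oriented strand contained in a box except for two protruding vertical end segments, one at the top and one at the bottom. Each is composed of crossings, local maxima, local minima and "vertical" lines, with compatible orientations. Each crossing consists of two crossing lines, one joining its SW and NE corners and the other joining its NW and SE corners; one is the over line and the other the under line. The strand is traversed in the direction of orientation from the base point (beginning) to the end point. Types of oriented local extrema: $(\mathsf u_-)$ a local maximum traversed from left to right (clockwise); $(\mathsf u_+)$ a local minimum traversed from left to right (counterclockwise); $(\mathsf d_+)$ a local maximum traversed from right to left (counterclockwise); $(\mathsf d_-)$ a local minimum traversed from right to left (clockwise).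 Definition of $\mathbf{Inv}_C$. If $\mathbf T$ has no crossings, $\mathbf{Inv}_C(\mathbf T)=\epsilon$. If $\mathbf T$ has $n\ge1$ crossings, traverse $\mathbf T$ from its base point and label the crossing lines $1,\dots,2n$ in the order encountered. For $1\le\imath\le2n$ let $u_{\mathsf d}(\imath)$ be the number of extrema of type $(\mathsf d_+)$ minus the number of type $(\mathsf d_-)$ encountered on the portion of the traversal from line $\imath$ to the end, and let $u_{\mathsf u}(\imath)$ be defined likewise with $(\mathsf u_+),(\mathsf u_-)$. Write $[\imath;p,q]=T_{\mathsf d}^{u_{\mathsf d}(\imath)+p}\circ T_{\mathsf u}^{u_{\mathsf u}(\imath)+q}(c_{(\imath)})$. For $c\in C$, with $\Delta^{(2n-1)}(c)=c_{(1)}\otimes\cdots\otimes c_{(2n)}$, the scalar $\mathbf{Inv}_C(\mathbf T)(c)$ is the (Sweedler sum of the) product over all crossings of the following factors, where $\imath$ labels the over line and $\jmath$ the under line: - over line SW--NE, both lines directed upward, or both directed downward: $b([\imath;0,0],[\jmath;0,0])$; - over line SW--NE, both lines directed left to right: $b^{-1}([\imath;0,1],[\jmath;0,0])$; - over line SW--NE, both lines directed right to left: $b^{-1}([\imath;1,0],[\jmath;0,0])$; - over line NW--SE, both lines directed upward, or both directed downward: $b^{-1}([\imath;0,0],[\jmath;0,0])$; - over line NW--SE, both lines directed left to right: $b([\imath;0,0],[\jmath;0,1])$; - over line NW--SE, both lines directed right to left: $b([\imath;0,0],[\jmath;1,0])$. Regular isotopy. Diagrams are considered up to planar isotopies which create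 or cancel no local extrema and do not change the position of crossings relative to the vertical. Two oriented diagrams are regularly isotopic if they are related by a finite sequence of the following local replacements (in either direction, with any compatible orientations): (M.1) a vertical arc is replaced by an arc having the same ends and one adjacent local maximum/local minimum pair (an "S" shape or its mirror image); (M.2) two vertical lines are replaced by two strands crossing twice, one crossing directly above the other, the strand starting at the bottom left being the over strand at both crossings; (M.2rev) the same with that strand being the under strand at both crossings; (M.3) for three strands in positions $1,2,3$ from left to right: reading upward, a crossing of positions $1,2$, then of positions $2,3$, then of positions $1,2$ is replaced by a crossing of positions $2,3$, then of positions $1,2$, then of positions $2,3$, where all over lines run NW--SE; (M.3rev) the same with all over lines running SW--NE; (M.4) a strand running from the bottom to the top which passes under the left leg of a local maximum arc (and then passes to the left of and above the maximum) is replaced by one which passes under the right leg (and to the right of and above the maximum); likewise, for a local minimum arc, a strand coming from below the minimum and passing under its left leg is replaced by one passing under its right leg; (M.4rev) the same with the strand passing over instead of under. *)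

theory Defs
  imports Complex_Main
begin

section \<open>Coalgebras\<close>

text \<open>A finite list of lists of vectors is read as a formal sum of pure tensors: the list
  \<open>[[x, y], [u, v]]\<close> stands for \<open>x \<otimes> y + u \<otimes> v\<close>. The relation below is the congruence on formal
  sums that presents the tensor powers of the vector space; sums of scalar multiples of pure
  tensors are obtained by moving the scalar into a factor.\<close>

inductive tensor_eq ::
  "('k::field \<Rightarrow> 'c::ab_group_add \<Rightarrow> 'c) \<Rightarrow> 'c list list \<Rightarrow> 'c list list \<Rightarrow> bool"
  for scale
  where
    refl: "tensor_eq scale X X"
  | sym: "tensor_eq scale X Y \<Longrightarrow> tensor_eq scale Y X"
  | trans: "tensor_eq scale X Y \<Longrightarrow> tensor_eq scale Y Z \<Longrightarrow> tensor_eq scale X Z"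
  | cong: "tensor_eq scale X X' \<Longrightarrow> tensor_eq scale Y Y' \<Longrightarrow> tensor_eq scale (X @ Y) (X' @ Y')"
  | comm: "tensor_eq scale (X @ Y) (Y @ X)"
  | zero: "tensor_eq scale [xs @ 0 # ys] []"
  | add: "tensor_eq scale [xs @ (x + y) # ys] [xs @ x # ys, xs @ y # ys]"
  | scalar: "tensor_eq scale [xs @ scale a x # ys @ y # zs] [xs @ x # ys @ scale a y # zs]"

text \<open>The coproduct is given by a choice, for each \<open>c\<close>, of a formal sum representing the tensor
  \<open>\<Delta>(c)\<close>. The laws of a coalgebra are required of the tensors represented, that is, up to
  \<^const>\<open>tensor_eq\<close>.\<close>

locale coalgebra = vector_space scale
  for scale :: "'k::field \<Rightarrow> 'c::ab_group_add \<Rightarrow> 'c" +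
  fixes \<Delta> :: "'c \<Rightarrow> ('c \<times> 'c) list"
    and \<epsilon> :: "'c \<Rightarrow> 'k"
  assumes coproduct_add:
      "tensor_eq scale [[x, y]. (x, y) \<leftarrow> \<Delta> (c + d)] [[x, y]. (x, y) \<leftarrow> \<Delta> c @ \<Delta> d]"
    and coproduct_scale:
      "tensor_eq scale [[x, y]. (x, y) \<leftarrow> \<Delta> (scale a c)] [[scale a x, y]. (x, y) \<leftarrow> \<Delta> c]"
    and counit_linear: "Vector_Spaces.linear scale (*) \<epsilon>"
    and coassociative:
      "tensor_eq scale [[x1, x2, y]. (x, y) \<leftarrow> \<Delta> c, (x1, x2) \<leftarrow> \<Delta> x]
                       [[x, y1, y2]. (x, y) \<leftarrow> \<Delta> c, (y1, y2) \<leftarrow> \<Delta> y]"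
    and counit_left: "(\<Sum>(x, y)\<leftarrow>\<Delta> c. scale (\<epsilon> x) y) = c"
    and counit_right: "(\<Sum>(x, y)\<leftarrow>\<Delta> c. scale (\<epsilon> y) x) = c"

text \<open>\<open>iter_coproduct \<Delta> m\<close> is \<open>\<Delta>\<^sup>(\<^sup>m\<^sup>)\<close>, whose summands have \<open>m + 1\<close> factors.\<close>

fun iter_coproduct :: "('c \<Rightarrow> ('c \<times> 'c) list) \<Rightarrow> nat \<Rightarrow> 'c \<Rightarrow> 'c list list" where
  "iter_coproduct \<Delta> 0 c = [[c]]"
| "iter_coproduct \<Delta> (Suc m) c = [x # ys. (x, y) \<leftarrow> \<Delta> c, ys \<leftarrow> iter_coproduct \<Delta> m y]"


section \<open>Oriented quantum coalgebras\<close>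

context coalgebra
begin

definition bilinear_form :: "('c \<Rightarrow> 'c \<Rightarrow> 'k) \<Rightarrow> bool" where
  "bilinear_form b \<longleftrightarrow>
     (\<forall>c. Vector_Spaces.linear scale (*) (b c)) \<and>
     (\<forall>d. Vector_Spaces.linear scale (*) (\<lambda>c. b c d))"

definition inverse_forms :: "('c \<Rightarrow> 'c \<Rightarrow> 'k) \<Rightarrow> ('c \<Rightarrow> 'c \<Rightarrow> 'k) \<Rightarrow> bool" where
  "inverse_forms b binv \<longleftrightarrow>
     (\<forall>c d. (\<Sum>(c1, c2)\<leftarrow>\<Delta> c. \<Sum>(d1, d2)\<leftarrow>\<Delta> d. binv c1 d1 * b c2 d2) = \<epsilon> c * \<epsilon> d \<and>
            (\<Sum>(c1, c2)\<leftarrow>\<Delta> c. \<Sum>(d1, d2)\<leftarrow>\<Delta> d. b c1 d1 * binv c2 d2) = \<epsilon> c * \<epsilon> d)"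

definition coalgebra_automorphism_wrt ::
    "('c \<Rightarrow> 'c \<Rightarrow> 'k) set \<Rightarrow> ('c \<Rightarrow> 'c) \<Rightarrow> bool" where
  "coalgebra_automorphism_wrt S T \<longleftrightarrow>
     Vector_Spaces.linear scale scale T \<and> bij T \<and> \<epsilon> \<circ> T = \<epsilon> \<and>
     (\<forall>b\<in>S. \<forall>b'\<in>S. \<forall>c d e.
        (\<Sum>(c1, c2)\<leftarrow>\<Delta> c. b (T c1) d * b' (T c2) e) = (\<Sum>(t1, t2)\<leftarrow>\<Delta> (T c). b t1 d * b' t2 e) \<and>
        (\<Sum>(c1, c2)\<leftarrow>\<Delta> c. b d (T c1) * b' e (T c2)) = (\<Sum>(t1, t2)\<leftarrow>\<Delta> (T c). b d t1 * b' e t2))"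

end

text \<open>The parameter \<open>binv\<close> is the inverse of \<open>b\<close>. It is determined by \<open>b\<close>, being an inverse for the
  convolution product of forms.\<close>

locale oriented_quantum_coalgebra = coalgebra scale \<Delta> \<epsilon>
  for scale :: "'k::field \<Rightarrow> 'c::ab_group_add \<Rightarrow> 'c"
    and \<Delta> :: "'c \<Rightarrow> ('c \<times> 'c) list"
    and \<epsilon> :: "'c \<Rightarrow> 'k" +
  fixes b binv :: "'c \<Rightarrow> 'c \<Rightarrow> 'k"
    and Td Tu :: "'c \<Rightarrow> 'c"
  assumes bilinear_b: "bilinear_form b"
    and bilinear_binv: "bilinear_form binv"
    and inverse: "inverse_forms b binv"
    and automorphism_Td: "coalgebra_automorphism_wrt {b, binv} Td"
    and automorphism_Tu: "coalgebra_automorphism_wrt {b, binv} Tu"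
    and commute: "Td \<circ> Tu = Tu \<circ> Td"
    and qc1a: "(\<Sum>(c1, c2)\<leftarrow>\<Delta> c. \<Sum>(d1, d2)\<leftarrow>\<Delta> d. b c1 (Tu d2) * binv (Td c2) d1) = \<epsilon> c * \<epsilon> d"
    and qc1b: "(\<Sum>(c1, c2)\<leftarrow>\<Delta> c. \<Sum>(d1, d2)\<leftarrow>\<Delta> d. binv (Td c1) d2 * b c2 (Tu d1)) = \<epsilon> c * \<epsilon> d"
    and qc2_Td: "b c d = b (Td c) (Td d)"
    and qc2_Tu: "b c d = b (Tu c) (Tu d)"
    and qc3: "(\<Sum>(c1, c2)\<leftarrow>\<Delta> c. \<Sum>(d1, d2)\<leftarrow>\<Delta> d. \<Sum>(e1, e2)\<leftarrow>\<Delta> e. b c1 d1 * b c2 e1 * b d2 e2)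
            = (\<Sum>(c1, c2)\<leftarrow>\<Delta> c. \<Sum>(d1, d2)\<leftarrow>\<Delta> d. \<Sum>(e1, e2)\<leftarrow>\<Delta> e. b c2 d2 * b c1 e2 * b d1 e1)"


section \<open>Oriented 1--1 tangle diagrams\<close>

text \<open>A diagram in general position is cut by horizontal levels into slices, listed from bottom to
  top. A slice \<open>(e, i)\<close> contains one crossing or local extremum \<open>e\<close>, with \<open>i\<close> vertical lines to the
  left of it; every other strand is vertical there. A crossing is described by the corners which
  its over line joins.\<close>

datatype line = SWNE | NWSE

fun other_line :: "line \<Rightarrow> line" where
  "other_line SWNE = NWSE"
| "other_line NWSE = SWNE"

datatype piece = Crossing (over_line: line) | Local_Max | Local_Min

type_synonym slice = "piece \<times> nat"

fun ends_below :: "piece \<Rightarrow> nat" where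
  "ends_below (Crossing _) = 2"
| "ends_below Local_Max = 2"
| "ends_below Local_Min = 0"

fun ends_above :: "piece \<Rightarrow> nat" where
  "ends_above (Crossing _) = 2"
| "ends_above Local_Max = 0"
| "ends_above Local_Min = 2"

text \<open>\<open>strands n w\<close> is the number of strands at the top of \<open>w\<close> when \<open>n\<close> strands enter at the bottom;
  it is \<^const>\<open>None\<close> if some slice does not fit on the strands below it.\<close>

fun strands :: "nat \<Rightarrow> slice list \<Rightarrow> nat option" where
  "strands n [] = Some n"
| "strands n ((e, i) # w) =
     (if i + ends_below e \<le> n then strands (n - ends_below e + ends_above e) w else None)"

text \<open>In \<open>Diagram w u\<close> the flag \<open>u\<close> says that the base point is the bottom end, so that the diagram is
  traversed from bottom to top; otherwise the base point is the top end.\<close>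

datatype diagram = Diagram (slices: "slice list") (from_bottom: bool)

text \<open>The point \<open>(k, p, u)\<close> is on the level below slice \<open>k\<close> (equivalently, above slice \<open>k - 1\<close>), with \<open>p\<close>
  strands to the left of it, and is being passed upward if \<open>u\<close> holds and downward otherwise. In
  \<open>Cross_Line k l up\<close> the number \<open>k\<close> is the slice of the crossing and \<open>up\<close> says that the line \<open>l\<close> is
  directed upward.\<close>

type_synonym point = "nat \<times> nat \<times> bool"

datatype event =
    Cross_Line nat line bool
  | U_minus | U_plus | D_plus | D_minus

inductive follow :: "slice list \<Rightarrow> point \<Rightarrow> event list \<Rightarrow> point \<Rightarrow> bool"
  for w where
    up_left: "k < length w \<Longrightarrow> w ! k = (e, i) \<Longrightarrow> p < i \<Longrightarrow>
      follow w (k, p, True) [] (Suc k, p, True)"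
  | up_right: "k < length w \<Longrightarrow> w ! k = (e, i) \<Longrightarrow>
      follow w (k, i + ends_below e + p, True) [] (Suc k, i + ends_above e + p, True)"
  | down_left: "k < length w \<Longrightarrow> w ! k = (e, i) \<Longrightarrow> p < i \<Longrightarrow>
      follow w (Suc k, p, False) [] (k, p, False)"
  | down_right: "k < length w \<Longrightarrow> w ! k = (e, i) \<Longrightarrow>
      follow w (Suc k, i + ends_above e + p, False) [] (k, i + ends_below e + p, False)"
  | SW_to_NE: "k < length w \<Longrightarrow> w ! k = (Crossing l, i) \<Longrightarrow>
      follow w (k, i, True) [Cross_Line k SWNE True] (Suc k, Suc i, True)"
  | SE_to_NW: "k < length w \<Longrightarrow> w ! k = (Crossing l, i) \<Longrightarrow>
      follow w (k, Suc i, True) [Cross_Line k NWSE True] (Suc k, i, True)"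
  | NE_to_SW: "k < length w \<Longrightarrow> w ! k = (Crossing l, i) \<Longrightarrow>
      follow w (Suc k, Suc i, False) [Cross_Line k SWNE False] (k, i, False)"
  | NW_to_SE: "k < length w \<Longrightarrow> w ! k = (Crossing l, i) \<Longrightarrow>
      follow w (Suc k, i, False) [Cross_Line k NWSE False] (k, Suc i, False)"
  | max_rightward: "k < length w \<Longrightarrow> w ! k = (Local_Max, i) \<Longrightarrow>
      follow w (k, i, True) [U_minus] (k, Suc i, False)"
  | max_leftward: "k < length w \<Longrightarrow> w ! k = (Local_Max, i) \<Longrightarrow>
      follow w (k, Suc i, True) [D_plus] (k, i, False)"
  | min_rightward: "k < length w \<Longrightarrow> w ! k = (Local_Min, i) \<Longrightarrow>
      follow w (Suc k, i, False) [U_plus] (Suc k, Suc i, True)"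
  | min_leftward: "k < length w \<Longrightarrow> w ! k = (Local_Min, i) \<Longrightarrow>
      follow w (Suc k, Suc i, False) [D_minus] (Suc k, i, True)"

inductive travel :: "slice list \<Rightarrow> point \<Rightarrow> event list \<Rightarrow> point \<Rightarrow> bool"
  for w where
    stop: "travel w s [] s"
  | go: "follow w s vs s' \<Longrightarrow> travel w s' vs' s'' \<Longrightarrow> travel w s (vs @ vs') s''"

fun base_point :: "diagram \<Rightarrow> point" where
  "base_point (Diagram w u) = (if u then (0, 0, True) else (length w, 0, False))"

fun end_point :: "diagram \<Rightarrow> point" where
  "end_point (Diagram w u) = (if u then (length w, 0, True) else (0, 0, False))"

text \<open>The last condition says that the diagram is a single strand: every point of every level is
  met when travelling from the base point, so that there are no closed components.\<close>

definition Tang :: "diagram set" where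
  "Tang = {D. strands 1 (slices D) = Some 1 \<and>
     (\<forall>k n p. k \<le> length (slices D) \<and> strands 1 (take k (slices D)) = Some n \<and> p < n \<longrightarrow>
        (\<exists>vs u. travel (slices D) (base_point D) vs (k, p, u)))}"

definition events :: "diagram \<Rightarrow> event list" where
  "events D = (THE vs. travel (slices D) (base_point D) vs (end_point D))"


section \<open>Regular isotopy\<close>

text \<open>Planar isotopies which keep the local extrema and the position of the crossings change the
  slices only by exchanging the heights of two neighbouring pieces of which one lies entirely to the
  left of the other. Here \<open>p\<close> is the number of strands between the two pieces.\<close>

inductive height_exchange :: "slice list \<Rightarrow> slice list \<Rightarrow> bool" where
  "height_exchange [(e, i), (f, i + ends_above e + p)] [(f, i + ends_below e + p), (e, i)]"

abbreviation (input) SWNE_over :: "nat \<Rightarrow> slice" where "SWNE_over i \<equiv> (Crossing SWNE, i)"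
abbreviation (input) NWSE_over :: "nat \<Rightarrow> slice" where "NWSE_over i \<equiv> (Crossing NWSE, i)"

text \<open>In the last four rules the passing strand starts between the legs of the maximum, respectively ends
  between the legs of the minimum.\<close>

inductive local_move :: "slice list \<Rightarrow> slice list \<Rightarrow> bool" where
    M1: "local_move [] [(Local_Min, Suc i), (Local_Max, i)]"
  | M1_mirror: "local_move [] [(Local_Min, i), (Local_Max, Suc i)]"
  | M2: "local_move [] [SWNE_over i, NWSE_over i]"
  | M2_rev: "local_move [] [NWSE_over i, SWNE_over i]"
  | M3: "local_move [NWSE_over i, NWSE_over (Suc i), NWSE_over i]
                    [NWSE_over (Suc i), NWSE_over i, NWSE_over (Suc i)]"
  | M3_rev: "local_move [SWNE_over i, SWNE_over (Suc i), SWNE_over i]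
                        [SWNE_over (Suc i), SWNE_over i, SWNE_over (Suc i)]"
  | M4_max: "local_move [SWNE_over i, (Local_Max, Suc i)] [NWSE_over (Suc i), (Local_Max, i)]"
  | M4_min: "local_move [(Local_Min, Suc i), NWSE_over i] [(Local_Min, i), SWNE_over (Suc i)]"
  | M4_max_rev: "local_move [NWSE_over i, (Local_Max, Suc i)] [SWNE_over (Suc i), (Local_Max, i)]"
  | M4_min_rev: "local_move [(Local_Min, Suc i), SWNE_over i] [(Local_Min, i), NWSE_over (Suc i)]"

inductive isotopy_step :: "diagram \<Rightarrow> diagram \<Rightarrow> bool" where
  "height_exchange l r \<or> local_move l r \<Longrightarrow>
   Diagram (v @ l @ w) u \<in> Tang \<Longrightarrow> Diagram (v @ r @ w) u \<in> Tang \<Longrightarrow>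
   isotopy_step (Diagram (v @ l @ w) u) (Diagram (v @ r @ w) u)"

definition regularly_isotopic :: "diagram \<Rightarrow> diagram \<Rightarrow> bool" where
  "regularly_isotopic = equivclp isotopy_step"


section \<open>The invariant\<close>

definition int_power :: "('c \<Rightarrow> 'c) \<Rightarrow> int \<Rightarrow> 'c \<Rightarrow> 'c" where
  "int_power T z = (if 0 \<le> z then T ^^ nat z else inv T ^^ nat (- z))"

text \<open>The crossing lines in the order in which they are encountered, each with its crossing, its
  corners, its direction and the numbers \<open>u\<^sub>d\<close> and \<open>u\<^sub>u\<close>. The labels are the positions in this list,
  hence start at \<open>0\<close>.\<close>

datatype labelled_line =
  Labelled (crossing: nat) (corners: line) (dir_up: bool) (ud: int) (uu: int)

fun labelled_lines :: "event list \<Rightarrow> labelled_line list" where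
  "labelled_lines [] = []"
| "labelled_lines (v # vs) =
     (case v of
        Cross_Line k l up \<Rightarrow>
          Labelled k l up
            (int (count_list vs D_plus) - int (count_list vs D_minus))
            (int (count_list vs U_plus) - int (count_list vs U_minus)) # labelled_lines vs
      | _ \<Rightarrow> labelled_lines vs)"

definition label_of :: "labelled_line list \<Rightarrow> nat \<Rightarrow> line \<Rightarrow> nat" where
  "label_of L k l = (THE i. i < length L \<and> crossing (L ! i) = k \<and> corners (L ! i) = l)"

text \<open>The arguments are: the corners of the over line, whether the over line and the under line are
  directed upward, and \<open>[i; p, q]\<close>, \<open>[j; p, q]\<close> as functions of \<open>p\<close> and \<open>q\<close>. If exactly one of the lines
  is directed upward, then both are directed to the right when it is the line SW--NE, and both to the
  left when it is the line NW--SE.\<close>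

fun crossing_factor ::
    "('c \<Rightarrow> 'c \<Rightarrow> 'k) \<Rightarrow> ('c \<Rightarrow> 'c \<Rightarrow> 'k) \<Rightarrow> line \<Rightarrow> bool \<Rightarrow> bool \<Rightarrow>
     (int \<Rightarrow> int \<Rightarrow> 'c) \<Rightarrow> (int \<Rightarrow> int \<Rightarrow> 'c) \<Rightarrow> 'k" where
  "crossing_factor b binv SWNE True True x y = b (x 0 0) (y 0 0)"
| "crossing_factor b binv SWNE False False x y = b (x 0 0) (y 0 0)"
| "crossing_factor b binv SWNE True False x y = binv (x 0 1) (y 0 0)"
| "crossing_factor b binv SWNE False True x y = binv (x 1 0) (y 0 0)"
| "crossing_factor b binv NWSE True True x y = binv (x 0 0) (y 0 0)"
| "crossing_factor b binv NWSE False False x y = binv (x 0 0) (y 0 0)"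
| "crossing_factor b binv NWSE False True x y = b (x 0 0) (y 0 1)"
| "crossing_factor b binv NWSE True False x y = b (x 0 0) (y 1 0)"

definition crossings :: "slice list \<Rightarrow> nat set" where
  "crossings w = {k. k < length w \<and> (\<exists>l i. w ! k = (Crossing l, i))}"

definition Inv ::
    "('c \<Rightarrow> ('c \<times> 'c) list) \<Rightarrow> ('c \<Rightarrow> 'k::field) \<Rightarrow> ('c \<Rightarrow> 'c \<Rightarrow> 'k) \<Rightarrow> ('c \<Rightarrow> 'c \<Rightarrow> 'k) \<Rightarrow>
     ('c \<Rightarrow> 'c) \<Rightarrow> ('c \<Rightarrow> 'c) \<Rightarrow> diagram \<Rightarrow> 'c \<Rightarrow> 'k" where
  "Inv \<Delta> \<epsilon> b binv Td Tu D c =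
     (let K = crossings (slices D); n = card K; L = labelled_lines (events D) in
      if n = 0 then \<epsilon> c
      else \<Sum>cs\<leftarrow>iter_coproduct \<Delta> (2 * n - 1) c. \<Prod>k\<in>K.
        let l = over_line (fst (slices D ! k));
            i = label_of L k l;
            j = label_of L k (other_line l);
            bracket = (\<lambda>m p q. int_power Td (ud (L ! m) + p) (int_power Tu (uu (L ! m) + q) (cs ! m)))
        in crossing_factor b binv l (dir_up (L ! i)) (dir_up (L ! j)) (bracket i) (bracket j))"

end

theory Submission
  imports Defs
begin

text \<open>Cut both diagrams around the place of the move. Every passage of the strand through the middle part
  keeps its ends and its turning numbers, so the two traversals have the same outer segments, and by
  coassociativity the state sum depends on the middle part only through local state sums, in which each
  passing strand carries one Sweedler factor. For the moves with one crossing these agree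
  by invariance of \<open>b\<close>. For (M.2) the sum collapses to counits by invertibility of \<open>b\<close> if the strands are
  parallel, and by (qc.1) if they are antiparallel. For (M.3) with
  parallel strands it is (qc.3); reversing a strand passes to the co-opposite coproduct of that factor,
  and the equations for the other orientations follow by conjugating with convolution inverses.\<close>

section \<open>Sweedler sums and convolution of forms\<close>

text \<open>Conjugation changes orientations for a combinatorial reason. In a convolution product of
  forms on the strand pairs 12, 13, 23, the order of the factors only decides, for each strand,
  which half of its coproduct goes to which of the two forms that it feeds. All six orders are
  therefore one expression, \<open>hexagon\<close>, up to three flags. Carrying an inverted factor
  to the other side of the equation flips the flag of the one strand that this form does not touch.
  Powers of \<open>Td\<close> and \<open>Tu\<close> enter a form only through differences of
  exponents. The shift by one in (qc.1) produces the exponent defect that appears when the middle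
  strand runs against both others. On the side of diagrams the obstacle is that a local move knows
  neither the order nor the directions in which its strands are passed, nor the turns made outside.
  So the traversal is first described with unresolved passages. The Sweedler factor of a relevant
  passage is kept whole in one slot and subdivided only afterwards, which makes the two local sums
  comparable for arbitrary outer exponents.\<close>

lemma sum_list_concat_map: "sum_list (concat xs) = (\<Sum>x\<leftarrow>xs. sum_list x)"
  by (induction xs) simp_all

text \<open>Universal property of the tensor powers: every rule of the congruence is respected by a
  function that is additive and homogeneous in each entry. The rules fix no length, so
  \<open>G\<close> has to be multilinear on lists of every length.\<close>

lemma tensor_eq_sum_list:
  assumes "tensor_eq scale X Y"
    and add: "\<And>xs x y ys. G (xs @ (x + y) # ys) = G (xs @ x # ys) + G (xs @ y # ys)"
    and scal: "\<And>xs a x ys. G (xs @ scale a x # ys) = (a::'k::field) * G (xs @ x # ys)"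
  shows "sum_list (map G X) = sum_list (map G Y)"
  using assms(1)
proof induction
  case (zero xs ys)
  \<comment> \<open>Reading the zero entry as \<open>0 + 0\<close> makes the value equal to twice
    itself.\<close>
  have "G (xs @ (0 + 0) # ys) = G (xs @ 0 # ys) + G (xs @ 0 # ys)" by (rule add)
  then have "G (xs @ 0 # ys) = 0" by (metis add_cancel_right_right add.right_neutral)
  then show ?case by simp
next
  case (scalar xs a x ys y zs)
  show ?case using scal[of xs a x "ys @ y # zs"] scal[of "xs @ x # ys" a y zs] by simp
qed (auto simp: add add.commute)

context coalgebra
begin

definition lin :: "('c \<Rightarrow> 'k) \<Rightarrow> bool" where
  "lin f \<longleftrightarrow> (\<forall>x y. f (x + y) = f x + f y) \<and> (\<forall>a x. f (scale a x) = a * f x)"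

lemma linI: "(\<And>x y. f (x + y) = f x + f y) \<Longrightarrow> (\<And>a x. f (scale a x) = a * f x) \<Longrightarrow> lin f"
  by (auto simp: lin_def)

lemma lin_add: "lin f \<Longrightarrow> f (x + y) = f x + f y"
  and lin_scale: "lin f \<Longrightarrow> f (scale a x) = a * f x"
  by (auto simp: lin_def)

lemma lin_zero: "lin f \<Longrightarrow> f 0 = 0"
  using lin_scale[of f 0 0] by simp

lemma lin_sum_list: "lin f \<Longrightarrow> f (sum_list (map g xs)) = (\<Sum>x\<leftarrow>xs. f (g x))"
  by (induction xs) (auto simp: lin_zero lin_add)

lemma lin_linear: "Vector_Spaces.linear scale (*) f \<Longrightarrow> lin f"
  unfolding lin_def Vector_Spaces.linear_def module_hom_def module_hom_axioms_def by auto

lemma lin_cmult: "lin f \<Longrightarrow> lin (\<lambda>x. a * f x)"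
  and lin_multc: "lin f \<Longrightarrow> lin (\<lambda>x. f x * a)"
  by (auto simp: lin_def algebra_simps)

lemma lin_sum_list_fun: "(\<And>y. y \<in> set ys \<Longrightarrow> lin (f y)) \<Longrightarrow> lin (\<lambda>x. \<Sum>y\<leftarrow>ys. f y x)"
  by (induction ys) (auto simp: lin_def algebra_simps)

lemma lin_counit: "lin \<epsilon>"
  using counit_linear by (rule lin_linear)

definition lin2 :: "('c \<Rightarrow> 'c \<Rightarrow> 'k) \<Rightarrow> bool" where
  "lin2 f \<longleftrightarrow> (\<forall>x. lin (f x)) \<and> (\<forall>y. lin (\<lambda>x. f x y))"

definition lin3 :: "('c \<Rightarrow> 'c \<Rightarrow> 'c \<Rightarrow> 'k) \<Rightarrow> bool" where
  "lin3 f \<longleftrightarrow> (\<forall>x y. lin (f x y)) \<and> (\<forall>x z. lin (\<lambda>y. f x y z)) \<and> (\<forall>y z. lin (\<lambda>x. f x y z))"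

text \<open>The flag selects the co-opposite coproduct, which is what a strand met in the reverse
  direction contributes.\<close>

definition sw :: "bool \<Rightarrow> 'c \<Rightarrow> ('c \<Rightarrow> 'c \<Rightarrow> 'k) \<Rightarrow> 'k" where
  "sw s c G = (\<Sum>z\<leftarrow>\<Delta> c. if s then G (fst z) (snd z) else G (snd z) (fst z))"

lemma sw_True: "sw True c G = (\<Sum>(x, y)\<leftarrow>\<Delta> c. G x y)"
  by (simp add: sw_def case_prod_unfold)

lemma sw_flip: "sw s c (\<lambda>x y. G y x) = sw (\<not> s) c G"
  by (cases s) (simp_all add: sw_def)

lemma sw_False: "sw False c G = sw True c (\<lambda>x y. G y x)"
  by (simp add: sw_def)

lemma sw_plus: "sw s c (\<lambda>x y. G x y + H x y) = sw s c G + sw s c H"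
  by (cases s) (simp_all add: sw_def case_prod_unfold sum_list_addf)

lemma sw_cmult: "sw s c (\<lambda>x y. a * G x y) = a * sw s c G"
  by (cases s) (simp_all add: sw_def case_prod_unfold sum_list_const_mult)

lemma sw_multc: "sw s c (\<lambda>x y. G x y * a) = sw s c G * a"
  by (cases s) (simp_all add: sw_def case_prod_unfold sum_list_mult_const)

lemma sw_sum_list: "sw s c (\<lambda>x y. \<Sum>z\<leftarrow>zs. G z x y) = (\<Sum>z\<leftarrow>zs. sw s c (G z))"
proof (induction zs)
  case Nil then show ?case by (simp add: sw_def case_prod_unfold)
next
  case (Cons a zs) then show ?case by (simp add: sw_plus)
qed

lemma sw_sw: "sw s c (\<lambda>x y. sw t d (G x y)) = sw t d (\<lambda>u v. sw s c (\<lambda>x y. G x y u v))"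
proof -
  have "sw s c (\<lambda>x y. sw t d (G x y))
      = (\<Sum>z\<leftarrow>\<Delta> d. sw s c (\<lambda>x y. if t then G x y (fst z) (snd z) else G x y (snd z) (fst z)))"
    unfolding sw_sum_list[symmetric] by (simp add: sw_def[of t d] case_prod_unfold)
  then show ?thesis by (cases t) (simp_all add: sw_def[of _ d] case_prod_unfold)
qed

lemma sw_cong: "(\<And>x y. G x y = H x y) \<Longrightarrow> sw s c G = sw s c H"
  using ext[of G H] by (metis ext)

text \<open>Covers both laws of the coproduct at once: \<open>f\<close> is the identity for
  additivity and \<open>scale a\<close> for homogeneity.\<close>

lemma sum_list_pairs_cong:
  assumes "tensor_eq scale (map (\<lambda>(x, y). [x, y]) A) (map (\<lambda>(x, y). [f x, y]) B)" and "lin2 G"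
  shows "(\<Sum>(x, y)\<leftarrow>A. G x y) = (\<Sum>(x, y)\<leftarrow>B. G (f x) y)"
proof -
  \<comment> \<open>Extending by zero to the other lengths keeps multilinearity on all
    lists.\<close>
  define G' where "G' l = (case l of [x, y] \<Rightarrow> G x y | _ \<Rightarrow> 0)" for l
  have G: "lin (G x)" "lin (\<lambda>x. G x y)" for x y using assms(2) by (auto simp: lin2_def)
  have "sum_list (map G' (map (\<lambda>(x, y). [x, y]) A)) = sum_list (map G' (map (\<lambda>(x, y). [f x, y]) B))"
  proof (rule tensor_eq_sum_list[OF assms(1)])
    fix xs x y ys
    show "G' (xs @ (x + y) # ys) = G' (xs @ x # ys) + G' (xs @ y # ys)"
      using lin_add[OF G(1)] lin_add[OF G(2)]
      by (auto simp: G'_def Cons_eq_append_conv append_eq_Cons_conv split: list.splits)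
  next
    fix xs a x ys
    show "G' (xs @ scale a x # ys) = a * G' (xs @ x # ys)"
      using lin_scale[OF G(1)] lin_scale[OF G(2)]
      by (auto simp: G'_def Cons_eq_append_conv append_eq_Cons_conv split: list.splits)
  qed
  then show ?thesis by (simp add: G'_def comp_def case_prod_unfold)
qed

lemma lin2_flip: "lin2 G \<Longrightarrow> lin2 (\<lambda>x y. G y x)"
  by (auto simp: lin2_def)

text \<open>The chosen representatives of the coproduct are linear only up to
  \<open>tensor_eq\<close>, so linearity in \<open>c\<close> is visible only after summing a
  bilinear function.\<close>

lemma lin_sw: assumes "lin2 G" shows "lin (\<lambda>c. sw s c G)"
proof -
  have *: "lin (\<lambda>c. sw True c G)" if "lin2 G" for G
  proof (rule linI)
    fix x y show "sw True (x + y) G = sw True x G + sw True y G"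
      using sum_list_pairs_cong[of "\<Delta> (x + y)" "\<lambda>x. x" "\<Delta> x @ \<Delta> y" G] coproduct_add[of x y] that
      by (simp add: sw_True)
  next
    fix a x
    have "lin (\<lambda>u. G u v)" for v using that by (simp add: lin2_def)
    then have "G (scale a u) v = a * G u v" for u v by (rule lin_scale)
    then show "sw True (scale a x) G = a * sw True x G"
      using sum_list_pairs_cong[of "\<Delta> (scale a x)" "scale a" "\<Delta> x" G] coproduct_scale[of a x] that
      by (simp add: sw_True case_prod_unfold sum_list_const_mult)
  qed
  show ?thesis using *[OF assms] *[OF lin2_flip[OF assms]] by (cases s) (simp_all add: sw_False)
qed

lemma lin_sw_fun: "(\<And>x y. lin (\<lambda>z. G z x y)) \<Longrightarrow> lin (\<lambda>z. sw s c (G z))"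
  unfolding sw_def by (intro lin_sum_list_fun) (cases s; simp)

lemma sw_counit1: assumes "lin f" shows "sw s c (\<lambda>x y. \<epsilon> x * f y) = f c"
proof -
  have "f c = f (\<Sum>(x, y)\<leftarrow>\<Delta> c. scale (\<epsilon> x) y)" by (simp add: counit_left)
  moreover have "f c = f (\<Sum>(x, y)\<leftarrow>\<Delta> c. scale (\<epsilon> y) x)" by (simp add: counit_right)
  ultimately show ?thesis
    by (cases s) (simp_all add: sw_def case_prod_unfold lin_sum_list[OF assms] lin_scale[OF assms])
qed

lemma sw_counit2: "lin f \<Longrightarrow> sw s c (\<lambda>x y. f x * \<epsilon> y) = f c"
  using sw_counit1[of f "\<not> s" c] sw_flip[of s c "\<lambda>x y. \<epsilon> x * f y"] by (simp add: mult.commute)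

lemma sw_assoc_True:
  assumes "lin3 G"
  shows "sw True c (\<lambda>x y. sw True x (\<lambda>x1 x2. G x1 x2 y)) = sw True c (\<lambda>x y. sw True y (G x))"
proof -
  define G' where "G' l = (case l of [x, y, z] \<Rightarrow> G x y z | _ \<Rightarrow> 0)" for l
  have G: "lin (G x y)" "lin (\<lambda>y. G x y z)" "lin (\<lambda>x. G x y z)" for x y z
    using assms by (auto simp: lin3_def)
  have "sum_list (map G' [[x1, x2, y]. (x, y) \<leftarrow> \<Delta> c, (x1, x2) \<leftarrow> \<Delta> x])
      = sum_list (map G' [[x, y1, y2]. (x, y) \<leftarrow> \<Delta> c, (y1, y2) \<leftarrow> \<Delta> y])"
  proof (rule tensor_eq_sum_list[OF coassociative])
    fix xs x y ys
    show "G' (xs @ (x + y) # ys) = G' (xs @ x # ys) + G' (xs @ y # ys)"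
      using lin_add[OF G(1)] lin_add[OF G(2)] lin_add[OF G(3)]
      by (auto simp: G'_def Cons_eq_append_conv append_eq_Cons_conv split: list.splits)
  next
    fix xs a x ys
    show "G' (xs @ scale a x # ys) = a * G' (xs @ x # ys)"
      using lin_scale[OF G(1)] lin_scale[OF G(2)] lin_scale[OF G(3)]
      by (auto simp: G'_def Cons_eq_append_conv append_eq_Cons_conv split: list.splits)
  qed
  then show ?thesis
    by (simp add: sw_True map_concat sum_list_concat_map comp_def case_prod_unfold G'_def)
qed

lemma sw_assoc:
  assumes "lin3 G"
  shows "sw s c (\<lambda>x y. sw s x (\<lambda>x1 x2. G x1 x2 y)) = sw s c (\<lambda>x y. sw s y (G x))"
proof (cases s)
  case True then show ?thesis using sw_assoc_True[OF assms] by simp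
next
  case False
  have "lin3 (\<lambda>x y z. G z y x)" using assms by (auto simp: lin3_def)
  from sw_assoc_True[OF this, of c] show ?thesis using False by (simp add: sw_False)
qed

section \<open>The convolution algebra of trilinear forms, where the flags choose the coproduct or
  its opposite in each argument\<close>

definition conv :: "bool \<Rightarrow> bool \<Rightarrow> bool \<Rightarrow> ('c \<Rightarrow> 'c \<Rightarrow> 'c \<Rightarrow> 'k) \<Rightarrow> ('c \<Rightarrow> 'c \<Rightarrow> 'c \<Rightarrow> 'k)
    \<Rightarrow> 'c \<Rightarrow> 'c \<Rightarrow> 'c \<Rightarrow> 'k" where
  "conv s t u F G x y z =
     sw s x (\<lambda>x1 x2. sw t y (\<lambda>y1 y2. sw u z (\<lambda>z1 z2. F x1 y1 z1 * G x2 y2 z2)))"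

lemma lin_conv:
  assumes "lin3 F" "lin3 G" shows "lin3 (conv s t u F G)"
proof -
  have F: "lin (F x y)" "lin (\<lambda>y. F x y z)" "lin (\<lambda>x. F x y z)" for x y z
    using assms by (auto simp: lin3_def)
  have G: "lin (G x y)" "lin (\<lambda>y. G x y z)" "lin (\<lambda>x. G x y z)" for x y z
    using assms by (auto simp: lin3_def)
  show ?thesis
    unfolding lin3_def conv_def
    by (intro conjI allI lin_sw lin_sw_fun; simp add: lin2_def; intro conjI allI lin_sw_fun lin_cmult lin_multc F G)
qed

text \<open>Coassociativity once in each argument, after the six coproducts have been sorted by
  argument with \<open>sw_sw\<close>.\<close>

lemma conv_assoc:
  assumes "lin3 F" "lin3 G" "lin3 H"
  shows "conv s t u (conv s t u F G) H = conv s t u F (conv s t u G H)"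
proof (intro ext)
  fix x y z
  have F: "lin (F x y)" "lin (\<lambda>y. F x y z)" "lin (\<lambda>x. F x y z)" for x y z
    using assms by (auto simp: lin3_def)
  have G: "lin (G x y)" "lin (\<lambda>y. G x y z)" "lin (\<lambda>x. G x y z)" for x y z
    using assms by (auto simp: lin3_def)
  have H: "lin (H x y)" "lin (\<lambda>y. H x y z)" "lin (\<lambda>x. H x y z)" for x y z
    using assms by (auto simp: lin3_def)
  let ?P = "\<lambda>x1 x2 x3 y1 y2 y3 z1 z2 z3. F x1 y1 z1 * G x2 y2 z2 * H x3 y3 z3"
  let ?Q = "\<lambda>x1 x2 x3. sw t y (\<lambda>y' y3. sw t y' (\<lambda>y1 y2. sw u z (\<lambda>z' z3. sw u z' (\<lambda>z1 z2.
       ?P x1 x2 x3 y1 y2 y3 z1 z2 z3))))"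
  have "conv s t u (conv s t u F G) H x y z = sw s x (\<lambda>x' x3. sw s x' (\<lambda>x1 x2. ?Q x1 x2 x3))"
    unfolding conv_def sw_multc[symmetric]
    by (simp only: sw_sw[of t _ s] sw_sw[of u _ s] sw_sw[of u _ t])
  also have "\<dots> = sw s x (\<lambda>x1 x'. sw s x' (\<lambda>x2 x3. ?Q x1 x2 x3))"
  proof (rule sw_assoc)
    show "lin3 ?Q" unfolding lin3_def
      by (intro conjI allI lin_sw_fun lin_cmult lin_multc F G H)
  qed
  also have "\<dots> = sw s x (\<lambda>x1 x'. sw s x' (\<lambda>x2 x3. sw t y (\<lambda>y1 y'. sw t y' (\<lambda>y2 y3.
      sw u z (\<lambda>z1 z'. sw u z' (\<lambda>z2 z3. ?P x1 x2 x3 y1 y2 y3 z1 z2 z3))))))"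
  proof (rule sw_cong, rule sw_cong)
    fix x1 x2 x3
    have "?Q x1 x2 x3 = sw t y (\<lambda>y1 y'. sw t y' (\<lambda>y2 y3. sw u z (\<lambda>z' z3. sw u z' (\<lambda>z1 z2.
       ?P x1 x2 x3 y1 y2 y3 z1 z2 z3))))"
      by (rule sw_assoc) (unfold lin3_def, intro conjI allI lin_sw_fun lin_cmult lin_multc F G H)
    also have "\<dots> = sw t y (\<lambda>y1 y'. sw t y' (\<lambda>y2 y3. sw u z (\<lambda>z1 z'. sw u z' (\<lambda>z2 z3.
       ?P x1 x2 x3 y1 y2 y3 z1 z2 z3))))"
      by (intro sw_cong sw_assoc) (unfold lin3_def, intro conjI allI lin_sw_fun lin_cmult lin_multc F G H)
    finally show "?Q x1 x2 x3 = \<dots>" .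
  qed
  also have "\<dots> = conv s t u F (conv s t u G H) x y z"
    unfolding conv_def sw_cmult[symmetric] mult.assoc
    by (simp only: sw_sw[of t _ s] sw_sw[of u _ s] sw_sw[of u _ t])
  finally show "conv s t u (conv s t u F G) H x y z = conv s t u F (conv s t u G H) x y z" .
qed

definition convolution_unit :: "'c \<Rightarrow> 'c \<Rightarrow> 'c \<Rightarrow> 'k" where
  "convolution_unit x y z = \<epsilon> x * \<epsilon> y * \<epsilon> z"

text \<open>Leg notation: a form placed on two of the three tensor factors, with the counit on the
  remaining one. The same holds for \<open>form13\<close> and \<open>form23\<close>.\<close>

definition form12 :: "('c \<Rightarrow> 'c \<Rightarrow> 'k) \<Rightarrow> 'c \<Rightarrow> 'c \<Rightarrow> 'c \<Rightarrow> 'k" where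
  "form12 f x y z = f x y * \<epsilon> z"

definition form13 :: "('c \<Rightarrow> 'c \<Rightarrow> 'k) \<Rightarrow> 'c \<Rightarrow> 'c \<Rightarrow> 'c \<Rightarrow> 'k" where
  "form13 f x y z = f x z * \<epsilon> y"

definition form23 :: "('c \<Rightarrow> 'c \<Rightarrow> 'k) \<Rightarrow> 'c \<Rightarrow> 'c \<Rightarrow> 'c \<Rightarrow> 'k" where
  "form23 f x y z = f y z * \<epsilon> x"

lemma lin3_forms [intro, simp]:
  "lin3 convolution_unit"
  "lin2 f \<Longrightarrow> lin3 (form12 f)" "lin2 f \<Longrightarrow> lin3 (form13 f)" "lin2 f \<Longrightarrow> lin3 (form23 f)"
  using lin_counit
  by (auto simp: lin3_def lin2_def convolution_unit_def[abs_def] form12_def[abs_def]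
      form13_def[abs_def] form23_def[abs_def]
      intro!: lin_cmult lin_multc)

lemma lin3_E: "lin3 G \<Longrightarrow> lin (G x y)" "lin3 G \<Longrightarrow> lin (\<lambda>y. G x y z)" "lin3 G \<Longrightarrow> lin (\<lambda>x. G x y z)"
  by (auto simp: lin3_def)

lemma lin2_E: "lin2 G \<Longrightarrow> lin (G x)" "lin2 G \<Longrightarrow> lin (\<lambda>x. G x y)"
  by (auto simp: lin2_def)

lemma conv_form12:
  assumes "lin3 G"
  shows "conv s t u (form12 f) G x y z = sw s x (\<lambda>x1 x2. sw t y (\<lambda>y1 y2. f x1 y1 * G x2 y2 z))"
proof -
  have "conv s t u (form12 f) G x y z
    = sw s x (\<lambda>x1 x2. sw t y (\<lambda>y1 y2. f x1 y1 * sw u z (\<lambda>z1 z2. \<epsilon> z1 * G x2 y2 z2)))"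
    by (simp add: conv_def form12_def sw_cmult mult.assoc)
  then show ?thesis using assms by (simp add: sw_counit1 lin3_E)
qed

lemma conv_form13:
  assumes "lin3 G"
  shows "conv s t u (form13 f) G x y z = sw s x (\<lambda>x1 x2. sw u z (\<lambda>z1 z2. f x1 z1 * G x2 y z2))"
proof -
  have "conv s t u (form13 f) G x y z
    = sw s x (\<lambda>x1 x2. sw u z (\<lambda>z1 z2. f x1 z1 * sw t y (\<lambda>y1 y2. \<epsilon> y1 * G x2 y2 z2)))"
    by (simp add: conv_def form13_def sw_cmult[symmetric] sw_sw[of t _ u] mult.assoc)
  then show ?thesis using assms by (simp add: sw_counit1 lin3_E)
qed

lemma conv_form23:
  assumes "lin3 G"
  shows "conv s t u (form23 f) G x y z = sw t y (\<lambda>y1 y2. sw u z (\<lambda>z1 z2. f y1 z1 * G x y2 z2))"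
proof -
  have "conv s t u (form23 f) G x y z
    = sw t y (\<lambda>y1 y2. sw u z (\<lambda>z1 z2. f y1 z1 * sw s x (\<lambda>x1 x2. \<epsilon> x1 * G x2 y2 z2)))"
    by (simp add: conv_def form23_def sw_cmult[symmetric] sw_sw[of s _ t] sw_sw[of s _ u] mult.assoc)
  then show ?thesis using assms by (simp add: sw_counit1 lin3_E)
qed

lemma conv_unit1: assumes "lin3 G" shows "conv s t u convolution_unit G = G"
proof (intro ext)
  fix x y z
  have "conv s t u convolution_unit G x y z
    = sw s x (\<lambda>x1 x2. \<epsilon> x1 * sw t y (\<lambda>y1 y2. \<epsilon> y1 * sw u z (\<lambda>z1 z2. \<epsilon> z1 * G x2 y2 z2)))"
    by (simp add: conv_def convolution_unit_def sw_cmult mult.assoc)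
  then show "conv s t u convolution_unit G x y z = G x y z"
    using assms by (simp add: sw_counit1 lin3_E)
qed

lemma conv_unit2: assumes "lin3 G" shows "conv s t u G convolution_unit = G"
proof (intro ext)
  fix x y z
  have "conv s t u G convolution_unit x y z
    = sw s x (\<lambda>x1 x2. sw t y (\<lambda>y1 y2. sw u z (\<lambda>z1 z2. G x1 y1 z1 * \<epsilon> z2) * \<epsilon> y2) * \<epsilon> x2)"
    by (simp add: conv_def convolution_unit_def sw_multc[symmetric] sw_cmult[symmetric] ac_simps)
  then show "conv s t u G convolution_unit x y z = G x y z"
    using assms by (simp add: sw_counit2 lin3_E)
qed

section \<open>Convolution inverses and the Yang-Baxter equation\<close>

definition dual_pair :: "bool \<Rightarrow> bool \<Rightarrow> ('c \<Rightarrow> 'c \<Rightarrow> 'k) \<Rightarrow> ('c \<Rightarrow> 'c \<Rightarrow> 'k) \<Rightarrow> bool" where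
  "dual_pair s t f g \<longleftrightarrow> lin2 f \<and> lin2 g \<and>
     (\<forall>x y. sw s x (\<lambda>x1 x2. sw t y (\<lambda>y1 y2. f x1 y1 * g x2 y2)) = \<epsilon> x * \<epsilon> y) \<and>
     (\<forall>x y. sw s x (\<lambda>x1 x2. sw t y (\<lambda>y1 y2. g x1 y1 * f x2 y2)) = \<epsilon> x * \<epsilon> y)"

lemma dual_pair_sym: "dual_pair s t f g \<Longrightarrow> dual_pair s t g f"
  by (auto simp: dual_pair_def)

lemma dual_pair_conv:
  assumes "dual_pair s t f g"
  shows "conv s t u (form12 f) (form12 g) = convolution_unit"
    and "conv s u t (form13 f) (form13 g) = convolution_unit"
    and "conv u s t (form23 f) (form23 g) = convolution_unit"
  using assms
  by (auto simp: fun_eq_iff dual_pair_def conv_form12 conv_form13 conv_form23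
      form12_def form13_def form23_def convolution_unit_def sw_multc mult.assoc[symmetric])

text \<open>With all flags true this is the left side of (qc.3), and with all flags false the right
  side; \<open>f\<close>, \<open>g\<close>, \<open>h\<close> sit on the pairs 12, 13, 23.\<close>

definition hexagon :: "bool \<Rightarrow> bool \<Rightarrow> bool \<Rightarrow> ('c \<Rightarrow> 'c \<Rightarrow> 'k) \<Rightarrow> ('c \<Rightarrow> 'c \<Rightarrow> 'k) \<Rightarrow> ('c \<Rightarrow> 'c \<Rightarrow> 'k)
    \<Rightarrow> 'c \<Rightarrow> 'c \<Rightarrow> 'c \<Rightarrow> 'k" where
  "hexagon s t u f g h x y z = sw s x (\<lambda>x1 x2. sw t y (\<lambda>y1 y2. sw u z (\<lambda>z1 z2.
     f x1 y1 * g x2 z1 * h y2 z2)))"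

lemma conv_pair:
  assumes "lin2 f" "lin2 g" "lin2 h"
  shows "conv s t u (form12 f) (form13 g) x y z = sw s x (\<lambda>x1 x2. f x1 y * g x2 z)"
    and "conv s t u (form13 g) (form12 f) x y z = sw s x (\<lambda>x1 x2. g x1 z * f x2 y)"
    and "conv s t u (form12 f) (form23 h) x y z = sw t y (\<lambda>y1 y2. f x y1 * h y2 z)"
    and "conv s t u (form23 h) (form12 f) x y z = sw t y (\<lambda>y1 y2. h y1 z * f x y2)"
    and "conv s t u (form13 g) (form23 h) x y z = sw u z (\<lambda>z1 z2. g x z1 * h y z2)"
    and "conv s t u (form23 h) (form13 g) x y z = sw u z (\<lambda>z1 z2. h y z1 * g x z2)"
proof -
  have c: "sw r c (\<lambda>x1 x2. p x1 * (a * \<epsilon> x2)) = p c * a" if "lin p" for r c p a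
  proof -
    have "sw r c (\<lambda>x1 x2. (a * p x1) * \<epsilon> x2) = a * p c"
      by (rule sw_counit2[OF lin_cmult[OF that]])
    then show ?thesis by (simp only: ac_simps)
  qed
  note F = lin2_E[OF assms(1)] lin2_E[OF assms(2)] lin2_E[OF assms(3)]
  show "conv s t u (form12 f) (form13 g) x y z = sw s x (\<lambda>x1 x2. f x1 y * g x2 z)"
    by (simp add: assms conv_form12 form13_def c F)
  show "conv s t u (form13 g) (form12 f) x y z = sw s x (\<lambda>x1 x2. g x1 z * f x2 y)"
    by (simp add: assms conv_form13 form12_def c F)
  show "conv s t u (form12 f) (form23 h) x y z = sw t y (\<lambda>y1 y2. f x y1 * h y2 z)"
    by (simp add: assms conv_form12 form23_def c F sw_sw[of s])
  show "conv s t u (form23 h) (form12 f) x y z = sw t y (\<lambda>y1 y2. h y1 z * f x y2)"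
    by (simp add: assms conv_form23 form12_def c F)
  show "conv s t u (form13 g) (form23 h) x y z = sw u z (\<lambda>z1 z2. g x z1 * h y z2)"
    by (simp add: assms conv_form13 form23_def c F sw_sw[of s])
  show "conv s t u (form23 h) (form13 g) x y z = sw u z (\<lambda>z1 z2. h y z1 * g x z2)"
    by (simp add: assms conv_form23 form13_def c F sw_sw[of t])
qed

text \<open>Any two of the legs share exactly one argument: \<open>f\<close> and \<open>g\<close>
  share \<open>x\<close>, \<open>f\<close> and \<open>h\<close> share \<open>y\<close>,
  \<open>g\<close> and \<open>h\<close> share \<open>z\<close>. The order of the product matters
  only through which of the two comes first there, and each pair in reversed order negates one
  flag.\<close>

lemma conv_triple:
  assumes "lin2 f" "lin2 g" "lin2 h"
  shows "conv s t u (form12 f) (conv s t u (form13 g) (form23 h)) = hexagon s t u f g h"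
    and "conv s t u (form12 f) (conv s t u (form23 h) (form13 g)) = hexagon s t (\<not> u) f g h"
    and "conv s t u (form13 g) (conv s t u (form12 f) (form23 h)) = hexagon (\<not> s) t u f g h"
    and "conv s t u (form13 g) (conv s t u (form23 h) (form12 f)) = hexagon (\<not> s) (\<not> t) u f g h"
    and "conv s t u (form23 h) (conv s t u (form12 f) (form13 g)) = hexagon s (\<not> t) (\<not> u) f g h"
    and "conv s t u (form23 h) (conv s t u (form13 g) (form12 f)) = hexagon (\<not> s) (\<not> t) (\<not> u) f g h"
proof -
  note l = lin3_forms(2)[OF assms(1)] lin3_forms(3)[OF assms(2)] lin3_forms(4)[OF assms(3)]
  note L = lin_conv[OF l(1) l(2)] lin_conv[OF l(1) l(3)] lin_conv[OF l(2) l(1)]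
    lin_conv[OF l(2) l(3)] lin_conv[OF l(3) l(1)] lin_conv[OF l(3) l(2)]
  note unfold = L[THEN conv_form12] L[THEN conv_form13] L[THEN conv_form23] conv_pair[OF assms]
    hexagon_def sw_flip[symmetric] sw_cmult[symmetric] ac_simps
    sw_sw[of u _ t] sw_sw[of u _ s] sw_sw[of t _ s]
  show "conv s t u (form12 f) (conv s t u (form13 g) (form23 h)) = hexagon s t u f g h"
    and "conv s t u (form12 f) (conv s t u (form23 h) (form13 g)) = hexagon s t (\<not> u) f g h"
    and "conv s t u (form13 g) (conv s t u (form12 f) (form23 h)) = hexagon (\<not> s) t u f g h"
    and "conv s t u (form13 g) (conv s t u (form23 h) (form12 f)) = hexagon (\<not> s) (\<not> t) u f g h"
    and "conv s t u (form23 h) (conv s t u (form12 f) (form13 g)) = hexagon s (\<not> t) (\<not> u) f g h"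
    and "conv s t u (form23 h) (conv s t u (form13 g) (form12 f)) = hexagon (\<not> s) (\<not> t) (\<not> u) f g h"
    by (intro ext, simp add: unfold)+
qed

text \<open>Multiply \<open>p q r = r q p\<close> by the inverse of \<open>r\<close> on both
  sides.\<close>

lemma conv_rotate:
  assumes lin: "lin3 p" "lin3 q" "lin3 r" "lin3 r'"
    and inv: "conv s t u r r' = convolution_unit" "conv s t u r' r = convolution_unit"
    and eq: "conv s t u p (conv s t u q r) = conv s t u r (conv s t u q p)"
  shows "conv s t u r' (conv s t u p q) = conv s t u q (conv s t u p r')"
proof -
  let ?m = "conv s t u"
  have "?m r' (?m p q) = ?m r' (?m (?m p (?m q r)) r')"
    using lin by (simp add: conv_assoc lin_conv conv_unit2 inv)
  also have "\<dots> = ?m (?m r' r) (?m q (?m p r'))"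
    unfolding eq using lin by (simp add: conv_assoc lin_conv)
  also have "\<dots> = ?m q (?m p r')"
    using lin by (simp add: lin_conv conv_unit1 inv)
  finally show ?thesis .
qed

definition yang_baxter :: "bool \<Rightarrow> bool \<Rightarrow> bool \<Rightarrow> ('c \<Rightarrow> 'c \<Rightarrow> 'k) \<Rightarrow> ('c \<Rightarrow> 'c \<Rightarrow> 'k)
    \<Rightarrow> ('c \<Rightarrow> 'c \<Rightarrow> 'k) \<Rightarrow> bool" where
  "yang_baxter s t u f g h \<longleftrightarrow> lin2 f \<and> lin2 g \<and> lin2 h \<and>
     hexagon s t u f g h = hexagon (\<not> s) (\<not> t) (\<not> u) f g h"

lemma yang_baxter_flip: "yang_baxter s t u f g h \<Longrightarrow> yang_baxter (\<not> s) (\<not> t) (\<not> u) f g h"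
  by (simp add: yang_baxter_def)

text \<open>The rotation is applied to the legs 12, 13, 23. Read through \<open>conv_triple\<close>,
  the rotated equation is again of hexagon type, with only the flag of the strand not seen by
  \<open>h\<close> negated.\<close>

lemma yang_baxter_inv23:
  assumes "yang_baxter s t u f g h" "dual_pair t u h h'"
  shows "yang_baxter (\<not> s) t u f g h'"
proof -
  have l: "lin2 f" "lin2 g" "lin2 h" "lin2 h'"
    using assms by (auto simp: yang_baxter_def dual_pair_def)
  have "conv s t u (form23 h') (conv s t u (form12 f) (form13 g))
      = conv s t u (form13 g) (conv s t u (form12 f) (form23 h'))"
    by (rule conv_rotate[of _ _ "form23 h"])
      (use assms dual_pair_conv(3)[OF assms(2)] dual_pair_conv(3)[OF dual_pair_sym[OF assms(2)]] in
        \<open>simp_all add: l conv_triple yang_baxter_def\<close>)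
  then show ?thesis using l by (simp add: conv_triple yang_baxter_def)
qed

lemma yang_baxter_inv12:
  assumes "yang_baxter s t u f g h" "dual_pair s t f f'"
  shows "yang_baxter s t (\<not> u) f' g h"
proof -
  have l: "lin2 f" "lin2 g" "lin2 h" "lin2 f'"
    using assms by (auto simp: yang_baxter_def dual_pair_def)
  have "conv s t u (form12 f') (conv s t u (form23 h) (form13 g))
      = conv s t u (form13 g) (conv s t u (form23 h) (form12 f'))"
    by (rule conv_rotate[of _ _ "form12 f"])
      (use assms dual_pair_conv(1)[OF assms(2)] dual_pair_conv(1)[OF dual_pair_sym[OF assms(2)]] in
        \<open>simp_all add: l conv_triple yang_baxter_def\<close>)
  then show ?thesis using l by (simp add: conv_triple yang_baxter_def)
qed

text \<open>The leg 13 stands in the middle of both sides and cannot be rotated. In the algebra with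
  the third flag negated the same equation reads 12 23 13 = 13 23 12, with this leg at the ends;
  hence the flag \<open>\<not> u\<close> of the inverse pair.\<close>

lemma yang_baxter_inv13:
  assumes "yang_baxter s t u f g h" "dual_pair s (\<not> u) g g'"
  shows "yang_baxter s (\<not> t) u f g' h"
proof -
  have l: "lin2 f" "lin2 g" "lin2 h" "lin2 g'"
    using assms by (auto simp: yang_baxter_def dual_pair_def)
  have "conv s t (\<not> u) (form13 g') (conv s t (\<not> u) (form12 f) (form23 h))
      = conv s t (\<not> u) (form23 h) (conv s t (\<not> u) (form12 f) (form13 g'))"
    by (rule conv_rotate[of _ _ "form13 g"])
      (use assms dual_pair_conv(2)[OF assms(2)] dual_pair_conv(2)[OF dual_pair_sym[OF assms(2)]] in
        \<open>simp_all add: l conv_triple yang_baxter_def\<close>)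
  then show ?thesis using l by (simp add: conv_triple yang_baxter_def)
qed

text \<open>The usual argument by associativity; the bilinear forms are embedded as legs 12 so that
  \<open>conv_assoc\<close> applies.\<close>

lemma left_inverse_unique:
  assumes "lin2 f" "lin2 g" "lin2 g'"
    and g: "\<And>x y. sw True x (\<lambda>x1 x2. sw True y (\<lambda>y1 y2. f x1 y1 * g x2 y2)) = \<epsilon> x * \<epsilon> y"
    and g': "\<And>x y. sw True x (\<lambda>x1 x2. sw True y (\<lambda>y1 y2. g' x1 y1 * f x2 y2)) = \<epsilon> x * \<epsilon> y"
  shows "g' = g"
proof -
  let ?m = "conv True True True"
  have "?m (form12 f) (form12 g) = convolution_unit" "?m (form12 g') (form12 f) = convolution_unit"
    using assms by (auto simp: fun_eq_iff conv_form12 form12_def convolution_unit_def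
        sw_multc mult.assoc[symmetric])
  moreover have "?m (form12 g') (?m (form12 f) (form12 g)) = ?m (?m (form12 g') (form12 f)) (form12 g)"
    using assms by (simp add: conv_assoc)
  ultimately have *: "form12 g' = form12 g"
    using assms by (simp add: conv_unit1 conv_unit2)
  show ?thesis
  proof (intro ext)
    fix x y
    \<comment> \<open>The embedding is injective: the second half of \<open>y\<close> is put into
      the third argument, where the counit absorbs it.\<close>
    have "g' x y = sw True y (\<lambda>y1 y2. form12 g' x y1 y2)" "g x y = sw True y (\<lambda>y1 y2. form12 g x y1 y2)"
      using assms by (simp_all add: form12_def sw_counit2 lin2_E)
    then show "g' x y = g x y" using * by simp
  qed
qed

end

section \<open>Automorphisms and the Yang-Baxter equation\<close>

lemma int_power_Suc: assumes "bij T" shows "int_power T (z + 1) x = T (int_power T z x)"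
proof (cases "0 \<le> z")
  case True then show ?thesis by (simp add: int_power_def nat_add_distrib)
next
  case False
  then have "nat (- z) = Suc (nat (- (z + 1)))" by simp
  then have "int_power T z x = inv T (int_power T (z + 1) x)"
    using False by (simp add: int_power_def)
  then show ?thesis using assms by (simp add: bij_is_surj surj_f_inv_f)
qed

lemma int_power_pred: assumes "bij T" shows "int_power T (z - 1) x = inv T (int_power T z x)"
  using int_power_Suc[OF assms, of "z - 1" x] assms by (simp add: bij_is_inj)

lemma int_power_0 [simp]: "int_power T 0 x = x"
  by (simp add: int_power_def)

lemma int_power_1 [simp]: "int_power T 1 x = T x"
  by (simp add: int_power_def)

lemma int_power_add:
  assumes "bij T" shows "int_power T (y + z) x = int_power T y (int_power T z x)"
proof (induction y rule: int_induct[where k = 0])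
  case (step1 y)
  then show ?case using int_power_Suc[OF assms, of "y + z" x] int_power_Suc[OF assms, of y]
    by (simp add: ac_simps)
next
  case (step2 y)
  have "y - 1 + z = y + z - 1" by simp
  then show ?case using step2 int_power_pred[OF assms, of "y + z" x] int_power_pred[OF assms, of y]
    by metis
qed simp

lemma int_power_commute:
  assumes "bij S" "\<And>x. S (T x) = T (S x)" shows "int_power S z (T x) = T (int_power S z x)"
proof (induction z rule: int_induct[where k = 0])
  case (step1 y)
  then show ?case using assms by (simp add: int_power_Suc)
next
  case (step2 y)
  have "inv S (T u) = T (inv S u)" for u
    using assms by (metis bij_inv_eq_iff)
  then show ?case using step2 assms(1) by (simp add: int_power_pred)
qed simp

context oriented_quantum_coalgebra begin

section \<open>Automorphisms compatible with both forms\<close>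

definition form :: "bool \<Rightarrow> 'c \<Rightarrow> 'c \<Rightarrow> 'k" where
  "form \<sigma> = (if \<sigma> then b else binv)"

definition form_automorphism :: "('c \<Rightarrow> 'c) \<Rightarrow> bool" where
  "form_automorphism A \<longleftrightarrow> bij A \<and> (\<forall>x y. A (x + y) = A x + A y) \<and>
     (\<forall>a x. A (scale a x) = scale a (A x)) \<and> (\<forall>x. \<epsilon> (A x) = \<epsilon> x) \<and>
     (\<forall>\<sigma> x y. form \<sigma> (A x) (A y) = form \<sigma> x y) \<and>
     (\<forall>\<sigma> \<tau> c d e. sw True c (\<lambda>x y. form \<sigma> (A x) d * form \<tau> (A y) e)
        = sw True (A c) (\<lambda>x y. form \<sigma> x d * form \<tau> y e)) \<and>
     (\<forall>\<sigma> \<tau> c d e. sw True c (\<lambda>x y. form \<sigma> d (A x) * form \<tau> e (A y))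
        = sw True (A c) (\<lambda>x y. form \<sigma> d x * form \<tau> e y))"

lemma lin2_form: "lin2 (form \<sigma>)"
  using bilinear_b bilinear_binv lin_linear
  by (auto simp: form_def lin2_def bilinear_form_def)

lemma form_automorphism_D:
  assumes "form_automorphism A"
  shows "bij A" "A (x + y) = A x + A y" "A (scale a x) = scale a (A x)" "\<epsilon> (A x) = \<epsilon> x"
    and "form \<sigma> (A x) (A y) = form \<sigma> x y"
    and "sw s c (\<lambda>x y. form \<sigma> (A x) d * form \<tau> (A y) e) = sw s (A c) (\<lambda>x y. form \<sigma> x d * form \<tau> y e)"
    and "sw s c (\<lambda>x y. form \<sigma> d (A x) * form \<tau> e (A y)) = sw s (A c) (\<lambda>x y. form \<sigma> d x * form \<tau> e y)"
proof -
  show "bij A" "A (x + y) = A x + A y" "A (scale a x) = scale a (A x)" "\<epsilon> (A x) = \<epsilon> x"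
    and "form \<sigma> (A x) (A y) = form \<sigma> x y" for x y
    using assms unfolding form_automorphism_def by blast+
  have 1: "sw True c (\<lambda>x y. form \<sigma> (A x) d * form \<tau> (A y) e)
        = sw True (A c) (\<lambda>x y. form \<sigma> x d * form \<tau> y e)" for \<sigma> \<tau> c d e
    using assms unfolding form_automorphism_def by blast
  have 2: "sw True c (\<lambda>x y. form \<sigma> d (A x) * form \<tau> e (A y))
        = sw True (A c) (\<lambda>x y. form \<sigma> d x * form \<tau> e y)" for \<sigma> \<tau> c d e
    using assms unfolding form_automorphism_def by blast
  show "sw s c (\<lambda>x y. form \<sigma> (A x) d * form \<tau> (A y) e) = sw s (A c) (\<lambda>x y. form \<sigma> x d * form \<tau> y e)"
    using 1[of c \<sigma> d \<tau> e] 1[of c \<tau> e \<sigma> d] by (cases s) (simp_all add: sw_False mult.commute)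
  show "sw s c (\<lambda>x y. form \<sigma> d (A x) * form \<tau> e (A y)) = sw s (A c) (\<lambda>x y. form \<sigma> d x * form \<tau> e y)"
    using 2[of c \<sigma> d \<tau> e] 2[of c \<tau> e \<sigma> d] by (cases s) (simp_all add: sw_False mult.commute)
qed

lemma inverse_form:
  "sw True x (\<lambda>x1 x2. sw True y (\<lambda>y1 y2. form \<sigma> x1 y1 * form (\<not> \<sigma>) x2 y2)) = \<epsilon> x * \<epsilon> y"
  using inverse by (auto simp: form_def inverse_forms_def sw_True)

text \<open>Invariance is given for \<open>b\<close> only. Transported by \<open>T\<close>, the form
  \<open>binv\<close> is still a left inverse of \<open>b\<close>, so uniqueness of inverses makes
  it invariant as well.\<close>

lemma form_automorphism_generator:
  assumes auto: "coalgebra_automorphism_wrt {b, binv} T" and qc2: "\<And>c d. b c d = b (T c) (T d)"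
  shows "form_automorphism T"
proof -
  have T: "Vector_Spaces.linear scale scale T" "bij T" "\<epsilon> \<circ> T = \<epsilon>"
    using auto by (auto simp: coalgebra_automorphism_wrt_def)
  have l: "T (x + y) = T x + T y" "T (scale a x) = scale a (T x)" for x y a
    using T(1) unfolding Vector_Spaces.linear_def module_hom_def module_hom_axioms_def by auto
  have e: "\<epsilon> (T x) = \<epsilon> x" for x using T(3) by (metis comp_apply)
  have f: "form \<sigma> \<in> {b, binv}" for \<sigma> by (simp add: form_def)
  have 1: "sw True c (\<lambda>x y. form \<sigma> (T x) d * form \<tau> (T y) e)
        = sw True (T c) (\<lambda>x y. form \<sigma> x d * form \<tau> y e)"
    and 2: "sw True c (\<lambda>x y. form \<sigma> d (T x) * form \<tau> e (T y))
        = sw True (T c) (\<lambda>x y. form \<sigma> d x * form \<tau> e y)" for \<sigma> \<tau> c d e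
    using auto f unfolding coalgebra_automorphism_wrt_def sw_True by blast+
  have "(\<lambda>x y. binv (T x) (T y)) = binv"
  proof (rule left_inverse_unique[of "form True"])
    show "lin2 (\<lambda>x y. binv (T x) (T y))"
      using lin2_form[of False] by (auto simp: lin2_def lin_def l form_def)
    fix x y
    show "sw True x (\<lambda>x1 x2. sw True y (\<lambda>y1 y2. form True x1 y1 * binv x2 y2)) = \<epsilon> x * \<epsilon> y"
      using inverse_form[of x y True] by (simp add: form_def)
    have "sw True x (\<lambda>x1 x2. sw True y (\<lambda>y1 y2. binv (T x1) (T y1) * form True x2 y2))
       = sw True x (\<lambda>x1 x2. sw True y (\<lambda>y1 y2. form False (T x1) (T y1) * form True (T x2) (T y2)))"
      by (simp add: form_def flip: qc2)
    also have "\<dots> = sw True y (\<lambda>y1 y2. sw True x (\<lambda>x1 x2. form False (T x1) (T y1) * form True (T x2) (T y2)))"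
      by (rule sw_sw)
    also have "\<dots> = sw True y (\<lambda>y1 y2. sw True (T x) (\<lambda>x1 x2. form False x1 (T y1) * form True x2 (T y2)))"
      by (simp only: 1)
    also have "\<dots> = sw True (T x) (\<lambda>x1 x2. sw True y (\<lambda>y1 y2. form False x1 (T y1) * form True x2 (T y2)))"
      by (rule sw_sw)
    also have "\<dots> = \<epsilon> x * \<epsilon> y"
      using inverse_form[of "T x" "T y" False] by (simp add: 2 e)
    finally show "sw True x (\<lambda>x1 x2. sw True y (\<lambda>y1 y2. binv (T x1) (T y1) * form True x2 y2)) = \<epsilon> x * \<epsilon> y" .
  qed (use lin2_form[of True] lin2_form[of False] in \<open>simp_all add: form_def\<close>)
  then have "form \<sigma> (T x) (T y) = form \<sigma> x y" for \<sigma> x y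
    using qc2 by (auto simp: form_def fun_eq_iff)
  then show ?thesis using T l e 1 2 by (simp add: form_automorphism_def)
qed

text \<open>Only pairs of forms see \<open>T\<close> as a coalgebra map, so powers of \<open>T\<close> are handled by moving the outer
  factor to the other argument with the help of invariance.\<close>

lemma form_automorphism_comp:
  assumes A: "form_automorphism A" and B: "form_automorphism B"
  shows "form_automorphism (\<lambda>x. A (B x))"
proof -
  have surj: "A (inv A x) = x" for x
    using form_automorphism_D(1)[OF A] by (simp add: bij_is_surj surj_f_inv_f)
  have l: "form \<sigma> (A x) d = form \<sigma> x (inv A d)" and r: "form \<sigma> d (A x) = form \<sigma> (inv A d) x" for \<sigma> x d
    using form_automorphism_D(5)[OF A, of \<sigma> x "inv A d"] form_automorphism_D(5)[OF A, of \<sigma> "inv A d" x]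
    by (simp_all add: surj)
  have "sw True c (\<lambda>x y. form \<sigma> (A (B x)) d * form \<tau> (A (B y)) e)
      = sw True (A (B c)) (\<lambda>x y. form \<sigma> x d * form \<tau> y e)" for \<sigma> \<tau> c d e
  proof -
    have "sw True c (\<lambda>x y. form \<sigma> (A (B x)) d * form \<tau> (A (B y)) e)
      = sw True (B c) (\<lambda>x y. form \<sigma> (A x) d * form \<tau> (A y) e)"
      unfolding l by (rule form_automorphism_D(6)[OF B])
    then show ?thesis unfolding form_automorphism_D(6)[OF A] .
  qed
  moreover have "sw True c (\<lambda>x y. form \<sigma> d (A (B x)) * form \<tau> e (A (B y)))
      = sw True (A (B c)) (\<lambda>x y. form \<sigma> d x * form \<tau> e y)" for \<sigma> \<tau> c d e
  proof -
    have "sw True c (\<lambda>x y. form \<sigma> d (A (B x)) * form \<tau> e (A (B y)))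
      = sw True (B c) (\<lambda>x y. form \<sigma> d (A x) * form \<tau> e (A y))"
      unfolding r by (rule form_automorphism_D(7)[OF B])
    then show ?thesis unfolding form_automorphism_D(7)[OF A] .
  qed
  moreover have "bij (\<lambda>x. A (B x))"
    using bij_comp[OF form_automorphism_D(1)[OF B] form_automorphism_D(1)[OF A]] by (simp add: comp_def)
  ultimately show ?thesis
    using form_automorphism_D(2-5)[OF A] form_automorphism_D(2-5)[OF B]
    by (simp add: form_automorphism_def)
qed

text \<open>By invariance \<open>inv A\<close> in one argument becomes \<open>A\<close> in the
  other; what remains is the coproduct identity of \<open>A\<close> taken at
  \<open>inv A c\<close>.\<close>

lemma form_automorphism_inv:
  assumes A: "form_automorphism A" shows "form_automorphism (inv A)"
proof -
  have surj: "A (inv A x) = x" and inj: "inv A (A x) = x" for x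
    using form_automorphism_D(1)[OF A] by (simp_all add: bij_is_surj surj_f_inv_f bij_is_inj)
  have l: "form \<sigma> (inv A x) d = form \<sigma> x (A d)" and r: "form \<sigma> d (inv A x) = form \<sigma> (A d) x" for \<sigma> x d
    using form_automorphism_D(5)[OF A, of \<sigma> "inv A x" d] form_automorphism_D(5)[OF A, of \<sigma> d "inv A x"]
    by (simp_all add: surj)
  have "sw True c (\<lambda>x y. form \<sigma> (inv A x) d * form \<tau> (inv A y) e)
      = sw True (inv A c) (\<lambda>x y. form \<sigma> x d * form \<tau> y e)" for \<sigma> \<tau> c d e
    using form_automorphism_D(6)[OF A, of True "inv A c" \<sigma> "A d" \<tau> "A e"]
    by (simp add: l surj form_automorphism_D(5)[OF A])
  moreover have "sw True c (\<lambda>x y. form \<sigma> d (inv A x) * form \<tau> e (inv A y))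
      = sw True (inv A c) (\<lambda>x y. form \<sigma> d x * form \<tau> e y)" for \<sigma> \<tau> c d e
    using form_automorphism_D(7)[OF A, of True "inv A c" \<sigma> "A d" \<tau> "A e"]
    by (simp add: r surj form_automorphism_D(5)[OF A])
  moreover have "inv A (x + y) = inv A x + inv A y" "inv A (scale a x) = scale a (inv A x)"
    "\<epsilon> (inv A x) = \<epsilon> x" "form \<sigma> (inv A x) (inv A y) = form \<sigma> x y" for \<sigma> x y a
    using form_automorphism_D(2)[OF A, of "inv A x" "inv A y"]
      form_automorphism_D(3)[OF A, of a "inv A x"] form_automorphism_D(4)[OF A, of "inv A x"]
      form_automorphism_D(5)[OF A, of \<sigma> "inv A x" "inv A y"]
    by (simp_all add: surj) (metis inj)+
  ultimately show ?thesis
    using form_automorphism_D(1)[OF A] by (simp add: form_automorphism_def bij_imp_bij_inv)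
qed

lemma form_automorphism_id: "form_automorphism (\<lambda>x. x)"
  by (simp add: form_automorphism_def bij_id[unfolded id_def])

lemma form_automorphism_int_power:
  assumes A: "form_automorphism A" shows "form_automorphism (\<lambda>x. int_power A z x)"
proof (induction z rule: int_induct[where k = 0])
  case base then show ?case by (simp add: form_automorphism_id)
next
  case (step1 i)
  show ?case
    using form_automorphism_comp[OF A step1(2)]
    by (simp only: int_power_Suc[OF form_automorphism_D(1)[OF A]])
next
  case (step2 i)
  show ?case
    using form_automorphism_comp[OF form_automorphism_inv[OF A] step2(2)]
    by (simp only: int_power_pred[OF form_automorphism_D(1)[OF A]])
qed

lemma form_automorphism_Td: "form_automorphism Td" and form_automorphism_Tu: "form_automorphism Tu"
  using automorphism_Td automorphism_Tu qc2_Td qc2_Tu by (auto intro: form_automorphism_generator)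

definition pw :: "int \<Rightarrow> int \<Rightarrow> 'c \<Rightarrow> 'c" where
  "pw m n x = int_power Td m (int_power Tu n x)"

lemma pw_auto: "form_automorphism (pw m n)"
  unfolding pw_def[abs_def]
  by (rule form_automorphism_comp[OF form_automorphism_int_power[OF form_automorphism_Td]
        form_automorphism_int_power[OF form_automorphism_Tu]])

lemma bij_Td: "bij Td" and bij_Tu: "bij Tu"
  using form_automorphism_D(1) form_automorphism_Td form_automorphism_Tu by auto

lemma pw_pw: "pw m n (pw m' n' x) = pw (m + m') (n + n') x"
proof -
  have "Td (Tu y) = Tu (Td y)" for y using commute by (metis comp_apply)
  then have "int_power Tu n (Td y) = Td (int_power Tu n y)" for y
    using int_power_commute[OF bij_Tu, of Td] by simp
  then have "int_power Tu n (int_power Td m' y) = int_power Td m' (int_power Tu n y)" for y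
    using int_power_commute[OF bij_Td, of "int_power Tu n" m' y] by simp
  then show ?thesis by (simp add: pw_def int_power_add bij_Td bij_Tu)
qed

lemma pw_0 [simp]: "pw 0 0 x = x"
  by (simp add: pw_def)

lemma pw_Td: "pw 1 0 = Td" and pw_Tu: "pw 0 1 = Tu"
  by (simp_all add: fun_eq_iff pw_def)

lemma lin_pw: "lin f \<Longrightarrow> lin (\<lambda>x. f (pw m n x))"
  by (simp add: lin_def form_automorphism_D[OF pw_auto])

text \<open>A common power can be removed by invariance, so a crossing sees only the difference of
  the exponents of its two lines. \<open>tform\<close> keeps this difference on the first
  argument.\<close>

lemma form_pw: "form \<sigma> (pw m n x) (pw m' n' y) = form \<sigma> (pw (m - m') (n - n') x) y"
  using form_automorphism_D(5)[OF pw_auto, of \<sigma> m' n' "pw (m - m') (n - n') x" y] by (simp add: pw_pw)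

definition tform :: "bool \<Rightarrow> int \<Rightarrow> int \<Rightarrow> 'c \<Rightarrow> 'c \<Rightarrow> 'k" where
  "tform \<sigma> m n x y = form \<sigma> (pw m n x) y"

lemma lin2_tform: "lin2 (tform \<sigma> m n)"
  unfolding lin2_def tform_def[abs_def]
  using lin2_E(1)[OF lin2_form] lin_pw[OF lin2_E(2)[OF lin2_form]] by auto

lemma inverse_form_gen:
  "sw s x (\<lambda>x1 x2. sw s y (\<lambda>y1 y2. form \<sigma> x1 y1 * form (\<not> \<sigma>) x2 y2)) = \<epsilon> x * \<epsilon> y"
  using inverse_form[of x y \<sigma>] inverse_form[of x y "\<not> \<sigma>"]
  by (cases s) (simp_all add: sw_False mult.commute)

lemma dual_same: "dual_pair s s (tform \<sigma> m n) (tform (\<not> \<sigma>) m n)"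
proof -
  have "sw s x (\<lambda>x1 x2. sw s y (\<lambda>y1 y2. tform \<sigma> m n x1 y1 * tform (\<not> \<sigma>) m n x2 y2)) = \<epsilon> x * \<epsilon> y" for \<sigma> x y
  proof -
    have "sw s x (\<lambda>x1 x2. sw s y (\<lambda>y1 y2. tform \<sigma> m n x1 y1 * tform (\<not> \<sigma>) m n x2 y2))
      = sw s y (\<lambda>y1 y2. sw s x (\<lambda>x1 x2. form \<sigma> (pw m n x1) y1 * form (\<not> \<sigma>) (pw m n x2) y2))"
      unfolding tform_def by (rule sw_sw)
    also have "\<dots> = sw s (pw m n x) (\<lambda>x1 x2. sw s y (\<lambda>y1 y2. form \<sigma> x1 y1 * form (\<not> \<sigma>) x2 y2))"
      unfolding form_automorphism_D(6)[OF pw_auto] by (rule sw_sw)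
    finally show ?thesis using form_automorphism_D(4)[OF pw_auto] by (simp add: inverse_form_gen)
  qed
  from this[where \<sigma> = \<sigma>] this[where \<sigma> = "\<not> \<sigma>"] show ?thesis by (simp add: dual_pair_def lin2_tform)
qed

text \<open>This is (qc.1), with \<open>Td\<close> and \<open>Tu\<close> moved to the first arguments.\<close>

lemma dual_opposite: "dual_pair s (\<not> s) (tform True m n) (tform False (m + 1) (n + 1))"
proof -
  let ?f = "\<lambda>\<sigma>. tform \<sigma> (if \<sigma> then m else m + 1) (if \<sigma> then n else n + 1)"
  \<comment> \<open>The power common to both factors: relative to it the first form has
    \<open>Tu\<close> on its second argument and the second form has \<open>Td\<close> on its first,
    as in (qc.1).\<close>
  let ?A = "pw m (n + 1)"
  have form: "?f True x y = form True (?A x) (Tu y)" "?f False x y = form False (Td (?A x)) y" for x y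
    using form_pw[of True m "n + 1" x 0 1 y, unfolded pw_Tu] pw_pw[of 1 0 m "n + 1" x, unfolded pw_Td]
    by (simp_all add: tform_def add.commute)
  have q: "sw True x (\<lambda>x1 x2. sw False y (\<lambda>y1 y2. ?f \<sigma> x1 y1 * ?f (\<not> \<sigma>) x2 y2)) = \<epsilon> x * \<epsilon> y" for x y \<sigma>
  proof -
    \<comment> \<open>Moving \<open>Td\<close> to the second argument leaves \<open>?A\<close> as
      the only map on \<open>x\<close> in both factors, so that its coproduct identity applies to
      the pair.\<close>
    define g where "g \<sigma> x y = (if \<sigma> then form True x (Tu y) else form False x (inv Td y))" for \<sigma> x y
    have Td: "form False (Td u) y = form False u (inv Td y)" for u y
      using form_automorphism_D(5)[OF form_automorphism_Td, of False u "inv Td y"] bij_Td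
      by (simp add: bij_is_surj surj_f_inv_f)
    have f: "?f \<sigma> x y = g \<sigma> (?A x) y" for \<sigma> x y
      using form[of x y] by (cases \<sigma>) (simp_all add: g_def Td)
    have "sw True x (\<lambda>x1 x2. sw False y (\<lambda>y1 y2. ?f \<sigma> x1 y1 * ?f (\<not> \<sigma>) x2 y2))
      = sw False y (\<lambda>y1 y2. sw True x (\<lambda>x1 x2. g \<sigma> (?A x1) y1 * g (\<not> \<sigma>) (?A x2) y2))"
      unfolding f by (rule sw_sw)
    also have "\<dots> = sw False y (\<lambda>y1 y2. sw True (?A x) (\<lambda>x1 x2. g \<sigma> x1 y1 * g (\<not> \<sigma>) x2 y2))"
      by (cases \<sigma>) (simp_all add: g_def form_automorphism_D(6)[OF pw_auto])
    also have "\<dots> = sw True (?A x) (\<lambda>x1 x2. sw False y (\<lambda>y1 y2. g \<sigma> x1 y1 * g (\<not> \<sigma>) x2 y2))"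
      by (rule sw_sw)
    also have "\<dots> = \<epsilon> (?A x) * \<epsilon> y"
      using qc1a[where c = "?A x" and d = y] qc1b[where c = "?A x" and d = y] Td
      by (cases \<sigma>) (simp_all add: g_def sw_False sw_True form_def)
    finally show ?thesis by (simp add: form_automorphism_D(4)[OF pw_auto])
  qed
  \<comment> \<open>Negating both flags exchanges the two factors, which is the claim for the other
    sign.\<close>
  have "sw s x (\<lambda>x1 x2. sw (\<not> s) y (\<lambda>y1 y2. ?f \<sigma> x1 y1 * ?f (\<not> \<sigma>) x2 y2)) = \<epsilon> x * \<epsilon> y" for x y \<sigma>
    using q[of x y \<sigma>] q[of x y "\<not> \<sigma>"] by (cases s) (simp_all add: sw_False mult.commute)
  from this[where \<sigma> = True] this[where \<sigma> = False] show ?thesis by (simp add: dual_pair_def lin2_tform)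
qed

lemma dual_opposite':
  assumes "s \<noteq> t"
  shows "dual_pair s t (tform \<sigma> m n)
    (tform (\<not> \<sigma>) (m + (if \<sigma> then 1 else - 1)) (n + (if \<sigma> then 1 else - 1)))"
proof -
  have "t = (\<not> s)" using assms by auto
  then show ?thesis
    using dual_opposite[of s m n] dual_pair_sym[OF dual_opposite[of s "m - 1" "n - 1"]]
    by (cases \<sigma>) simp_all
qed

section \<open>The Yang-Baxter equation for all signs, twists and orientations\<close>

lemma yang_baxter_b: "yang_baxter True True True b b b"
proof -
  have "lin2 b" using lin2_form[of True] by (simp add: form_def)
  then show ?thesis
    using qc3 by (auto simp: yang_baxter_def hexagon_def fun_eq_iff sw_False sw_True ac_simps)
qed

text \<open>For \<open>binv\<close> all three forms are inverted in turn. Each inversion negates one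
  flag, so at the end all are negated, which does not change the equation.\<close>

lemma yang_baxter_form: "yang_baxter True True True (form \<sigma>) (form \<sigma>) (form \<sigma>)"
proof (cases \<sigma>)
  case True then show ?thesis using yang_baxter_b by (simp add: form_def)
next
  case False
  have *: "dual_pair s s b binv" for s
    using dual_same[of s True 0 0] by (simp add: tform_def[abs_def] form_def)
  have "yang_baxter True True False binv b b"
    using yang_baxter_inv12[OF yang_baxter_b *] by simp
  from yang_baxter_inv13[OF this, of binv] have "yang_baxter True False False binv binv b"
    using * by simp
  from yang_baxter_inv23[OF this *] have "yang_baxter False False False binv binv binv" by simp
  from yang_baxter_flip[OF this] show ?thesis using False by (simp add: form_def)
qed

text \<open>As the twist of the form 13 is the sum of the other two, all twists can be carried by
  the arguments: \<open>pw m n\<close> on \<open>x\<close>, \<open>pw (- m') (- n')\<close> on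
  \<open>z\<close> and none on \<open>y\<close>.\<close>

lemma yang_baxter_tform:
  "yang_baxter True True True (tform \<sigma> m n) (tform \<sigma> (m + m') (n + n')) (tform \<sigma> m' n')"
proof -
  have "hexagon s s s (tform \<sigma> m n) (tform \<sigma> (m + m') (n + n')) (tform \<sigma> m' n') x y z
      = hexagon s s s (form \<sigma>) (form \<sigma>) (form \<sigma>) (pw m n x) y (pw (- m') (- n') z)" for s x y z
  proof -
    have g: "tform \<sigma> (m + m') (n + n') u v = form \<sigma> (pw m n u) (pw (- m') (- n') v)"
      and h: "tform \<sigma> m' n' u v = form \<sigma> u (pw (- m') (- n') v)" for u v
      using form_pw[of \<sigma> 0 0 u "- m'" "- n'" v] by (simp_all add: tform_def form_pw)
    have "hexagon s s s (tform \<sigma> m n) (tform \<sigma> (m + m') (n + n')) (tform \<sigma> m' n') x y z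
      = sw s x (\<lambda>x1 x2. sw s y (\<lambda>y1 y2. form \<sigma> (pw m n x1) y1 *
          sw s z (\<lambda>z1 z2. form \<sigma> (pw m n x2) (pw (- m') (- n') z1) * form \<sigma> y2 (pw (- m') (- n') z2))))"
      unfolding hexagon_def g h tform_def[of _ m n] by (simp add: sw_cmult mult.assoc)
    also have "\<dots> = sw s x (\<lambda>x1 x2. sw s y (\<lambda>y1 y2. sw s (pw (- m') (- n') z) (\<lambda>z1 z2.
          (form \<sigma> (pw m n x1) y1 * form \<sigma> (pw m n x2) z1) * form \<sigma> y2 z2)))"
      unfolding form_automorphism_D(7)[OF pw_auto] by (simp add: sw_cmult mult.assoc)
    also have "\<dots> = sw s y (\<lambda>y1 y2. sw s (pw (- m') (- n') z) (\<lambda>z1 z2.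
          sw s x (\<lambda>x1 x2. form \<sigma> (pw m n x1) y1 * form \<sigma> (pw m n x2) z1) * form \<sigma> y2 z2))"
      by (simp only: sw_sw[of s x] sw_multc)
    also have "\<dots> = sw s (pw m n x) (\<lambda>x1 x2. sw s y (\<lambda>y1 y2. sw s (pw (- m') (- n') z) (\<lambda>z1 z2.
          form \<sigma> x1 y1 * form \<sigma> x2 z1 * form \<sigma> y2 z2)))"
      unfolding form_automorphism_D(6)[OF pw_auto] by (simp only: sw_sw[of s "pw m n x"] sw_multc)
    finally show ?thesis by (simp add: hexagon_def)
  qed
  then show ?thesis using yang_baxter_form[of \<sigma>]
    by (simp add: yang_baxter_def fun_eq_iff lin2_tform)
qed

text \<open>The flags are the directions of the strands. Starting from equal flags, every reversal
  is made by inverting forms, and inverting across opposite flags shifts both exponents by one, by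
  (qc.1). The shifts balance unless the middle strand runs against both others; \<open>k\<close> is
  what then remains.\<close>

lemma yang_baxter_oriented:
  fixes s t u \<sigma> :: bool
  defines "k \<equiv> if s = u \<and> s \<noteq> t then (if \<sigma> then - 1 else 1) else 0"
  assumes "m13 = m12 + m23 + k" "n13 = n12 + n23 + k"
  shows "yang_baxter s t u (tform (\<sigma> = (s = t)) m12 n12) (tform (\<sigma> = (s = u)) m13 n13)
     (tform (\<sigma> = (t = u)) m23 n23)"
proof -
  have main: "yang_baxter True t u (tform (\<sigma> = t) m12 n12) (tform (\<sigma> = u) m13 n13)
     (tform (\<sigma> = (t = u)) m23 n23)"
    if "m13 = m12 + m23 + (if u \<and> \<not> t then (if \<sigma> then - 1 else 1) else 0)"
     "n13 = n12 + n23 + (if u \<and> \<not> t then (if \<sigma> then - 1 else 1) else 0)" for t u :: bool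
  proof -
    \<comment> \<open>The shift that comes with each inversion across opposite flags; it is
      subtracted beforehand so that the required exponents result.\<close>
    define j :: int where "j = (if \<sigma> then 1 else - 1)"
    have op: "s \<noteq> t \<Longrightarrow> dual_pair s t (tform \<sigma> (m - j) (n - j)) (tform (\<not> \<sigma>) m n)" for s t m n
      using dual_opposite'[of s t \<sigma> "m - j" "n - j"] by (simp add: j_def[symmetric])
    consider "t" "u" | "t" "\<not> u" | "\<not> t" "u" | "\<not> t" "\<not> u" by blast
    then show ?thesis
    proof cases
      case 1 then show ?thesis using that yang_baxter_tform[of \<sigma> m12 n12 m23 n23] by simp
    next
      case 2
      have eq: "m13 - j = m12 + (m23 - j)" "n13 - j = n12 + (n23 - j)" using 2 that by auto
      have "yang_baxter True True True (tform \<sigma> m12 n12) (tform \<sigma> (m13 - j) (n13 - j)) (tform \<sigma> (m23 - j) (n23 - j))"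
        unfolding eq by (rule yang_baxter_tform)
      from yang_baxter_inv13[OF this op]
      have "yang_baxter True False True (tform \<sigma> m12 n12) (tform (\<not> \<sigma>) m13 n13) (tform \<sigma> (m23 - j) (n23 - j))"
        by simp
      from yang_baxter_flip[OF yang_baxter_inv23[OF this op]] show ?thesis using 2 by simp
    next
      \<comment> \<open>The form 12 is inverted while the flags of its two strands still agree,
        hence without a shift. Only the form 23 shifts, and this is the origin of
        \<open>k\<close>.\<close>
      case 3
      have eq: "m13 = m12 + (m23 - j)" "n13 = n12 + (n23 - j)" using 3 that by (simp_all add: j_def)
      have "yang_baxter True True True (tform \<sigma> m12 n12) (tform \<sigma> m13 n13) (tform \<sigma> (m23 - j) (n23 - j))"
        unfolding eq by (rule yang_baxter_tform)
      from yang_baxter_inv12[OF this dual_same]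
      have "yang_baxter True True False (tform (\<not> \<sigma>) m12 n12) (tform \<sigma> m13 n13) (tform \<sigma> (m23 - j) (n23 - j))"
        by simp
      from yang_baxter_flip[OF yang_baxter_inv23[OF this op]] show ?thesis using 3 by simp
    next
      case 4
      have eq: "m13 - j = (m12 - j) + m23" "n13 - j = (n12 - j) + n23" using 4 that by auto
      have "yang_baxter True True True (tform \<sigma> (m12 - j) (n12 - j)) (tform \<sigma> (m13 - j) (n13 - j)) (tform \<sigma> m23 n23)"
        unfolding eq by (rule yang_baxter_tform)
      from yang_baxter_inv13[OF this op]
      have "yang_baxter True False True (tform \<sigma> (m12 - j) (n12 - j)) (tform (\<not> \<sigma>) m13 n13) (tform \<sigma> m23 n23)"
        by simp
      from yang_baxter_inv12[OF this op] show ?thesis using 4 by simp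
    qed
  qed
  show ?thesis
  proof (cases s)
    case True then show ?thesis using main[where t = t and u = u] assms by (auto simp: k_def)
  next
    case False
    then show ?thesis using yang_baxter_flip[OF main[where t = "\<not> t" and u = "\<not> u"]] assms
      by (auto simp: k_def)
  qed
qed

end

section \<open>Traversals of diagrams\<close>

fun next_point :: "slice list \<Rightarrow> point \<Rightarrow> (event list \<times> point) option" where
  "next_point w (k, p, True) = (if k < length w then (case w ! k of (e, i) \<Rightarrow>
     if p < i then Some ([], (Suc k, p, True))
     else if i + ends_below e \<le> p then Some ([], (Suc k, p - ends_below e + ends_above e, True))
     else (case e of
         Crossing _ \<Rightarrow> if p = i then Some ([Cross_Line k SWNE True], (Suc k, Suc i, True))
            else Some ([Cross_Line k NWSE True], (Suc k, i, True))
       | Local_Max \<Rightarrow> if p = i then Some ([U_minus], (k, Suc i, False)) else Some ([D_plus], (k, i, False))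
       | Local_Min \<Rightarrow> None)) else None)"
| "next_point w (0, p, False) = None"
| "next_point w (Suc k, p, False) = (if k < length w then (case w ! k of (e, i) \<Rightarrow>
     if p < i then Some ([], (k, p, False))
     else if i + ends_above e \<le> p then Some ([], (k, p - ends_above e + ends_below e, False))
     else (case e of
         Crossing _ \<Rightarrow> if p = i then Some ([Cross_Line k NWSE False], (k, Suc i, False))
            else Some ([Cross_Line k SWNE False], (k, i, False))
       | Local_Min \<Rightarrow> if p = i then Some ([U_plus], (Suc k, Suc i, True)) else Some ([D_minus], (Suc k, i, True))
       | Local_Max \<Rightarrow> None)) else None)"

lemma follow_imp_next: "follow w s vs s' \<Longrightarrow> next_point w s = Some (vs, s')"
  by (induction rule: follow.induct) auto

lemma next_imp_follow:
  assumes "next_point w s = Some (vs, s')" shows "follow w s vs s'"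
proof (cases "(w, s)" rule: next_point.cases)
  case (1 w k p)
  then have k: "k < length w" using assms by (auto split: if_splits)
  obtain e i where e: "w ! k = (e, i)" by fastforce
  consider (left) "p < i" | (right) "i + ends_below e \<le> p" | (at) "i \<le> p" "p < i + ends_below e" by linarith
  then show ?thesis
  proof cases
    case left then show ?thesis using assms 1 k e by (auto intro: follow.intros)
  next
    case right
    then show ?thesis using follow.up_right[OF k e, of "p - (i + ends_below e)"] assms 1 k e
      by (auto simp: algebra_simps)
  next
    case at
    then have "p = i \<or> p = Suc i" by (cases e) auto
    then consider "p = i" | "p = Suc i" by blast
    then show ?thesis using assms 1 k e at by cases (auto split: piece.splits intro: follow.intros)
  qed
next
  case (2 w p) then show ?thesis using assms by auto
next
  case (3 w k p)
  then have k: "k < length w" using assms by (auto split: if_splits)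
  obtain e i where e: "w ! k = (e, i)" by fastforce
  consider (left) "p < i" | (right) "i + ends_above e \<le> p" | (at) "i \<le> p" "p < i + ends_above e" by linarith
  then show ?thesis
  proof cases
    case left then show ?thesis using assms 3 k e by (auto intro: follow.intros)
  next
    case right
    then show ?thesis using follow.down_right[OF k e, of "p - (i + ends_above e)"] assms 3 k e
      by (auto simp: algebra_simps)
  next
    case at
    then have "p = i \<or> p = Suc i" by (cases e) auto
    then consider "p = i" | "p = Suc i" by blast
    then show ?thesis using assms 3 k e at by cases (auto split: piece.splits intro: follow.intros)
  qed
qed

lemma follow_iff: "follow w s vs s' \<longleftrightarrow> next_point w s = Some (vs, s')"
  using follow_imp_next next_imp_follow by blast

lemma follow_det: "follow w s vs s' \<Longrightarrow> follow w s vs' s'' \<Longrightarrow> vs = vs' \<and> s' = s''"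
  by (simp add: follow_iff)

fun opposite :: "point \<Rightarrow> point" where
  "opposite (k, p, u) = (k, p, \<not> u)"

lemma opposite_opposite [simp]: "opposite (opposite s) = s"
  by (cases s) simp

lemma opposite_neq: "opposite s \<noteq> s"
  by (cases s) simp

lemma follow_opposite: "follow w s vs s' \<Longrightarrow> \<exists>vs'. follow w (opposite s') vs' (opposite s)"
  by (induction rule: follow.induct) (auto intro: follow.intros)

text \<open>Reversal turns two steps into the same point into two steps out of one point, where
  determinism applies.\<close>

lemma follow_inj: "follow w s vs t \<Longrightarrow> follow w s' vs' t \<Longrightarrow> s = s'"
  by (metis follow_det follow_opposite opposite_opposite)

lemma not_follow_opposite: "\<not> follow w s vs (opposite s)"
proof
  have "follow w s vs t \<Longrightarrow> t \<noteq> opposite s" for t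
    by (induction rule: follow.induct) auto
  moreover assume "follow w s vs (opposite s)"
  ultimately show False by blast
qed

text \<open>A crossing line can be run along in only two ways, and each is the reversal of the
  other.\<close>

lemma follow_Cross_Line:
  assumes "follow w q [Cross_Line k l up] q'"
  shows "k \<in> crossings w"
    and "follow w r [Cross_Line k l up'] r' \<Longrightarrow>
      (if up = up' then r = q \<and> r' = q' else r = opposite q' \<and> r' = opposite q)"
  using assms by (auto elim!: follow.cases simp: crossings_def)

lemma follow_events: "follow w s vs s' \<Longrightarrow> vs = [] \<or> (\<exists>v. vs = [v])"
  by (auto elim: follow.cases)

text \<open>\<open>travel\<close> with its length: the length serves for induction, and it bounds
  every initial part of a run to a terminal point.\<close>

inductive steps :: "slice list \<Rightarrow> nat \<Rightarrow> point \<Rightarrow> event list \<Rightarrow> point \<Rightarrow> bool" for w where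
  steps_0: "steps w 0 s [] s"
| steps_Suc: "follow w s vs s' \<Longrightarrow> steps w n s' vs' s'' \<Longrightarrow> steps w (Suc n) s (vs @ vs') s''"

lemma steps_travel: "steps w n s vs t \<Longrightarrow> travel w s vs t"
  by (induction rule: steps.induct) (auto intro: travel.intros)

lemma travel_steps: "travel w s vs t \<Longrightarrow> \<exists>n. steps w n s vs t"
  by (induction rule: travel.induct) (auto intro: steps.intros)

lemma steps_0_iff [simp]: "steps w 0 s vs t \<longleftrightarrow> vs = [] \<and> t = s"
  by (auto intro: steps.intros elim: steps.cases)

lemma steps_SucE:
  assumes "steps w (Suc n) s vs t"
  obtains us r vs' where "follow w s us r" "steps w n r vs' t" "vs = us @ vs'"
  using assms by (auto elim: steps.cases)

lemma steps_append: "steps w n s vs t \<Longrightarrow> steps w m t vs' r \<Longrightarrow> steps w (n + m) s (vs @ vs') r"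
  by (induction rule: steps.induct) (auto intro: steps.intros)

lemma steps_split: "steps w n s vs t \<Longrightarrow> steps w (n + m) s vs' r \<Longrightarrow> \<exists>us. vs' = vs @ us \<and> steps w m t us r"
proof (induction arbitrary: vs' rule: steps.induct)
  case (steps_Suc s us s' n us' s'')
  from steps_Suc.prems have "steps w (Suc (n + m)) s vs' r" by simp
  then obtain x r' y where x: "follow w s x r'" "steps w (n + m) r' y r" "vs' = x @ y"
    by (rule steps_SucE)
  then have "x = us" "r' = s'" using follow_det steps_Suc.hyps(1) by blast+
  then show ?case using x steps_Suc.IH by auto
qed simp

lemma steps_last: "steps w (Suc n) s vs t \<Longrightarrow> \<exists>us r us'. steps w n s us r \<and> follow w r us' t \<and> vs = us @ us'"
proof (induction n arbitrary: s vs)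
  case 0 then show ?case by (auto elim!: steps_SucE)
next
  case (Suc n)
  then obtain x r y where x: "follow w s x r" "steps w (Suc n) r y t" "vs = x @ y"
    by (auto elim: steps_SucE)
  from Suc.IH[OF x(2)] obtain us q us' where "steps w n r us q" "follow w q us' t" "y = us @ us'" by blast
  then show ?case using x steps_Suc[OF x(1)] by (metis append.assoc)
qed

definition terminal :: "slice list \<Rightarrow> point \<Rightarrow> bool" where
  "terminal w t \<longleftrightarrow> next_point w t = None"

lemma terminal_steps: "terminal w t \<Longrightarrow> steps w n t vs r \<Longrightarrow> n = 0 \<and> vs = [] \<and> r = t"
  by (cases n) (auto simp: terminal_def follow_iff elim!: steps_SucE)

lemma steps_le_terminal:
  assumes "steps w n s vs t" "terminal w t" "steps w m s vs' r" shows "m \<le> n"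
proof (rule ccontr)
  assume "\<not> m \<le> n"
  then obtain d where "m = n + Suc d" by (metis less_imp_Suc_add linorder_not_le add_Suc_right)
  then show False using steps_split[OF assms(1), of "Suc d"] assms terminal_steps by blast
qed

lemma steps_terminal_unique:
  assumes "steps w n s vs t" "terminal w t" "steps w m s vs' t'" "terminal w t'"
  shows "n = m \<and> vs = vs' \<and> t = t'"
proof -
  have "n = m" using assms steps_le_terminal by (metis le_antisym)
  then show ?thesis using steps_split[OF assms(1), of 0 vs' t'] assms(3) by auto
qed

text \<open>A path from a point to its opposite would be its own reversal, and hence turn around at a point
  or on a single step.\<close>

lemma not_steps_opposite: "\<not> steps w n s vs (opposite s)"
proof (induction n arbitrary: s vs rule: less_induct)
  case (less n)
  show ?case
  proof
    assume *: "steps w n s vs (opposite s)"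
    then obtain m where n: "n = Suc m" using opposite_neq by (cases n) auto
    then obtain us r vs' where f: "follow w s us r" "steps w m r vs' (opposite s)"
      using * by (auto elim: steps_SucE)
    show False
    proof (cases m)
      case 0 then show ?thesis using f not_follow_opposite by (metis steps_0_iff)
    next
      case (Suc j)
      then obtain xs q ys where q: "steps w j r xs q" "follow w q ys (opposite s)"
        using f steps_last by blast
      have "q = opposite r" using follow_opposite[OF f(1)] q(2) follow_inj by blast
      then show False using less[of j] q(1) n Suc by auto
    qed
  qed
qed

fun line_keys :: "event list \<Rightarrow> (nat \<times> line) list" where
  "line_keys [] = []"
| "line_keys (v # vs) = (case v of Cross_Line k l up \<Rightarrow> (k, l) # line_keys vs | _ \<Rightarrow> line_keys vs)"

lemma line_keys_append [simp]: "line_keys (vs @ vs') = line_keys vs @ line_keys vs'"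
  by (induction vs) (auto split: event.splits)

lemma set_line_keys: "(k, l) \<in> set (line_keys vs) \<longleftrightarrow> (\<exists>up. Cross_Line k l up \<in> set vs)"
  by (induction vs) (auto split: event.splits)

lemma steps_event:
  assumes "steps w n s vs t" "v \<in> set vs"
  shows "\<exists>i q q' j us us'. steps w i s us q \<and> follow w q [v] q' \<and> steps w j q' us' t \<and> n = Suc (i + j)"
  using assms
proof induction
  case (steps_Suc s vs s' n vs' s'')
  show ?case
  proof (cases "v \<in> set vs")
    case True
    then have vs: "vs = [v]" using follow_events[OF steps_Suc.hyps(1)] by auto
    have "steps w 0 s [] s" by simp
    moreover have "follow w s [v] s'" using steps_Suc.hyps(1) vs by simp
    ultimately show ?thesis using steps_Suc.hyps(2) by fastforce
  next
    case False
    then obtain i q q' j us us' where *: "steps w i s' us q" "follow w q [v] q'" "steps w j q' us' s''" "n = Suc (i + j)"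
      using steps_Suc by auto
    have "steps w (Suc i) s (vs @ us) q" using steps.steps_Suc[OF steps_Suc.hyps(1) *(1)] .
    moreover have "Suc n = Suc (Suc i + j)" using *(4) by simp
    ultimately show ?thesis using *(2,3) by blast
  qed
qed simp

text \<open>Meeting a line again in the same direction would give two runs of different lengths from
  one point to the terminal point. Meeting it in the opposite direction would give a path from a
  point to its opposite.\<close>

lemma distinct_line_keys: "steps w n s vs t \<Longrightarrow> terminal w t \<Longrightarrow> distinct (line_keys vs)"
proof (induction rule: steps.induct)
  case (steps_Suc s vs s' n vs' s'')
  consider (cross) k l up where "vs = [Cross_Line k l up]" | (other) "line_keys vs = []"
  proof (cases "line_keys vs = []")
    case False
    then obtain v where v: "vs = [v]" using follow_events[OF steps_Suc.hyps(1)] by auto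
    then show ?thesis using False cross by (cases v) auto
  qed
  then show ?case
  proof cases
    case cross
    note f = steps_Suc.hyps(1)[unfolded cross]
    have "(k, l) \<notin> set (line_keys vs')"
    proof
      assume "(k, l) \<in> set (line_keys vs')"
      then obtain up' where "Cross_Line k l up' \<in> set vs'" by (auto simp: set_line_keys)
      from steps_event[OF steps_Suc.hyps(2) this]
      obtain i q q' j us us' where q: "steps w i s' us q" "follow w q [Cross_Line k l up'] q'"
        "steps w j q' us' s''" "n = Suc (i + j)" by blast
      show False
      proof (cases "up' = up")
        case True
        then have "q = s" "q' = s'" using follow_Cross_Line(2)[OF f q(2)] by auto
        then have "n = j" using steps_terminal_unique steps_Suc.hyps(2) q(3) steps_Suc.prems by blast
        then show False using q(4) by simp
      next
        case False
        then have "q = opposite s'" using follow_Cross_Line(2)[OF f q(2)] by (auto split: if_splits)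
        then show False using q(1) not_steps_opposite by blast
      qed
    qed
    then show ?thesis using cross steps_Suc by simp
  next
    case other
    then show ?thesis using steps_Suc by simp
  qed
qed simp

section \<open>Complete traversals of a tangle diagram\<close>

lemma strands_take:
  assumes "strands n w = Some m" "k < length w" "w ! k = (e, i)"
  shows "\<exists>n'. strands n (take k w) = Some n' \<and> i + ends_below e \<le> n'"
  using assms
proof (induction w arbitrary: n k)
  case (Cons a w)
  obtain f j where a: "a = (f, j)" by fastforce
  show ?case
  proof (cases k)
    case 0 then show ?thesis using Cons a by (auto split: if_splits)
  next
    case (Suc k')
    then show ?thesis using Cons.IH[of "n - ends_below f + ends_above f" k'] Cons.prems a
      by (auto split: if_splits)
  qed
qed simp

lemma terminal_end_point: "terminal w (end_point (Diagram w u))"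
  by (simp add: terminal_def)

lemma not_follow_into_bottom: "\<not> follow w s vs (0, p, True)"
  by (auto elim: follow.cases)

lemma not_follow_into_top: "\<not> follow w s vs (length w, p, False)"
  by (auto elim: follow.cases)

lemma steps_into:
  assumes "steps w n s vs t" "t \<noteq> s"
  shows "\<exists>r us. follow w r us t"
proof (cases n)
  case 0 then show ?thesis using assms by simp
next
  case (Suc m) then show ?thesis using steps_last[of w m s vs t] assms(1) by blast
qed

lemma Tang_travel:
  assumes "Diagram w u \<in> Tang" "k \<le> length w" "strands 1 (take k w) = Some n" "p < n"
  obtains m vs u' where "steps w m (base_point (Diagram w u)) vs (k, p, u')"
proof -
  obtain vs u' where "travel w (base_point (Diagram w u)) vs (k, p, u')"
    using assms unfolding Tang_def mem_Collect_eq diagram.sel by blast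
  then show thesis using travel_steps that by blast
qed

text \<open>The condition that every point is met, applied at the level of the end point, yields a
  run to that place in some direction. The wrong direction cannot be entered by any step and is not
  the base point.\<close>

lemma Tang_steps:
  assumes "Diagram w u \<in> Tang"
  obtains n vs where "steps w n (base_point (Diagram w u)) vs (end_point (Diagram w u))"
proof -
  define k where "k = (if u then length w else 0)"
  have "strands 1 w = Some 1" using assms by (simp add: Tang_def)
  then have st: "strands 1 (take k w) = Some 1" by (simp add: k_def)
  have k: "k \<le> length w" by (simp add: k_def)
  obtain n vs u' where n: "steps w n (base_point (Diagram w u)) vs (k, 0, u')"
    by (rule Tang_travel[OF assms k st zero_less_one])
  have "u' = u"
  proof (rule ccontr)
    assume ne: "u' \<noteq> u"
    then have "(k, 0, u') \<noteq> base_point (Diagram w u)" by auto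
    then show False using steps_into[OF n] ne not_follow_into_bottom not_follow_into_top
      by (cases u; cases u') (auto simp: k_def)
  qed
  then have "steps w n (base_point (Diagram w u)) vs (end_point (Diagram w u))"
    using n by (simp add: k_def split: if_splits)
  then show thesis by (rule that)
qed

lemma events_eq:
  assumes "steps w n (base_point (Diagram w u)) vs (end_point (Diagram w u))"
  shows "events (Diagram w u) = vs"
  unfolding events_def
proof (rule the_equality)
  show "travel (slices (Diagram w u)) (base_point (Diagram w u)) vs (end_point (Diagram w u))"
    using steps_travel[OF assms] by simp
  fix vs' assume "travel (slices (Diagram w u)) (base_point (Diagram w u)) vs' (end_point (Diagram w u))"
  then obtain m where "steps w m (base_point (Diagram w u)) vs' (end_point (Diagram w u))"
    unfolding diagram.sel using travel_steps by blast
  then show "vs' = vs"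
    using steps_terminal_unique assms terminal_end_point by blast
qed

lemma Tang_events:
  assumes "Diagram w u \<in> Tang"
  obtains n where "steps w n (base_point (Diagram w u)) (events (Diagram w u)) (end_point (Diagram w u))"
  using Tang_steps[OF assms] events_eq by metis

lemma distinct_line_keys_events: "Diagram w u \<in> Tang \<Longrightarrow> distinct (line_keys (events (Diagram w u)))"
  using distinct_line_keys terminal_end_point Tang_events by metis

text \<open>For the converse inclusion consider the lower end of the line, which the traversal
  meets. If it is passed upward, the line comes in the next step; if downward, it came in the
  preceding one.\<close>

lemma set_line_keys_events:
  assumes T: "Diagram w u \<in> Tang"
  shows "set (line_keys (events (Diagram w u))) = crossings w \<times> UNIV"
proof -
  let ?s = "base_point (Diagram w u)" and ?t = "end_point (Diagram w u)" and ?es = "events (Diagram w u)"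
  obtain n where n: "steps w n ?s ?es ?t" using Tang_events[OF T] .
  have "k \<in> crossings w" if "(k, l) \<in> set (line_keys ?es)" for k l
  proof -
    obtain up where "Cross_Line k l up \<in> set ?es" using \<open>(k, l) \<in> set (line_keys ?es)\<close>
      by (auto simp: set_line_keys)
    from steps_event[OF n this] show ?thesis using follow_Cross_Line(1) by blast
  qed
  moreover have "(k, l) \<in> set (line_keys ?es)" if "k \<in> crossings w" for k l
  proof -
    obtain l' i where k: "k < length w" "w ! k = (Crossing l', i)"
      using \<open>k \<in> crossings w\<close> by (auto simp: crossings_def)
    define p where "p = (if l = SWNE then i else Suc i)"
    obtain n' where n': "strands 1 (take k w) = Some n'" "i + 2 \<le> n'"
      using strands_take[of 1 w 1, OF _ k] T by (auto simp: Tang_def)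
    have "k \<le> length w" "p < n'" using k n' by (auto simp: p_def)
    then obtain m vs u' where m: "steps w m ?s vs (k, p, u')"
      using Tang_travel[OF T] n'(1) by blast
    \<comment> \<open>The run to the lower end is an initial part of the complete traversal.\<close>
    have "m + (n - m) = n" using steps_le_terminal[OF n terminal_end_point m] by simp
    then obtain us where us: "?es = vs @ us" "steps w (n - m) (k, p, u') us ?t"
      using steps_split[OF m, of "n - m" ?es ?t] n by metis
    have "\<exists>up. Cross_Line k l up \<in> set ?es"
    proof (cases u')
      case True
      have "(k, p, u') \<noteq> ?t" using k True by auto
      then obtain j where "n - m = Suc j" using us(2) by (cases "n - m") auto
      then obtain xs r ys where "follow w (k, p, True) xs r" "us = xs @ ys"
        using us(2) True by (auto elim: steps_SucE)
      moreover have "follow w (k, p, True) [Cross_Line k l True] (Suc k, if l = SWNE then Suc i else i, True)"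
        using k by (cases l) (auto simp: p_def intro: follow.intros)
      ultimately have "xs = [Cross_Line k l True]" using follow_det by blast
      then show ?thesis using us(1) \<open>us = xs @ ys\<close> by auto
    next
      case False
      have "(k, p, u') \<noteq> ?s" using k False by auto
      then obtain j where "m = Suc j" using m by (cases m) auto
      then have "steps w (Suc j) ?s vs (k, p, False)" using m False by simp
      then obtain xs r ys where r: "follow w r ys (k, p, False)" "vs = xs @ ys"
        using steps_last by blast
      have f: "follow w (Suc k, if l = SWNE then Suc i else i, False) [Cross_Line k l False] (k, p, False)"
        using k by (cases l) (auto simp: p_def intro: follow.intros)
      have "ys = [Cross_Line k l False]" using follow_inj[OF r(1) f] r(1) f follow_det by blast
      then show ?thesis using us(1) r(2) by auto
    qed
    then show ?thesis by (auto simp: set_line_keys)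
  qed
  ultimately show ?thesis by auto
qed

text \<open>\<open>(True, p)\<close> is a strand entering (or leaving) a middle part of a diagram in the upward direction at
  position \<open>p\<close>; \<open>(False, p)\<close> is one directed downward.\<close>

type_synonym strand = "bool \<times> nat"

section \<open>Cutting the traversal at a middle part\<close>

fun entry_point :: "slice list \<Rightarrow> strand \<Rightarrow> point" where
  "entry_point l (u, p) = (if u then 0 else length l, p, u)"

fun exit_point :: "slice list \<Rightarrow> strand \<Rightarrow> point" where
  "exit_point l (u, p) = (if u then length l else 0, p, u)"

text \<open>Passages are prescribed at all positions, also beyond the strands actually present, so
  that no bounds have to be carried along.\<close>

definition realizes :: "slice list \<Rightarrow> (strand \<Rightarrow> strand) \<Rightarrow> (strand \<Rightarrow> event list) \<Rightarrow> bool" where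
  "realizes l conn X \<longleftrightarrow> (\<forall>s. travel l (entry_point l s) (X s) (exit_point l (conn s)))"

fun shift_point :: "nat \<Rightarrow> point \<Rightarrow> point" where
  "shift_point a (k, p, u) = (a + k, p, u)"

fun map_crossing :: "(nat \<Rightarrow> nat) \<Rightarrow> event \<Rightarrow> event" where
  "map_crossing h (Cross_Line k l up) = Cross_Line (h k) l up"
| "map_crossing h v = v"

abbreviation shift_event :: "nat \<Rightarrow> event \<Rightarrow> event" where "shift_event a \<equiv> map_crossing ((+) a)"

text \<open>A traversal of \<open>v @ l @ w\<close> in which the passages through \<open>l\<close> are not resolved: the flag in \<open>Outer\<close>
  and in a node tells the lower part \<open>v\<close> from the upper part \<open>w\<close>.\<close>

datatype macro = Outer bool event | Pass strand

type_synonym node = "bool \<times> point"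

fun exit_node :: "slice list \<Rightarrow> strand \<Rightarrow> node" where
  "exit_node v (u, p) = (if u then (False, (0, p, True)) else (True, (length v, p, False)))"

inductive macro_travel ::
    "slice list \<Rightarrow> slice list \<Rightarrow> (strand \<Rightarrow> strand) \<Rightarrow> node \<Rightarrow> macro list \<Rightarrow> node \<Rightarrow> bool"
  for v w conn where
  macro_stop: "macro_travel v w conn s [] s"
| macro_below: "follow v s vs s' \<Longrightarrow> macro_travel v w conn (True, s') M t \<Longrightarrow>
    macro_travel v w conn (True, s) (map (Outer True) vs @ M) t"
| macro_above: "follow w s vs s' \<Longrightarrow> macro_travel v w conn (False, s') M t \<Longrightarrow>
    macro_travel v w conn (False, s) (map (Outer False) vs @ M) t"
| macro_up: "macro_travel v w conn (exit_node v (conn (True, p))) M t \<Longrightarrow>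
    macro_travel v w conn (True, (length v, p, True)) (Pass (True, p) # M) t"
| macro_down: "macro_travel v w conn (exit_node v (conn (False, p))) M t \<Longrightarrow>
    macro_travel v w conn (False, (0, p, False)) (Pass (False, p) # M) t"

fun embed :: "nat \<Rightarrow> node \<Rightarrow> point" where
  "embed a (below, s) = (if below then s else shift_point a s)"

fun expand :: "nat \<Rightarrow> nat \<Rightarrow> (strand \<Rightarrow> event list) \<Rightarrow> macro list \<Rightarrow> event list" where
  "expand a n X [] = []"
| "expand a n X (Outer below v # M) = (if below then v else shift_event (a + n) v) # expand a n X M"
| "expand a n X (Pass s # M) = map (shift_event a) (X s) @ expand a n X M"

lemma expand_append: "expand a n X (M @ M') = expand a n X M @ expand a n X M'"
  by (induction a n X M rule: expand.induct) auto

lemma expand_Outer: "expand a n X (map (Outer below) vs) = (if below then vs else map (shift_event (a + n)) vs)"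
  by (induction vs) auto

lemma follow_extend: "follow v s vs s' \<Longrightarrow> follow (v @ w) s vs s'"
  by (induction rule: follow.induct) (auto intro: follow.intros simp: nth_append)

lemma follow_shift:
  "follow w s vs s' \<Longrightarrow> follow (v @ w) (shift_point (length v) s) (map (shift_event (length v)) vs)
     (shift_point (length v) s')"
  by (induction rule: follow.induct) (auto intro: follow.intros simp: nth_append)

lemma steps_middle:
  "steps l n s vs s' \<Longrightarrow> steps (v @ l @ w) n (shift_point (length v) s) (map (shift_event (length v)) vs)
     (shift_point (length v) s')"
proof (induction rule: steps.induct)
  case (steps_Suc s us s' n us' s'')
  then show ?case using follow_shift[OF follow_extend[OF steps_Suc.hyps(1)], of v w] steps.steps_Suc
    by fastforce
qed (auto intro: steps.intros)

lemma steps_pass: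
  assumes "realizes l conn X"
  shows "\<exists>n. steps (v @ l @ w) n (shift_point (length v) (entry_point l s))
     (map (shift_event (length v)) (X s)) (embed (length v + length l) (exit_node v (conn s)))"
proof -
  have "travel l (entry_point l s) (X s) (exit_point l (conn s))" using assms unfolding realizes_def by blast
  then obtain n where n: "steps l n (entry_point l s) (X s) (exit_point l (conn s))" using travel_steps by blast
  have "shift_point (length v) (exit_point l (conn s)) = embed (length v + length l) (exit_node v (conn s))"
    by (cases "conn s") auto
  then show ?thesis using steps_middle[OF n, of v w] by auto
qed

lemma expand_steps:
  assumes "macro_travel v w conn s M t" and r: "realizes l conn X"
  shows "\<exists>n. steps (v @ l @ w) n (embed (length v + length l) s) (expand (length v) (length l) X M)
    (embed (length v + length l) t)"
  using assms(1)
proof induction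
  case (macro_stop s) then show ?case by (intro exI[of _ 0]) simp
next
  case (macro_below s vs s' M t)
  then obtain n where "steps (v @ l @ w) n s' (expand (length v) (length l) X M) (embed (length v + length l) t)"
    by auto
  from steps.steps_Suc[OF follow_extend[OF macro_below.hyps(1)] this]
  show ?case by (auto simp: expand_append expand_Outer)
next
  case (macro_above s vs s' M t)
  then obtain n where "steps (v @ l @ w) n (shift_point (length (v @ l)) s')
     (expand (length v) (length l) X M) (embed (length v + length l) t)"
    by auto
  then have "steps ((v @ l) @ w) n (shift_point (length (v @ l)) s')
     (expand (length v) (length l) X M) (embed (length v + length l) t)"
    by simp
  from steps.steps_Suc[OF follow_shift[OF macro_above.hyps(1)] this]
  show ?case by (auto simp: expand_append expand_Outer)
next
  case (macro_up p M t)
  then obtain m where m: "steps (v @ l @ w) m (embed (length v + length l) (exit_node v (conn (True, p))))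
    (expand (length v) (length l) X M) (embed (length v + length l) t)" by blast
  obtain n where "steps (v @ l @ w) n (shift_point (length v) (entry_point l (True, p)))
     (map (shift_event (length v)) (X (True, p))) (embed (length v + length l) (exit_node v (conn (True, p))))"
    using steps_pass[OF r] by blast
  from steps_append[OF this m] show ?case by auto
next
  case (macro_down p M t)
  then obtain m where m: "steps (v @ l @ w) m (embed (length v + length l) (exit_node v (conn (False, p))))
    (expand (length v) (length l) X M) (embed (length v + length l) t)" by blast
  obtain n where "steps (v @ l @ w) n (shift_point (length v) (entry_point l (False, p)))
     (map (shift_event (length v)) (X (False, p))) (embed (length v + length l) (exit_node v (conn (False, p))))"
    using steps_pass[OF r] by blast
  from steps_append[OF this m] show ?case by auto
qed

lemma ex_follow_up: "k < length w \<Longrightarrow> \<exists>vs s'. follow w (k, p, True) vs s'"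
  by (cases "w ! k"; cases "fst (w ! k)") (auto simp: follow_iff)

lemma ex_follow_down: "k < length w \<Longrightarrow> \<exists>vs s'. follow w (Suc k, p, False) vs s'"
  by (cases "w ! k"; cases "fst (w ! k)") (auto simp: follow_iff)

lemma follow_level: "follow w s vs s' \<Longrightarrow> fst s' \<le> length w"
  by (induction rule: follow.induct) auto

fun valid_node :: "slice list \<Rightarrow> slice list \<Rightarrow> node \<Rightarrow> bool" where
  "valid_node v w (below, (k, p, u)) = (k \<le> (if below then length v else length w))"

lemma not_terminal:
  "\<not> terminal w (k, p, True) \<Longrightarrow> k < length w" "\<not> terminal w (k, p, False) \<Longrightarrow> 0 < k"
proof -
  show "k < length w" if "\<not> terminal w (k, p, True)"
    using that by (cases "k < length w") (simp_all add: terminal_def)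
  show "0 < k" if "\<not> terminal w (k, p, False)"
    using that by (cases k) (simp_all add: terminal_def)
qed

lemma macro_cases:
  assumes "valid_node v w s" "\<not> terminal (v @ l @ w) (embed (length v + length l) s)"
  obtains (below) q vs q' where "s = (True, q)" "follow v q vs q'"
  | (above) q vs q' where "s = (False, q)" "follow w q vs q'"
  | (up) p where "s = (True, (length v, p, True))"
  | (down) p where "s = (False, (0, p, False))"
proof -
  obtain r k p u where s: "s = (r, (k, p, u))" by (metis prod.exhaust)
  have nt: "\<not> terminal (v @ l @ w) (if r then (k, p, u) else (length v + length l + k, p, u))"
    and va: "k \<le> length (if r then v else w)"
    using assms s by (cases r; simp)+
  have "(\<exists>vs q'. follow (if r then v else w) (k, p, u) vs q') \<or> s = (True, (length v, p, True)) \<or> s = (False, (0, p, False))"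
  proof (cases u)
    case True
    have "k < length (if r then v else w) \<or> r \<and> k = length v"
      using nt va not_terminal(1)[of "v @ l @ w" "length v + length l + k" p] True by (cases r) auto
    then show ?thesis using ex_follow_up[of k "if r then v else w" p] True s by auto
  next
    case False
    then have "k = 0 \<longrightarrow> \<not> r" using nt not_terminal(2)[of "v @ l @ w" k p] by (cases r) auto
    then show ?thesis using ex_follow_down[of "k - 1" "if r then v else w" p] False s va
      by (cases k) auto
  qed
  then show thesis using that s by (cases r) auto
qed

text \<open>Induction on the number of remaining steps. A passage has to consume at least one of
  them, which is where \<open>l\<close> being nonempty enters.\<close>

lemma factor_steps:
  assumes "realizes l conn X" "l \<noteq> []"
    and "steps (v @ l @ w) n (embed (length v + length l) s) es t" "terminal (v @ l @ w) t" "valid_node v w s"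
  shows "\<exists>M t'. macro_travel v w conn s M t' \<and> embed (length v + length l) t' = t \<and> valid_node v w t'"
  using assms(3,5)
proof (induction n arbitrary: s es rule: less_induct)
  case (less n)
  let ?e = "embed (length v + length l)" and ?W = "v @ l @ w"
  have *: "\<exists>M t'. macro_travel v w conn s' M t' \<and> ?e t' = t \<and> valid_node v w t'"
    if st: "steps ?W (Suc m) (?e s) es' (?e s')" and va: "valid_node v w s'" for m s' es'
  proof -
    have "Suc m \<le> n" using steps_le_terminal[OF less.prems(1) assms(4) st] .
    then have "Suc m + (n - Suc m) = n" by simp
    then obtain us where "steps ?W (n - Suc m) (?e s') us t"
      using steps_split[OF st, of "n - Suc m" es t] less.prems(1) by metis
    then show ?thesis using less.IH[of "n - Suc m"] \<open>Suc m \<le> n\<close> va by auto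
  qed
  have pass: "\<exists>M t'. macro_travel v w conn (exit_node v (conn q)) M t' \<and> ?e t' = t \<and> valid_node v w t'"
    if eq: "?e s = shift_point (length v) (entry_point l q)" for q
  proof -
    obtain m where m: "steps ?W m (?e s) (map (shift_event (length v)) (X q)) (?e (exit_node v (conn q)))"
      unfolding eq using steps_pass[OF assms(1)] by blast
    moreover have "?e (exit_node v (conn q)) \<noteq> ?e s"
      unfolding eq using assms(2) by (cases "conn q"; cases q) auto
    ultimately obtain m' where "m = Suc m'" by (cases m) auto
    moreover have "valid_node v w (exit_node v (conn q))" by (cases "conn q") auto
    ultimately show ?thesis using * m by blast
  qed
  show ?case
  proof (cases "terminal ?W (?e s)")
    case True
    then have "?e s = t" using terminal_steps less.prems(1) by blast
    then show ?thesis using macro_stop less.prems(2) by blast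
  next
    case False
    from less.prems(2) False show ?thesis
    proof (cases rule: macro_cases)
      case (below q vs q')
      have "steps ?W (Suc 0) (?e s) (vs @ []) (?e (True, q'))"
        using follow_extend[OF below(2)] below(1) by (intro steps.intros) auto
      moreover have "valid_node v w (True, q')" using follow_level[OF below(2)] by (cases q') auto
      ultimately show ?thesis using * macro_below[OF below(2)] below(1) by metis
    next
      case (above q vs q')
      have "steps ?W (Suc 0) (?e s) (map (shift_event (length (v @ l))) vs @ []) (?e (False, q'))"
        using follow_shift[OF above(2), of "v @ l"] above(1) by (intro steps.intros) auto
      moreover have "valid_node v w (False, q')" using follow_level[OF above(2)] by (cases q') auto
      ultimately show ?thesis using * macro_above[OF above(2)] above(1) by metis
    next
      case (up p)
      then show ?thesis using pass[of "(True, p)"] macro_up by fastforce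
    next
      case (down p)
      then show ?thesis using pass[of "(False, p)"] macro_down by fastforce
    qed
  qed
qed

lemma macro_travel_below:
  "macro_travel v w conn s M t \<Longrightarrow> Outer True (Cross_Line k z up) \<in> set M \<Longrightarrow> k < length v"
proof (induction rule: macro_travel.induct)
  case (macro_below s vs s' M t)
  then have "Cross_Line k z up \<in> set vs \<or> Outer True (Cross_Line k z up) \<in> set M" by auto
  then show ?case
  proof
    assume "Cross_Line k z up \<in> set vs"
    then have "vs = [Cross_Line k z up]" using follow_events[OF macro_below.hyps(1)] by auto
    then have "k \<in> crossings v" using macro_below.hyps(1) follow_Cross_Line(1) by blast
    then show ?thesis by (simp add: crossings_def)
  qed (rule macro_below.IH)
qed auto

text \<open>Only the diagram with \<open>l\<close> is factored. The list \<open>M\<close> depends on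
  the middle part through \<open>conn\<close> alone, so its expansion through \<open>r\<close> is a
  run from base point to end point of the other diagram, and uniqueness of such runs identifies it.
  In this way \<open>r\<close> may be empty.\<close>

lemma events_expand:
  assumes l: "realizes l conn X" "l \<noteq> []" "Diagram (v @ l @ w) u \<in> Tang"
    and r: "realizes r conn Y"
  obtains M where "events (Diagram (v @ l @ w) u) = expand (length v) (length l) X M"
    and "events (Diagram (v @ r @ w) u) = expand (length v) (length r) Y M"
    and "\<And>k z up. Outer True (Cross_Line k z up) \<in> set M \<Longrightarrow> k < length v"
proof -
  define s :: node where "s = (if u then (True, (0, 0, True)) else (False, (length w, 0, False)))"
  define t :: node where "t = (if u then (False, (length w, 0, True)) else (True, (0, 0, False)))"
  have s: "embed (length v + length m) s = base_point (Diagram (v @ m @ w) u)"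
    and t: "embed (length v + length m) t = end_point (Diagram (v @ m @ w) u)" for m
    by (simp_all add: s_def t_def)
  obtain n where "steps (v @ l @ w) n (embed (length v + length l) s) (events (Diagram (v @ l @ w) u))
      (end_point (Diagram (v @ l @ w) u))"
    unfolding s using Tang_events[OF l(3)] .
  moreover have "valid_node v w s" by (simp add: s_def)
  ultimately have "\<exists>M t'. macro_travel v w conn s M t' \<and>
      embed (length v + length l) t' = end_point (Diagram (v @ l @ w) u) \<and> valid_node v w t'"
    using factor_steps[OF l(1,2)] terminal_end_point by blast
  then obtain M t' where M: "macro_travel v w conn s M t'"
    "embed (length v + length l) t' = end_point (Diagram (v @ l @ w) u)" "valid_node v w t'"
    by blast
  \<comment> \<open>A nonempty middle part separates the levels of the two outer parts, so the end
    point comes from only one valid node.\<close>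
  have "t' = t"
    using M(2,3) l(2) by (cases t') (auto simp: t_def split: if_splits)
  note M = M(1)[unfolded this]
  have "events (Diagram (v @ m @ w) u) = expand (length v) (length m) Z M" if "realizes m conn Z" for m Z
    using expand_steps[OF M that] events_eq unfolding s t by blast
  then show thesis using that l(1) r macro_travel_below[OF M] by blast
qed

section \<open>State sums\<close>

context coalgebra begin

text \<open>The Sweedler sum over the iterated coproduct of \<open>c\<close>, whose factors are stored, together with the
  given information, in the listed slots of an environment. A trailing factor is absorbed by the
  counit, so that the empty list makes sense.\<close>

fun state_sum :: "('a \<times> 'i) list \<Rightarrow> (('a \<Rightarrow> 'i \<times> 'c) \<Rightarrow> 'k) \<Rightarrow> ('a \<Rightarrow> 'i \<times> 'c) \<Rightarrow> 'c \<Rightarrow> 'k" where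
  "state_sum [] F e c = \<epsilon> c * F e"
| "state_sum ((k, i) # ks) F e c = sw True c (\<lambda>x y. state_sum ks F (e(k := (i, x))) y)"

definition multilinear :: "'a set \<Rightarrow> (('a \<Rightarrow> 'i \<times> 'c) \<Rightarrow> 'k) \<Rightarrow> bool" where
  "multilinear K F \<longleftrightarrow> (\<forall>k\<in>K. \<forall>e i. lin (\<lambda>x. F (e(k := (i, x)))))"

definition insensitive :: "'a \<Rightarrow> (('a \<Rightarrow> 'i \<times> 'c) \<Rightarrow> 'k) \<Rightarrow> bool" where
  "insensitive k F \<longleftrightarrow> (\<forall>e v. F (e(k := v)) = F e)"

lemma multilinearD: "multilinear K F \<Longrightarrow> k \<in> K \<Longrightarrow> lin (\<lambda>x. F (e(k := (i, x))))"
  by (simp add: multilinear_def)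

lemma multilinear_subset: "multilinear K F \<Longrightarrow> L \<subseteq> K \<Longrightarrow> multilinear L F"
  by (auto simp: multilinear_def)

lemma insensitiveD: "insensitive k F \<Longrightarrow> F (e(k := v)) = F e"
  unfolding insensitive_def by blast

lemma state_sum_update:
  "k \<notin> fst ` set ks \<Longrightarrow> state_sum ks F (e(k := v)) c = state_sum ks (\<lambda>e. F (e(k := v))) e c"
proof (induction ks arbitrary: e c)
  case (Cons a ks)
  obtain k' i where a: "a = (k', i)" by fastforce
  have "state_sum ks F (e(k := v, k' := z)) y = state_sum ks (\<lambda>e. F (e(k := v))) (e(k' := z)) y" for z y
  proof -
    have "e(k := v, k' := z) = e(k' := z, k := v)" by (rule fun_upd_twist) (use Cons.prems a in auto)
    then show ?thesis using Cons.IH[of "e(k' := z)" y] Cons.prems by (simp del: fun_upd_apply)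
  qed
  then show ?case unfolding a state_sum.simps by (rule sw_cong)
qed simp

lemma state_sum_insensitive:
  "k \<notin> fst ` set ks \<Longrightarrow> insensitive k F \<Longrightarrow> state_sum ks F (e(k := v)) c = state_sum ks F e c"
  by (simp add: state_sum_update insensitiveD)

lemma lin_state_sum_slot:
  "multilinear K F \<Longrightarrow> k \<in> K \<Longrightarrow> k \<notin> fst ` set ks \<Longrightarrow> lin (\<lambda>x. state_sum ks F (e(k := (i, x))) c)"
proof (induction ks arbitrary: e c)
  case Nil
  then show ?case unfolding state_sum.simps by (intro lin_cmult multilinearD)
next
  case (Cons a ks)
  obtain k' i' where a: "a = (k', i')" by fastforce
  have "lin (\<lambda>x. state_sum ks F (e(k' := (i', y), k := (i, x))) z)" for y z
    using Cons.prems by (intro Cons.IH) auto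
  moreover have "e(k' := v, k := w) = e(k := w, k' := v)" for v w
    by (rule fun_upd_twist) (use Cons.prems a in auto)
  ultimately have "lin (\<lambda>x. state_sum ks F (e(k := (i, x), k' := (i', y))) z)" for y z
    by (simp del: fun_upd_apply)
  then show ?case unfolding a state_sum.simps by (rule lin_sw_fun)
qed

lemma lin_state_sum_param: "(\<And>e. lin (\<lambda>z. F z e)) \<Longrightarrow> lin (\<lambda>z. state_sum ks (F z) e c)"
proof (induction ks arbitrary: e c)
  case (Cons a ks) then show ?case by (cases a) (auto intro!: lin_sw_fun)
qed (simp add: lin_cmult)

lemma lin_state_sum:
  "distinct (map fst ks) \<Longrightarrow> multilinear (fst ` set ks) F \<Longrightarrow> lin (state_sum ks F e)"
proof (induction ks arbitrary: e)
  case Nil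
  have "state_sum [] F e = (\<lambda>c. \<epsilon> c * F e)" by (simp add: fun_eq_iff)
  then show ?case using lin_multc[OF lin_counit] by simp
next
  case (Cons a ks)
  obtain k i where a: "a = (k, i)" by fastforce
  have "multilinear (fst ` set ks) F" using Cons.prems(2) by (rule multilinear_subset) auto
  then have "lin (state_sum ks F (e(k := (i, x))))" for x using Cons a by auto
  moreover have "lin (\<lambda>x. state_sum ks F (e(k := (i, x))) y)" for y
    using Cons.prems(1) by (intro lin_state_sum_slot[OF Cons.prems(2)]) (auto simp: a)
  ultimately have "lin (\<lambda>c. sw True c (\<lambda>x y. state_sum ks F (e(k := (i, x))) y))"
    by (intro lin_sw) (simp add: lin2_def)
  moreover have "state_sum (a # ks) F e = (\<lambda>c. sw True c (\<lambda>x y. state_sum ks F (e(k := (i, x))) y))"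
    by (simp add: a fun_eq_iff)
  ultimately show ?case by simp
qed

text \<open>Coassociativity once for each slot of \<open>ks\<close>; the empty list is the counit
  law.\<close>

lemma state_sum_append:
  assumes "distinct (map fst (ks @ ls))" "multilinear (fst ` set (ks @ ls)) F"
  shows "state_sum (ks @ ls) F e c = sw True c (\<lambda>x y. state_sum ks (\<lambda>e'. state_sum ls F e' y) e x)"
  using assms
proof (induction ks arbitrary: e c)
  case Nil
  then show ?case by (simp add: sw_counit1 lin_state_sum)
next
  case (Cons a ks)
  obtain k i where a: "a = (k, i)" by fastforce
  have ks: "distinct (map fst ks)" "distinct (map fst ls)" "k \<notin> fst ` set ks" "k \<notin> fst ` set ls"
    "fst ` set ks \<inter> fst ` set ls = {}"
    using Cons.prems by (auto simp: a)
  have F: "multilinear (fst ` set ls) F" using Cons.prems(2) by (rule multilinear_subset) auto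
  let ?G = "\<lambda>x1 x2 z. state_sum ks (\<lambda>e'. state_sum ls F e' z) (e(k := (i, x1))) x2"
  have "lin (?G x1 x2)" for x1 x2
    using lin_state_sum[OF ks(2) F] by (rule lin_state_sum_param)
  moreover have "lin (\<lambda>x2. ?G x1 x2 z)" for x1 z
  proof -
    have "multilinear (fst ` set ks) (\<lambda>e'. state_sum ls F e' z)"
      unfolding multilinear_def
      using ks(5) by (intro ballI allI lin_state_sum_slot[OF Cons.prems(2)]) auto
    then show ?thesis using lin_state_sum[OF ks(1)] by blast
  qed
  moreover have "lin (\<lambda>x1. ?G x1 x2 z)" for x2 z
  proof -
    have "multilinear {k} (\<lambda>e'. state_sum ls F e' z)"
      unfolding multilinear_def
      using ks(4) by (intro ballI allI) (auto intro!: lin_state_sum_slot[OF Cons.prems(2)] simp: a simp del: fun_upd_apply)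
    then show ?thesis using ks(3) by (intro lin_state_sum_slot[where K = "{k}"]) simp_all
  qed
  ultimately have l: "lin3 ?G" by (simp add: lin3_def)
  have "multilinear (fst ` set (ks @ ls)) F" using Cons.prems(2) by (rule multilinear_subset) auto
  then have "state_sum ((a # ks) @ ls) F e c = sw True c (\<lambda>x y. sw True y (?G x))"
    using Cons.IH Cons.prems(1)
    unfolding a append_Cons state_sum.simps by (intro sw_cong) (simp del: fun_upd_apply)
  also have "\<dots> = sw True c (\<lambda>x y. sw True x (\<lambda>x1 x2. ?G x1 x2 y))"
    by (rule sw_assoc[OF l, symmetric])
  finally show ?case by (simp add: a)
qed

lemma state_sum_cmult: "state_sum ks (\<lambda>e. a * F e) e c = a * state_sum ks F e c"
proof (induction ks arbitrary: e c)
  case (Cons a ks)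
  obtain k i where a: "a = (k, i)" by fastforce
  show ?case unfolding a state_sum.simps sw_cmult[symmetric] Cons.IH ..
qed simp

lemma state_sum_factor:
  "(\<And>k. k \<in> fst ` set ks \<Longrightarrow> insensitive k G) \<Longrightarrow>
     state_sum ks (\<lambda>e. G e * F e) e c = G e * state_sum ks F e c"
proof (induction ks arbitrary: e c)
  case (Cons a ks)
  obtain k i where a: "a = (k, i)" by fastforce
  have "state_sum ks (\<lambda>e. G e * F e) (e(k := (i, x))) y
      = G (e(k := (i, x))) * state_sum ks F (e(k := (i, x))) y" for x y
    by (rule Cons.IH) (simp add: Cons.prems)
  moreover have "G (e(k := v)) = G e" for v
    by (rule insensitiveD) (simp add: Cons.prems a)
  ultimately show ?case
    unfolding a state_sum.simps sw_cmult[symmetric] by (intro sw_cong) (simp del: fun_upd_apply)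
qed simp

lemma state_sum_sw:
  "state_sum ks (\<lambda>e. sw s d (\<lambda>x y. H x y e)) e c = sw s d (\<lambda>x y. state_sum ks (H x y) e c)"
proof (induction ks arbitrary: e c)
  case (Cons a ks)
  obtain k i where a: "a = (k, i)" by fastforce
  show ?case unfolding a state_sum.simps Cons.IH by (rule sw_sw)
qed (simp add: sw_cmult)

lemma state_sum_commute:
  "fst ` set ks \<inter> fst ` set ls = {} \<Longrightarrow>
     state_sum ks (\<lambda>e'. state_sum ls F e' d) e c = state_sum ls (\<lambda>e'. state_sum ks F e' c) e d"
proof (induction ks arbitrary: e c)
  case Nil then show ?case by (simp add: state_sum_cmult)
next
  case (Cons a ks)
  obtain k i where a: "a = (k, i)" by fastforce
  have "state_sum ls (\<lambda>e'. state_sum ks F e' y) (e(k := v)) d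
      = state_sum ls (\<lambda>e'. state_sum ks F (e'(k := v)) y) e d" for y v
    using Cons.prems by (intro state_sum_update) (auto simp: a)
  moreover have "fst ` set ks \<inter> fst ` set ls = {}" using Cons.prems by auto
  ultimately show ?case
    unfolding a state_sum.simps state_sum_sw by (intro sw_cong) (simp del: fun_upd_apply add: Cons.IH)
qed

text \<open>A segment of the traversal can be treated as a single slot, the factor in which is
  subdivided afterwards.\<close>

lemma state_sum_hole:
  assumes "distinct (map fst (ks @ ls))" "multilinear (fst ` set (ks @ ls)) F"
    and "h \<notin> fst ` set (ks @ ls)" "insensitive h F"
  shows "state_sum (js @ ks @ ls) F e c
    = state_sum (js @ (h, i) # ls) (\<lambda>e'. state_sum ks F e' (snd (e' h))) e c"
proof (induction js arbitrary: e c)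
  case Nil
  have "state_sum (ks @ ls) F e c = sw True c (\<lambda>x y. state_sum ls (\<lambda>e'. state_sum ks F e' x) e y)"
    using state_sum_append[OF assms(1,2)] assms(1) state_sum_commute[of ks ls] by auto
  moreover have "state_sum ls (\<lambda>e'. state_sum ks F e' (snd (e' h))) (e(h := (i, x))) y
      = state_sum ls (\<lambda>e'. state_sum ks F e' x) e y" for x y
  proof -
    have h: "h \<notin> fst ` set ks" "h \<notin> fst ` set ls" using assms(3) by auto
    show ?thesis
      unfolding state_sum_update[OF h(2)] state_sum_insensitive[OF h(1) assms(4)] by simp
  qed
  then have "sw True c (\<lambda>x y. state_sum ls (\<lambda>e'. state_sum ks F e' (snd (e' h))) (e(h := (i, x))) y)
      = sw True c (\<lambda>x y. state_sum ls (\<lambda>e'. state_sum ks F e' x) e y)"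
    by (rule sw_cong)
  ultimately show ?case by simp
next
  case (Cons a js)
  obtain k i where a: "a = (k, i)" by fastforce
  show ?case unfolding a append_Cons state_sum.simps Cons.IH ..
qed

lemma state_sum_rename:
  assumes "inj \<rho>"
  shows "state_sum (map (\<lambda>(k, i). (\<rho> k, i)) ks) (\<lambda>e. F (\<lambda>k. e (\<rho> k))) e c = state_sum ks F (\<lambda>k. e (\<rho> k)) c"
proof (induction ks arbitrary: e c)
  case (Cons a ks)
  obtain k i where a: "a = (k, i)" by fastforce
  have "(\<lambda>k'. (e(\<rho> k := v)) (\<rho> k')) = (\<lambda>k'. e (\<rho> k'))(k := v)" for e v
    using assms by (auto simp: fun_eq_iff dest: injD)
  then have "state_sum ks F (\<lambda>k'. (e(\<rho> k := v)) (\<rho> k')) y = state_sum ks F ((\<lambda>k'. e (\<rho> k'))(k := v)) y" for v y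
    by (rule arg_cong[where f = "\<lambda>e. state_sum ks F e y"])
  then show ?case
    unfolding a list.map prod.case state_sum.simps Cons.IH by (intro sw_cong)
qed simp

fun assign :: "('a \<times> 'i) list \<Rightarrow> 'c list \<Rightarrow> ('a \<Rightarrow> 'i \<times> 'c) \<Rightarrow> 'a \<Rightarrow> 'i \<times> 'c" where
  "assign ((k, i) # ks) (x # xs) e = assign ks xs (e(k := (i, x)))"
| "assign _ _ e = e"

lemma assign_other: "k \<notin> fst ` set ks \<Longrightarrow> assign ks xs e k = e k"
  by (induction ks xs e rule: assign.induct) auto

lemma assign_nth:
  "distinct (map fst ks) \<Longrightarrow> length xs = length ks \<Longrightarrow> j < length ks \<Longrightarrow>
     assign ks xs e (fst (ks ! j)) = (snd (ks ! j), xs ! j)"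
proof (induction ks arbitrary: xs e j)
  case (Cons a ks)
  obtain k i where a: "a = (k, i)" by fastforce
  obtain x xs' where xs: "xs = x # xs'" using Cons.prems(2) by (cases xs) auto
  show ?case
  proof (cases j)
    case 0 then show ?thesis using Cons.prems by (simp add: a xs assign_other)
  next
    case (Suc j')
    then show ?thesis
      using Cons.IH[of xs' j' "e(k := (i, x))"] Cons.prems by (simp add: a xs del: fun_upd_apply)
  qed
qed simp

lemma length_iter_coproduct: "cs \<in> set (iter_coproduct \<Delta> m c) \<Longrightarrow> length cs = Suc m"
  by (induction m arbitrary: c cs) auto

text \<open>Both sides split off factors from the left. \<open>state_sum\<close> performs one
  coproduct more, after the last slot, and its trailing factor is removed by the counit; hence
  \<open>m + 1\<close> slots for \<open>m\<close> iterations.\<close>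

lemma state_sum_iter_coproduct:
  assumes "length ks = Suc m" "distinct (map fst ks)" "multilinear (fst ` set ks) F"
  shows "state_sum ks F e c = (\<Sum>cs\<leftarrow>iter_coproduct \<Delta> m c. F (assign ks cs e))"
  using assms
proof (induction m arbitrary: ks e c)
  case 0
  then obtain k i where ks: "ks = [(k, i)]" by (metis length_0_conv length_Suc_conv prod.exhaust)
  have "lin (\<lambda>x. F (e(k := (i, x))))" using 0 by (auto simp: ks intro: multilinearD)
  then have "sw True c (\<lambda>x y. F (e(k := (i, x))) * \<epsilon> y) = F (e(k := (i, c)))"
    by (rule sw_counit2)
  moreover have "state_sum ks F e c = sw True c (\<lambda>x y. F (e(k := (i, x))) * \<epsilon> y)"
    unfolding ks state_sum.simps by (intro sw_cong) (rule mult.commute)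
  ultimately show ?case by (simp add: ks)
next
  case (Suc m)
  then obtain k i ks' where ks: "ks = (k, i) # ks'" by (metis length_Suc_conv prod.exhaust)
  have "multilinear (fst ` set ks') F" using Suc.prems(3) by (rule multilinear_subset) (auto simp: ks)
  then have "state_sum ks' F e y = (\<Sum>cs\<leftarrow>iter_coproduct \<Delta> m y. F (assign ks' cs e))" for e y
    using Suc by (auto simp: ks)
  then show ?case
    by (simp add: ks sw_True map_concat sum_list_concat_map comp_def case_prod_unfold)
qed

end

section \<open>Replacing a part of a diagram\<close>

fun dturn :: "event \<Rightarrow> int" where
  "dturn D_plus = 1" | "dturn D_minus = - 1" | "dturn _ = 0"

fun uturn :: "event \<Rightarrow> int" where
  "uturn U_plus = 1" | "uturn U_minus = - 1" | "uturn _ = 0"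

abbreviation dturns :: "event list \<Rightarrow> int" where "dturns vs \<equiv> sum_list (map dturn vs)"
abbreviation uturns :: "event list \<Rightarrow> int" where "uturns vs \<equiv> sum_list (map uturn vs)"

type_synonym info = "bool \<times> int \<times> int"

text \<open>The crossing lines met, with their directions and their numbers \<open>u\<^sub>d\<close>, \<open>u\<^sub>u\<close>, when the contribution
  of the rest of the traversal to these numbers is \<open>m\<close>, \<open>n\<close>.\<close>

fun items :: "int \<Rightarrow> int \<Rightarrow> event list \<Rightarrow> ((nat \<times> line) \<times> info) list" where
  "items m n [] = []"
| "items m n (v # vs) = (case v of
     Cross_Line k l up \<Rightarrow> [((k, l), (up, m + dturns vs, n + uturns vs))] | _ \<Rightarrow> []) @ items m n vs"

lemma items_append: "items m n (vs @ vs') = items (m + dturns vs') (n + uturns vs') vs @ items m n vs'"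
  by (induction vs) (auto split: event.splits)

lemma map_fst_items: "map fst (items m n vs) = line_keys vs"
  by (induction vs) (auto split: event.splits)

lemma turn_map_crossing [simp]: "dturn (map_crossing h v) = dturn v" "uturn (map_crossing h v) = uturn v"
  by (cases v; simp)+

lemma turns_map_crossing [simp]:
  "dturns (map (map_crossing h) vs) = dturns vs" "uturns (map (map_crossing h) vs) = uturns vs"
  by (simp_all add: comp_def)

lemma items_map_crossing:
  "items m n (map (map_crossing h) vs) = map (\<lambda>((k, l), i). ((h k, l), i)) (items m n vs)"
  by (induction vs) (auto simp: comp_def split: event.splits)

type_synonym slot = "((nat \<times> nat) \<times> line) + strand"

fun macro_sum :: "(event \<Rightarrow> int) \<Rightarrow> (strand \<Rightarrow> int) \<Rightarrow> macro list \<Rightarrow> int" where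
  "macro_sum f g [] = 0"
| "macro_sum f g (Outer below v # M) = f v + macro_sum f g M"
| "macro_sum f g (Pass s # M) = g s + macro_sum f g M"

text \<open>\<open>X s m n\<close> lists the slots for the passage \<open>s\<close> through the middle part; the slots of the other
  crossing lines record whether they lie in the lower part (\<open>0\<close>) or the upper part (\<open>2\<close>).\<close>

fun segments :: "(strand \<Rightarrow> int) \<Rightarrow> (strand \<Rightarrow> int) \<Rightarrow> (strand \<Rightarrow> int \<Rightarrow> int \<Rightarrow> (slot \<times> info) list) \<Rightarrow>
    macro list \<Rightarrow> (slot \<times> info) list" where
  "segments gd gu X [] = []"
| "segments gd gu X (Outer below v # M) = (case v of
     Cross_Line k l up \<Rightarrow>
       [(Inl ((if below then 0 else 2, k), l), (up, macro_sum dturn gd M, macro_sum uturn gu M))]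
   | _ \<Rightarrow> []) @ segments gd gu X M"
| "segments gd gu X (Pass s # M) = X s (macro_sum dturn gd M) (macro_sum uturn gu M) @ segments gd gu X M"

text \<open>A numbering that does not depend on the length of the middle part, so that the diagrams
  before and after a move share their outer slots. The map \<open>\<pi>\<close> matches the
  crossings inside.\<close>

definition key_region :: "nat \<Rightarrow> nat \<Rightarrow> (nat \<Rightarrow> nat) \<Rightarrow> nat \<Rightarrow> nat \<times> nat" where
  "key_region a n \<pi> k = (if k < a then (0, k) else if k < a + n then (1, \<pi> (k - a)) else (2, k - (a + n)))"

definition inner_items :: "(nat \<Rightarrow> nat) \<Rightarrow> (strand \<Rightarrow> event list) \<Rightarrow> strand \<Rightarrow> int \<Rightarrow> int \<Rightarrow> (slot \<times> info) list" where
  "inner_items \<pi> E s m n = map (\<lambda>((k, l), i). (Inl ((1, \<pi> k), l), i)) (items m n (E s))"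

lemma turns_expand:
  assumes "\<And>s. gd s = dturns (E s)" "\<And>s. gu s = uturns (E s)"
  shows "dturns (expand a n E M) = macro_sum dturn gd M"
    and "uturns (expand a n E M) = macro_sum uturn gu M"
proof -
  have "dturns (expand a n E M) = macro_sum dturn gd M \<and> uturns (expand a n E M) = macro_sum uturn gu M"
  proof (induction M)
    case (Cons x M) then show ?case by (cases x) (simp_all add: assms comp_def)
  qed simp
  then show "dturns (expand a n E M) = macro_sum dturn gd M"
    and "uturns (expand a n E M) = macro_sum uturn gu M" by auto
qed

text \<open>An outer line sees the later passages only through their turning totals
  \<open>gd\<close>, \<open>gu\<close>. Moves that keep these totals therefore keep the outer slots
  and their exponents.\<close>

lemma segments_expand:
  assumes "\<And>s k l. (k, l) \<in> set (line_keys (E s)) \<Longrightarrow> k < n"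
    and "\<And>k l up. Outer True (Cross_Line k l up) \<in> set M \<Longrightarrow> k < a"
    and g: "\<And>s. gd s = dturns (E s)" "\<And>s. gu s = uturns (E s)"
  shows "map (\<lambda>((k, l), i). (Inl (key_region a n \<pi> k, l), i)) (items 0 0 (expand a n E M))
    = segments gd gu (inner_items \<pi> E) M"
  using assms(2)
proof (induction M)
  case (Cons x M)
  have IH: "map (\<lambda>((k, l), i). (Inl (key_region a n \<pi> k, l), i)) (items 0 0 (expand a n E M))
    = segments gd gu (inner_items \<pi> E) M"
    using Cons by auto
  show ?case
  proof (cases x)
    case (Outer below v)
    have "k < a" if "below" "v = Cross_Line k l up" for k l up
      using Cons.prems[of k l up] Outer that by simp
    then show ?thesis using Outer IH
      by (cases v) (auto simp: turns_expand[OF g] key_region_def)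
  next
    case (Pass s)
    have "k < n" if "((k, l), i) \<in> set (items m m' (E s))" for k l i m m'
    proof -
      have "(k, l) \<in> set (map fst (items m m' (E s)))" using that by force
      then show ?thesis using assms(1) by (simp add: map_fst_items)
    qed
    then have "map (\<lambda>((k, l), i). (Inl (key_region a n \<pi> k, l), i)) (items m m' (map (shift_event a) (E s)))
      = inner_items \<pi> E s m m'" for m m'
      by (fastforce simp: items_map_crossing inner_items_def key_region_def)
    then show ?thesis using Pass IH by (simp add: items_append turns_expand[OF g])
  qed
qed simp

text \<open>The information stored with a hole is a dummy, since only the vector in its slot is read
  later.\<close>

definition holes :: "strand list \<Rightarrow> (strand \<Rightarrow> int \<Rightarrow> int \<Rightarrow> (slot \<times> info) list) \<Rightarrow>
    strand \<Rightarrow> int \<Rightarrow> int \<Rightarrow> (slot \<times> info) list" where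
  "holes S X s m n = (if s \<in> set S then [(Inr s, (True, 0, 0))] else X s m n)"

text \<open>The turns made after the passage \<open>s\<close>, intended for passages that occur
  once; \<open>tl\<close> removes the passage itself.\<close>

definition rest_sum :: "(event \<Rightarrow> int) \<Rightarrow> (strand \<Rightarrow> int) \<Rightarrow> macro list \<Rightarrow> strand \<Rightarrow> int" where
  "rest_sum f g M s = macro_sum f g (tl (dropWhile (\<lambda>x. x \<noteq> Pass s) M))"

lemma segments_cong:
  "(\<And>s m n. Pass s \<in> set M \<Longrightarrow> X s m n = Y s m n) \<Longrightarrow> segments gd gu X M = segments gd gu Y M"
  by (induction gd gu X M rule: segments.induct) auto

lemma segments_split:
  "(\<And>s m n. Pass s \<in> set A \<Longrightarrow> X s m n = Y s m n) \<Longrightarrow>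
     \<exists>P. segments gd gu X (A @ B) = P @ segments gd gu X B \<and> segments gd gu Y (A @ B) = P @ segments gd gu Y B"
proof (induction A)
  case (Cons x A)
  then obtain P where P: "segments gd gu X (A @ B) = P @ segments gd gu X B"
    "segments gd gu Y (A @ B) = P @ segments gd gu Y B" by auto
  have "\<exists>H. segments gd gu X (x # A @ B) = H @ segments gd gu X (A @ B) \<and>
     segments gd gu Y (x # A @ B) = H @ segments gd gu Y (A @ B)"
    using Cons.prems by (cases x) auto
  then show ?case using P by (metis append_Cons append.assoc)
qed simp

text \<open>As the passage occurs once, nothing before or after it consults \<open>X s\<close>. The
  same \<open>P\<close> and \<open>Q\<close> thus serve for every \<open>Y\<close> that differs from
  \<open>X\<close> only at \<open>s\<close>.\<close>

lemma segments_hole: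
  assumes "count_list M (Pass s) = 1"
  obtains P Q where
    "segments gd gu X M = P @ X s (rest_sum dturn gd M s) (rest_sum uturn gu M s) @ Q"
    "\<And>Y. (\<And>t m n. t \<noteq> s \<Longrightarrow> X t m n = Y t m n) \<Longrightarrow>
       segments gd gu Y M = P @ Y s (rest_sum dturn gd M s) (rest_sum uturn gu M s) @ Q"
proof -
  have "Pass s \<in> set M" using assms by (metis count_list_0_iff zero_neq_one)
  then obtain A B where M: "M = A @ Pass s # B" "Pass s \<notin> set A" by (meson split_list_first)
  then have B: "Pass s \<notin> set B" using assms by (simp add: count_list_0_iff)
  have "dropWhile (\<lambda>x. x \<noteq> Pass s) M = Pass s # B" using M by (simp add: dropWhile_append)
  then have r: "rest_sum dturn gd M s = macro_sum dturn gd B" "rest_sum uturn gu M s = macro_sum uturn gu B"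
    by (simp_all add: rest_sum_def)
  obtain P where P: "segments gd gu X (A @ Pass s # B) = P @ segments gd gu X (Pass s # B)"
    using segments_split[of A X X gd gu "Pass s # B"] by blast
  show thesis
  proof (rule that)
    show "segments gd gu X M = P @ X s (rest_sum dturn gd M s) (rest_sum uturn gu M s) @ segments gd gu X B"
      using P unfolding r by (simp add: M(1))
    fix Y assume Y: "\<And>t m n. t \<noteq> s \<Longrightarrow> X t m n = Y t m n"
    have "\<exists>P. segments gd gu X (A @ Pass s # B) = P @ segments gd gu X (Pass s # B) \<and>
       segments gd gu Y (A @ Pass s # B) = P @ segments gd gu Y (Pass s # B)"
      using M Y by (intro segments_split) metis
    then have "segments gd gu Y (A @ Pass s # B) = P @ segments gd gu Y (Pass s # B)"
      using P by auto
    moreover have "segments gd gu Y B = segments gd gu X B"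
      using B Y by (intro segments_cong) metis
    ultimately show "segments gd gu Y M = P @ Y s (rest_sum dturn gd M s) (rest_sum uturn gu M s) @ segments gd gu X B"
      unfolding r by (simp add: M(1))
  qed
qed

lemma segments_keys:
  assumes X: "\<And>s m n. fst ` set (X s m n) \<subseteq> range Inl"
  shows "fst ` set (segments gd gu (holes S X) M) \<subseteq> range Inl \<union> Inr ` set S"
proof (induction M)
  case (Cons x M)
  show ?case
  proof (cases x)
    case (Outer below v) then show ?thesis using Cons by (auto split: event.splits)
  next
    case (Pass t)
    have "fst ` set (holes S X t m n) \<subseteq> range Inl \<union> Inr ` set S" for m n
      using X[of t m n] by (auto simp: holes_def)
    then show ?thesis using Cons Pass by (simp add: image_Un)
  qed
qed simp

text \<open>A slot common to both directions of an arc is listed once for every passage of the arc.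
  When slots are distinct, this bounds the number of passages by one.\<close>

lemma segments_count:
  assumes "s \<noteq> s'" "\<And>m n. k \<in> fst ` set (X s m n)" "\<And>m n. k \<in> fst ` set (X s' m n)"
  shows "count_list M (Pass s) + count_list M (Pass s') \<le> count_list (map fst (segments gd gu X M)) k"
proof -
  have *: "1 \<le> count_list xs y" if "y \<in> set xs" for xs and y :: slot
    using that by (metis count_list_0_iff less_one not_le)
  have X: "1 \<le> count_list (map fst (X s m n)) k" "1 \<le> count_list (map fst (X s' m n)) k" for m n
    using assms(2,3) by (intro *; simp only: set_map)+
  show ?thesis
  proof (induction M)
    case (Cons x M)
    show ?case
    proof (cases x)
      case (Outer below v) then show ?thesis using Cons by (simp add: le_add2 trans_le_add2)
    next
      case (Pass t)
      define m n where "m = macro_sum dturn gd M" and "n = macro_sum uturn gu M"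
      have "(if t = s \<or> t = s' then 1 else 0) \<le> count_list (map fst (X t m n)) k"
        using X[of m n] by auto
      then show ?thesis using Cons Pass assms(1) by (auto simp flip: m_def n_def split: if_splits)
    qed
  qed simp
qed

context coalgebra begin

text \<open>The local state sum: the factor kept in each hole is distributed over the crossing lines
  of its passage, with \<open>od\<close> and \<open>ou\<close> as the turns contributed by the
  outside.\<close>

primrec nest :: "(strand \<Rightarrow> int \<Rightarrow> int \<Rightarrow> (slot \<times> info) list) \<Rightarrow> (strand \<Rightarrow> int) \<Rightarrow> (strand \<Rightarrow> int) \<Rightarrow>
    strand list \<Rightarrow> ((slot \<Rightarrow> info \<times> 'c) \<Rightarrow> 'k) \<Rightarrow> (slot \<Rightarrow> info \<times> 'c) \<Rightarrow> 'k" where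
  "nest X od ou [] F = F"
| "nest X od ou (s # S) F = (\<lambda>e. state_sum (X s (od s) (ou s)) (nest X od ou S F) e (snd (e (Inr s))))"

lemma nest_factor:
  assumes "\<And>s k m n. s \<in> set S \<Longrightarrow> k \<in> fst ` set (X s m n) \<Longrightarrow> insensitive k G"
  shows "nest X od ou S (\<lambda>e. G e * F e) e = G e * nest X od ou S F e"
  using assms
proof (induction S arbitrary: e)
  case (Cons s S)
  have "nest X od ou S (\<lambda>e. G e * F e) = (\<lambda>e. G e * nest X od ou S F e)"
    by (intro ext Cons.IH) (meson Cons.prems list.set_intros(2))
  moreover have "insensitive k G" if "k \<in> fst ` set (X s (od s) (ou s))" for k
    using Cons.prems[of s] that by auto
  ultimately show ?case by (simp add: state_sum_factor)
qed simp

text \<open>\<open>state_sum_hole\<close> is applied to one passage after another; the first three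
  claims carry its hypotheses along the induction.\<close>

lemma nest_holes:
  fixes X :: "strand \<Rightarrow> int \<Rightarrow> int \<Rightarrow> (slot \<times> info) list" and gd gu :: "strand \<Rightarrow> int"
  defines "keys \<equiv> (\<lambda>S M. fst ` set (segments gd gu (holes S X) M))"
  assumes M: "\<And>s. s \<in> set S \<Longrightarrow> count_list M (Pass s) = 1"
    and S: "distinct S"
    and X: "\<And>s m n. fst ` set (X s m n) \<subseteq> range Inl"
    and dist: "distinct (map fst (segments gd gu X M))"
    and F: "multilinear (fst ` set (segments gd gu X M)) F" "\<And>s. insensitive (Inr s) F"
  shows "distinct (map fst (segments gd gu (holes S X) M)) \<and>
    multilinear (keys S M) (nest X (rest_sum dturn gd M) (rest_sum uturn gu M) S F) \<and>
    (\<forall>s. s \<notin> set S \<longrightarrow> insensitive (Inr s) (nest X (rest_sum dturn gd M) (rest_sum uturn gu M) S F)) \<and>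
    (\<forall>e c. state_sum (segments gd gu X M) F e c =
      state_sum (segments gd gu (holes S X) M) (nest X (rest_sum dturn gd M) (rest_sum uturn gu M) S F) e c)"
  using M S
proof (induction S)
  case Nil
  have "segments gd gu (holes [] X) M = segments gd gu X M"
    by (intro segments_cong) (simp add: holes_def)
  then show ?case using dist F by (simp add: keys_def)
next
  case (Cons s S)
  let ?od = "rest_sum dturn gd M" and ?ou = "rest_sum uturn gu M"
  define N where "N = nest X ?od ?ou S F"
  define ks where "ks = X s (?od s) (?ou s)"
  have IH: "distinct (map fst (segments gd gu (holes S X) M))" "multilinear (keys S M) N"
    "\<And>t. t \<notin> set S \<Longrightarrow> insensitive (Inr t) N"
    "\<And>e c. state_sum (segments gd gu X M) F e c = state_sum (segments gd gu (holes S X) M) N e c"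
    using Cons by (auto simp: N_def)
  have s: "s \<notin> set S" "count_list M (Pass s) = 1" using Cons.prems by auto
  obtain P Q where
    P: "segments gd gu (holes S X) M = P @ holes S X s (?od s) (?ou s) @ Q" and
    Q: "\<And>Y. (\<And>t m n. t \<noteq> s \<Longrightarrow> holes S X t m n = Y t m n) \<Longrightarrow>
       segments gd gu Y M = P @ Y s (?od s) (?ou s) @ Q"
    using segments_hole[OF s(2)] by blast
  have P: "segments gd gu (holes S X) M = P @ ks @ Q" using P s(1) by (simp add: holes_def ks_def)
  have Q: "segments gd gu (holes (s # S) X) M = P @ (Inr s, (True, 0, 0)) # Q"
    using Q[of "holes (s # S) X"] by (simp add: holes_def)
  have no: "Inr s \<notin> keys S M" using segments_keys[of X gd gu S M, OF X] s(1) unfolding keys_def by blast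
  have dks: "distinct (map fst (ks @ Q))" "distinct (map fst ks)" "fst ` set ks \<inter> (fst ` set P \<union> fst ` set Q) = {}"
    using IH(1) by (auto simp: P)
  have mks: "multilinear (fst ` set (ks @ Q)) N" "multilinear (fst ` set ks) N"
    using IH(2) by (auto simp: keys_def P intro: multilinear_subset)
  have new: "nest X ?od ?ou (s # S) F = (\<lambda>e. state_sum ks N e (snd (e (Inr s))))"
    by (simp add: N_def ks_def)
  have ks: "fst ` set ks \<subseteq> range Inl" using X by (simp add: ks_def)
  have sum: "state_sum (segments gd gu X M) F e c
      = state_sum (segments gd gu (holes (s # S) X) M) (nest X ?od ?ou (s # S) F) e c" for e c
    unfolding IH(4) P Q new using no by (intro state_sum_hole dks mks IH(3) s(1)) (auto simp: keys_def P)
  have "distinct (map fst (segments gd gu (holes (s # S) X) M))"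
    using IH(1) no by (auto simp: P Q keys_def)
  moreover have "multilinear (keys (s # S) M) (nest X ?od ?ou (s # S) F)"
    unfolding multilinear_def new
  proof (intro ballI allI)
    fix k e and i :: info assume k: "k \<in> keys (s # S) M"
    show "lin (\<lambda>x. state_sum ks N (e(k := (i, x))) (snd ((e(k := (i, x))) (Inr s))))"
    proof (cases "k = Inr s")
      case True
      have "Inr s \<notin> fst ` set ks" using ks by auto
      then have "(\<lambda>x. state_sum ks N (e(k := (i, x))) (snd ((e(k := (i, x))) (Inr s)))) = state_sum ks N e"
        using IH(3)[OF s(1)] by (simp add: True fun_eq_iff state_sum_insensitive del: fun_upd_apply) simp
      then show ?thesis using lin_state_sum[OF dks(2) mks(2)] by simp
    next
      case False
      then have "k \<in> fst ` set P \<union> fst ` set Q" using k by (auto simp: keys_def Q)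
      then have "k \<notin> fst ` set ks" "k \<in> keys S M" using dks(3) by (auto simp: keys_def P)
      from lin_state_sum_slot[OF IH(2) this(2,1)] show ?thesis using False by simp
    qed
  qed
  moreover have "insensitive (Inr t) (nest X ?od ?ou (s # S) F)" if "t \<notin> set (s # S)" for t
  proof -
    have "Inr t \<notin> fst ` set ks" using ks by auto
    moreover have "insensitive (Inr t) N" using IH(3) that by simp
    ultimately have "state_sum ks N (e(Inr t := v)) c = state_sum ks N e c" for e v c
      by (rule state_sum_insensitive)
    then show ?thesis unfolding new using that by (auto simp: insensitive_def)
  qed
  ultimately show ?case using sum by blast
qed

end

section \<open>The invariant as a state sum over crossing lines\<close>

lemma dturns_count: "dturns vs = int (count_list vs D_plus) - int (count_list vs D_minus)"
  and uturns_count: "uturns vs = int (count_list vs U_plus) - int (count_list vs U_minus)"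
proof -
  have "dturns vs = int (count_list vs D_plus) - int (count_list vs D_minus) \<and>
      uturns vs = int (count_list vs U_plus) - int (count_list vs U_minus)"
  proof (induction vs)
    case (Cons v vs) then show ?case by (cases v) auto
  qed simp
  then show "dturns vs = int (count_list vs D_plus) - int (count_list vs D_minus)"
    and "uturns vs = int (count_list vs U_plus) - int (count_list vs U_minus)" by auto
qed

lemma items_labelled_lines:
  "items 0 0 vs = map (\<lambda>t. ((crossing t, corners t), (dir_up t, ud t, uu t))) (labelled_lines vs)"
  by (induction vs) (auto simp: dturns_count uturns_count split: event.splits)

lemma label_of_nth:
  assumes "distinct (map (\<lambda>t. (crossing t, corners t)) L)" "(k, l) \<in> set (map (\<lambda>t. (crossing t, corners t)) L)"
  shows "label_of L k l < length L \<and> crossing (L ! label_of L k l) = k \<and> corners (L ! label_of L k l) = l"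
proof -
  obtain i where i: "i < length L" "crossing (L ! i) = k" "corners (L ! i) = l"
    using assms(2) by (auto simp: in_set_conv_nth)
  have "j = i" if "j < length L \<and> crossing (L ! j) = k \<and> corners (L ! j) = l" for j
    using that i nth_eq_iff_index_eq[OF assms(1), of i j] by simp
  then have "label_of L k l = i"
    unfolding label_of_def using i by (intro the_equality) blast+
  then show ?thesis using i by simp
qed

lemma UNIV_line: "(UNIV :: line set) = {SWNE, NWSE}"
proof -
  have "l \<in> {SWNE, NWSE}" for l by (cases l) auto
  then show ?thesis by blast
qed

lemma card_line: "card (UNIV :: line set) = 2"
  unfolding UNIV_line by simp

lemma finite_crossings: "finite (crossings w)"
  by (simp add: crossings_def)

lemma prod_lessThan_add: "(\<Prod>k<m + n. f k) = (\<Prod>k<m. f k) * (\<Prod>k<n. f (m + k :: nat) :: 'a :: comm_monoid_mult)"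
  by (induction n) (simp_all add: mult.assoc)

lemma count_list_distinct: "distinct xs \<Longrightarrow> count_list xs x \<le> 1"
  by (induction xs) (auto simp: count_list_0_iff)

lemma realizes_keys: "realizes l conn E \<Longrightarrow> (k, z) \<in> set (line_keys (E s)) \<Longrightarrow> k \<in> crossings l"
proof -
  assume "realizes l conn E" "(k, z) \<in> set (line_keys (E s))"
  then obtain up where "Cross_Line k z up \<in> set (E s)" by (auto simp: set_line_keys)
  moreover obtain n where "steps l n (entry_point l s) (E s) (exit_point l (conn s))"
    using \<open>realizes l conn E\<close> travel_steps unfolding realizes_def by blast
  ultimately show ?thesis using steps_event follow_Cross_Line(1) by blast
qed

lemma expand_keys:
  assumes "(a + j, z) \<in> set (line_keys (expand a n E M))" "j < n"
    and "\<And>k z up. Outer True (Cross_Line k z up) \<in> set M \<Longrightarrow> k < a"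
  shows "\<exists>s. Pass s \<in> set M \<and> (j, z) \<in> set (line_keys (E s))"
  using assms(1,3)
proof (induction M)
  case (Cons x M)
  have IH: "\<exists>s. Pass s \<in> set M \<and> (j, z) \<in> set (line_keys (E s))"
    if "(a + j, z) \<in> set (line_keys (expand a n E M))"
    by (rule Cons.IH[OF that]) (use Cons.prems(2) in auto)
  show ?case
  proof (cases x)
    case (Outer below v)
    have "(a + j, z) \<in> set (line_keys (expand a n E M))"
      using Cons.prems Outer \<open>j < n\<close> by (cases v; cases below) (fastforce)+
    then show ?thesis using IH by auto
  next
    case (Pass s)
    have "(j, z) \<in> set (line_keys (E s))" if key: "(a + j, z) \<in> set (line_keys (map (shift_event a) (E s)))"
    proof -
      have "v = Cross_Line j z up" if "shift_event a v = Cross_Line (a + j) z up" for v up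
        using that by (cases v) auto
      moreover obtain up v where "v \<in> set (E s)" "shift_event a v = Cross_Line (a + j) z up"
        using key unfolding set_line_keys set_map by (metis imageE)
      ultimately show ?thesis unfolding set_line_keys by metis
    qed
    then have "(j, z) \<in> set (line_keys (E s)) \<or> (\<exists>s. Pass s \<in> set M \<and> (j, z) \<in> set (line_keys (E s)))"
      using Cons.prems(1) IH unfolding Pass expand.simps line_keys_append set_append by blast
    then show ?thesis unfolding Pass by (metis list.set_intros)
  qed
qed simp

lemma key_region_inj:
  assumes "inj \<pi>" shows "inj (key_region a n \<pi>)"
proof (rule injI)
  fix x y assume eq: "key_region a n \<pi> x = key_region a n \<pi> y"
  show "x = y"
    using eq unfolding key_region_def
    by (cases "x < a"; cases "y < a"; cases "x < a + n"; cases "y < a + n"; simp add: inj_eq[OF assms])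
qed

context oriented_quantum_coalgebra begin

definition crossing_weight :: "line \<Rightarrow> info \<times> 'c \<Rightarrow> info \<times> 'c \<Rightarrow> 'k" where
  "crossing_weight l p q = (case p of ((up, m, n), x) \<Rightarrow> case q of ((up', m', n'), y) \<Rightarrow>
     crossing_factor b binv l up up' (\<lambda>i j. pw (m + i) (n + j) x) (\<lambda>i j. pw (m' + i) (n' + j) y))"

fun piece_weight :: "piece \<Rightarrow> (line \<Rightarrow> info \<times> 'c) \<Rightarrow> 'k" where
  "piece_weight (Crossing l) g = crossing_weight l (g l) (g (other_line l))"
| "piece_weight _ g = 1"

definition slices_weight :: "slice list \<Rightarrow> (nat \<Rightarrow> line \<Rightarrow> info \<times> 'c) \<Rightarrow> 'k" where
  "slices_weight w g = (\<Prod>k<length w. piece_weight (fst (w ! k)) (g k))"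

lemma slices_weight_append:
  "slices_weight (v @ w) g = slices_weight v g * slices_weight w (\<lambda>k. g (length v + k))"
  by (simp add: slices_weight_def prod_lessThan_add nth_append)

lemma slices_weight_cong: "(\<And>k. k < length w \<Longrightarrow> g k = g' k) \<Longrightarrow> slices_weight w g = slices_weight w g'"
  unfolding slices_weight_def by (intro prod.cong) auto

lemma slices_weight_crossings:
  "slices_weight w g = (\<Prod>k\<in>crossings w. let l = over_line (fst (w ! k)) in crossing_weight l (g k l) (g k (other_line l)))"
proof -
  have "slices_weight w g = (\<Prod>k\<in>crossings w. piece_weight (fst (w ! k)) (g k))"
    unfolding slices_weight_def
  proof (rule prod.mono_neutral_right)
    show "\<forall>k\<in>{..<length w} - crossings w. piece_weight (fst (w ! k)) (g k) = 1"
    proof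
      fix k assume "k \<in> {..<length w} - crossings w"
      moreover obtain p i where "w ! k = (p, i)" by fastforce
      ultimately show "piece_weight (fst (w ! k)) (g k) = 1"
        by (cases p) (auto simp: crossings_def)
    qed
  qed (auto simp: crossings_def)
  also have "\<dots> = (\<Prod>k\<in>crossings w. let l = over_line (fst (w ! k)) in crossing_weight l (g k l) (g k (other_line l)))"
    by (intro prod.cong) (auto simp: crossings_def Let_def)
  finally show ?thesis .
qed

lemma lin_form_pw: "lin (\<lambda>x. form \<sigma> (pw m n x) y)" "lin (\<lambda>y. form \<sigma> x (pw m n y))"
  using lin_pw[OF lin2_E(2)[OF lin2_form]] lin_pw[OF lin2_E(1)[OF lin2_form]] by auto

lemma lin_b_pw:
  "lin (\<lambda>x. b (pw m n x) y)" "lin (\<lambda>y. b x (pw m n y))"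
  "lin (\<lambda>x. binv (pw m n x) y)" "lin (\<lambda>y. binv x (pw m n y))"
  using lin_form_pw[of True] lin_form_pw[of False] by (simp_all add: form_def)

lemma lin_crossing_weight:
  "lin (\<lambda>x. crossing_weight l (i, x) q)" "lin (\<lambda>y. crossing_weight l p (i, y))"
proof -
  obtain up m n where i: "i = (up, m, n)" by (metis prod.exhaust)
  obtain up' m' n' y where q: "q = ((up', m', n'), y)" by (metis prod.exhaust)
  obtain up'' m'' n'' x where p: "p = ((up'', m'', n''), x)" by (metis prod.exhaust)
  show "lin (\<lambda>x. crossing_weight l (i, x) q)" unfolding i q crossing_weight_def prod.case
    by (cases l; cases up; cases up'; simp add: lin_b_pw)
  show "lin (\<lambda>y. crossing_weight l p (i, y))" unfolding i p crossing_weight_def prod.case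
    by (cases l; cases up; cases up''; simp add: lin_b_pw)
qed

text \<open>A slot is one line of one crossing, so it enters a single factor of the product, and
  there a single argument.\<close>

lemma multilinear_slices_weight:
  assumes "inj \<rho>"
  shows "multilinear (\<rho> ` (crossings w \<times> UNIV)) (\<lambda>e. slices_weight w (\<lambda>k l. e (\<rho> (k, l))))"
  unfolding multilinear_def
proof (intro ballI allI)
  fix q and e :: "'a \<Rightarrow> info \<times> 'c" and i :: info assume "q \<in> \<rho> ` (crossings w \<times> UNIV)"
  then obtain k l where q: "q = \<rho> (k, l)" "k \<in> crossings w" by auto
  let ?g = "\<lambda>x k' l'. (e(\<rho> (k, l) := (i, x))) (\<rho> (k', l'))"
  let ?c = "\<lambda>x k'. (let l' = over_line (fst (w ! k')) in crossing_weight l' (?g x k' l') (?g x k' (other_line l')))"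
  have g: "?g x k' l' = (if (k', l') = (k, l) then (i, x) else e (\<rho> (k', l')))" for x k' l'
    using assms by (auto dest: injD)
  have o: "other_line l' \<noteq> l'" for l' by (cases l') auto
  have all: "slices_weight w (?g x) = ?c x k * (\<Prod>k'\<in>crossings w - {k}. ?c x k')" for x
    unfolding slices_weight_crossings by (rule prod.remove[OF finite_crossings q(2)])
  have rest: "(\<Prod>k'\<in>crossings w - {k}. ?c x k') = (\<Prod>k'\<in>crossings w - {k}. ?c 0 k')" for x
    by (intro prod.cong) (auto simp: g simp del: fun_upd_apply)
  have eq: "slices_weight w (?g x) = ?c x k * (\<Prod>k'\<in>crossings w - {k}. ?c 0 k')" for x
    using all[of x] unfolding rest[of x] .
  have "l = over_line (fst (w ! k)) \<or> l = other_line (over_line (fst (w ! k)))"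
    by (cases l; cases "over_line (fst (w ! k))") auto
  then have "lin (\<lambda>x. ?c x k)"
    using o[of "over_line (fst (w ! k))"] o[of "over_line (fst (w ! k))", symmetric]
    unfolding g Let_def by (auto simp: lin_crossing_weight)
  then show "lin (\<lambda>x. slices_weight w (\<lambda>k l. (e(q := (i, x))) (\<rho> (k, l))))"
    unfolding q(1) eq by (rule lin_multc)
qed

text \<open>Each line of each crossing is met exactly once, so labels are positions in the list of
  slots. Without crossings the state sum is empty and equals the counit.\<close>

lemma Inv_state_sum:
  assumes T: "Diagram w u \<in> Tang"
  shows "Inv \<Delta> \<epsilon> b binv Td Tu (Diagram w u) c
    = state_sum (items 0 0 (events (Diagram w u))) (\<lambda>e. slices_weight w (\<lambda>k l. e (k, l))) e c"
proof -
  let ?es = "events (Diagram w u)"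
  define ks where "ks = items 0 0 ?es"
  define L where "L = labelled_lines ?es"
  define n where "n = card (crossings w)"
  have ks: "ks = map (\<lambda>t. ((crossing t, corners t), (dir_up t, ud t, uu t))) L"
    by (simp add: ks_def L_def items_labelled_lines)
  have keys: "map fst ks = line_keys ?es" by (simp add: ks_def map_fst_items)
  have dist: "distinct (map fst ks)" and set: "set (map fst ks) = crossings w \<times> UNIV"
    using distinct_line_keys_events[OF T] set_line_keys_events[OF T] by (simp_all only: keys)
  have fstL: "map fst ks = map (\<lambda>t. (crossing t, corners t)) L" by (simp add: ks)
  have len: "length ks = 2 * n"
    using distinct_card[OF dist] by (simp add: set[unfolded set_map] n_def card_cartesian_product card_line)
  have ml: "multilinear (fst ` set ks) (\<lambda>e. slices_weight w (\<lambda>k l. e (k, l)))"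
    using multilinear_slices_weight[of "\<lambda>x. x" w] set by simp
  show ?thesis
  proof (cases "n = 0")
    case True
    then have "crossings w = {}" using finite_crossings by (simp add: n_def)
    moreover have "ks = []" using len True by simp
    ultimately show ?thesis by (simp add: Inv_def ks_def[symmetric] slices_weight_crossings)
  next
    case False
    then have "length ks = Suc (2 * n - 1)" using len by simp
    from state_sum_iter_coproduct[OF this dist ml]
    have "state_sum ks (\<lambda>e. slices_weight w (\<lambda>k l. e (k, l))) e c
      = (\<Sum>cs\<leftarrow>iter_coproduct \<Delta> (2 * n - 1) c. slices_weight w (\<lambda>k l. assign ks cs e (k, l)))" .
    also have "\<dots> = Inv \<Delta> \<epsilon> b binv Td Tu (Diagram w u) c"
      unfolding Inv_def using False
    proof (simp add: n_def[symmetric] L_def[symmetric] Let_def slices_weight_crossings del: fun_upd_apply, intro arg_cong[where f = sum_list] map_cong refl prod.cong)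
      fix cs k assume cs: "cs \<in> set (iter_coproduct \<Delta> (2 * n - Suc 0) c)" and k: "k \<in> crossings w"
      have "assign ks cs e (k, l) = ((dir_up (L ! i), ud (L ! i), uu (L ! i)), cs ! i)"
        if "i = label_of L k l" for l i
      proof -
        have "(k, l) \<in> set (map (\<lambda>t. (crossing t, corners t)) L)" using set k unfolding fstL by auto
        from label_of_nth[OF dist[unfolded fstL] this]
        have i: "i < length L" "crossing (L ! i) = k" "corners (L ! i) = l" by (simp_all add: that)
        moreover have "length cs = length ks" using length_iter_coproduct[OF cs] len False by simp
        ultimately show ?thesis using assign_nth[OF dist, of cs i e] by (simp add: ks)
      qed
      then show "crossing_weight (over_line (fst (w ! k))) (assign ks cs e (k, over_line (fst (w ! k))))
           (assign ks cs e (k, other_line (over_line (fst (w ! k)))))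
        = crossing_factor b binv (over_line (fst (w ! k)))
            (dir_up (L ! label_of L k (over_line (fst (w ! k)))))
            (dir_up (L ! label_of L k (other_line (over_line (fst (w ! k))))))
            (\<lambda>p q. int_power Td (ud (L ! label_of L k (over_line (fst (w ! k)))) + p)
               (int_power Tu (uu (L ! label_of L k (over_line (fst (w ! k)))) + q)
                 (cs ! label_of L k (over_line (fst (w ! k))))))
            (\<lambda>p q. int_power Td (ud (L ! label_of L k (other_line (over_line (fst (w ! k))))) + p)
               (int_power Tu (uu (L ! label_of L k (other_line (over_line (fst (w ! k))))) + q)
                 (cs ! label_of L k (other_line (over_line (fst (w ! k)))))))"
        by (simp add: crossing_weight_def pw_def)
    qed simp_all
    finally show ?thesis by (simp add: ks_def)
  qed
qed

lemma Inv_segments: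
  assumes T: "Diagram (v @ l @ w) u \<in> Tang" and r: "realizes l conn E"
    and ev: "events (Diagram (v @ l @ w) u) = expand (length v) (length l) E M"
    and M: "\<And>k z up. Outer True (Cross_Line k z up) \<in> set M \<Longrightarrow> k < length v"
    and \<pi>: "inj \<pi>" and g: "\<And>s. gd s = dturns (E s)" "\<And>s. gu s = uturns (E s)"
  defines "F \<equiv> (\<lambda>e :: slot \<Rightarrow> info \<times> 'c. (slices_weight v (\<lambda>k z. e (Inl ((0, k), z))) *
      slices_weight w (\<lambda>k z. e (Inl ((2, k), z)))) * slices_weight l (\<lambda>k z. e (Inl ((1, \<pi> k), z))))"
    and "ks \<equiv> segments gd gu (inner_items \<pi> E) M"
  shows "Inv \<Delta> \<epsilon> b binv Td Tu (Diagram (v @ l @ w) u) c = state_sum ks F e c"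
    and "distinct (map fst ks)" "multilinear (fst ` set ks) F"
proof -
  let ?W = "v @ l @ w" and ?es = "events (Diagram (v @ l @ w) u)"
  define \<rho> :: "nat \<times> line \<Rightarrow> slot" where
    "\<rho> = (\<lambda>(k, z). Inl (key_region (length v) (length l) \<pi> k, z))"
  have \<rho>: "inj \<rho>" using injD[OF key_region_inj[OF \<pi>]] by (auto simp: \<rho>_def inj_def)
  have keys: "k < length l" if "(k, z) \<in> set (line_keys (E s))" for s k z
    using realizes_keys[OF r that] by (simp add: crossings_def)
  have ks: "ks = map (\<lambda>(k, i). (\<rho> k, i)) (items 0 0 ?es)"
    using segments_expand[of E "length l" M "length v" gd gu \<pi>, OF keys M g]
    unfolding ks_def ev \<rho>_def by (simp add: case_prod_unfold)
  have F: "F = (\<lambda>e. slices_weight ?W (\<lambda>k z. e (\<rho> (k, z))))"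
  proof
    fix e :: "slot \<Rightarrow> info \<times> 'c"
    have "slices_weight v (\<lambda>k z. e (\<rho> (k, z))) = slices_weight v (\<lambda>k z. e (Inl ((0, k), z)))"
      "slices_weight l (\<lambda>k z. e (\<rho> (length v + k, z))) = slices_weight l (\<lambda>k z. e (Inl ((1, \<pi> k), z)))"
      "slices_weight w (\<lambda>k z. e (\<rho> (length v + (length l + k), z))) = slices_weight w (\<lambda>k z. e (Inl ((2, k), z)))"
      by (rule slices_weight_cong, simp add: \<rho>_def key_region_def)+
    then show "F e = slices_weight ?W (\<lambda>k z. e (\<rho> (k, z)))"
      by (simp add: F_def slices_weight_append)
  qed
  have fst_ks: "map fst ks = map \<rho> (line_keys ?es)"
    by (simp add: ks map_fst_items[of 0 0, symmetric] case_prod_unfold)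
  show "distinct (map fst ks)"
    unfolding fst_ks distinct_map using distinct_line_keys_events[OF T] \<rho> by (auto intro: inj_on_subset)
  have "fst ` set ks = \<rho> ` (crossings ?W \<times> UNIV)"
    using arg_cong[OF fst_ks, of set] set_line_keys_events[OF T] by simp
  then show "multilinear (fst ` set ks) F"
    unfolding F using multilinear_slices_weight[OF \<rho>] by simp
  show "Inv \<Delta> \<epsilon> b binv Td Tu (Diagram (v @ l @ w) u) c = state_sum ks F e c"
    unfolding Inv_state_sum[OF T, of c "\<lambda>k. e (\<rho> k)"] ks F
    using state_sum_rename[OF \<rho>, of "items 0 0 ?es" "\<lambda>e. slices_weight ?W (\<lambda>k z. e (k, z))" e c] by simp
qed

text \<open>Each arc is given by the two directions in which it can be passed; the crossing line required of
  it ensures that exactly one of them occurs, exactly once.\<close>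

lemma Inv_replace:
  assumes Tl: "Diagram (v @ l @ w) u \<in> Tang" and Tr: "Diagram (v @ r @ w) u \<in> Tang" and ne: "l \<noteq> []"
    and El: "realizes l conn E" and Er: "realizes r conn E'"
    and g: "\<And>s. dturns (E s) = dturns (E' s)" "\<And>s. uturns (E s) = uturns (E' s)" and \<pi>: "inj \<pi>"
    and arcs: "\<And>s s'. (s, s') \<in> set arcs \<Longrightarrow> s \<noteq> s' \<and> (\<exists>j z. (j, z) \<in> set (line_keys (E s)) \<and>
       (j, z) \<in> set (line_keys (E s')) \<and> (\<forall>t. (j, z) \<in> set (line_keys (E t)) \<longrightarrow> t = s \<or> t = s'))"
    and distinct_arcs: "distinct (concat (map (\<lambda>(s, s'). [s, s']) arcs))"
    and same: "\<And>s m n. (\<And>t t'. (t, t') \<in> set arcs \<Longrightarrow> s \<noteq> t \<and> s \<noteq> t') \<Longrightarrow>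
       inner_items id E s m n = inner_items \<pi> E' s m n"
    and local: "\<And>S od ou e. list_all2 (\<lambda>s (t, t'). s = t \<or> s = t') S arcs \<Longrightarrow>
       nest (inner_items id E) od ou S (\<lambda>e. slices_weight l (\<lambda>k z. e (Inl ((1, k), z)))) e =
       nest (inner_items \<pi> E') od ou S (\<lambda>e. slices_weight r (\<lambda>k z. e (Inl ((1, \<pi> k), z)))) e"
  shows "Inv \<Delta> \<epsilon> b binv Td Tu (Diagram (v @ l @ w) u) = Inv \<Delta> \<epsilon> b binv Td Tu (Diagram (v @ r @ w) u)"
proof
  fix c
  define gd gu where "gd = (\<lambda>s. dturns (E s))" and "gu = (\<lambda>s. uturns (E s))"
  define X Y where "X = inner_items id E" and "Y = inner_items \<pi> E'"
  define G where "G = (\<lambda>e :: slot \<Rightarrow> info \<times> 'c. slices_weight v (\<lambda>k z. e (Inl ((0, k), z))) *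
      slices_weight w (\<lambda>k z. e (Inl ((2, k), z))))"
  obtain M where M: "events (Diagram (v @ l @ w) u) = expand (length v) (length l) E M"
    "events (Diagram (v @ r @ w) u) = expand (length v) (length r) E' M"
    "\<And>k z up. Outer True (Cross_Line k z up) \<in> set M \<Longrightarrow> k < length v"
    using events_expand[OF El ne Tl Er] by metis
  \<comment> \<open>Any initial environment will do, because every slot that the weight reads is
    overwritten.\<close>
  obtain e :: "slot \<Rightarrow> info \<times> 'c" where True by blast
  note L = Inv_segments[OF Tl El M(1,3) inj_on_id fun_cong[OF gd_def] fun_cong[OF gu_def]]
  have "gd s = dturns (E' s)" "gu s = uturns (E' s)" for s by (simp_all add: gd_def gu_def g)
  note R = Inv_segments[OF Tr Er M(2,3) \<pi> this]
  have XY: "fst ` set (X s m n) \<subseteq> range Inl" "fst ` set (Y s m n) \<subseteq> range Inl" for s m n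
    by (auto simp: X_def Y_def inner_items_def)
  have dX: "distinct (map fst (segments gd gu X M))" using L(2) by (simp add: X_def)
  \<comment> \<open>At most one passage, because the crossing line of the arc owns a single slot; at
    least one, because the complete traversal meets that line.\<close>
  have key: "count_list M (Pass s) + count_list M (Pass s') = 1" if s: "(s, s') \<in> set arcs" for s s'
  proof -
    obtain j z where j: "s \<noteq> s'" "(j, z) \<in> set (line_keys (E s))" "(j, z) \<in> set (line_keys (E s'))"
      "\<And>t. (j, z) \<in> set (line_keys (E t)) \<Longrightarrow> t = s \<or> t = s'"
      using arcs[OF s] by blast
    have "Inl ((1, j), z) \<in> fst ` set (X t m n)" if "(j, z) \<in> set (line_keys (E t))" for t m n
    proof -
      have "(j, z) \<in> fst ` set (items m n (E t))" using that map_fst_items[of m n "E t"] by (metis set_map)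
      then show ?thesis by (force simp: X_def inner_items_def)
    qed
    then have "count_list M (Pass s) + count_list M (Pass s')
        \<le> count_list (map fst (segments gd gu X M)) (Inl ((1, j), z))"
      using j(2,3) by (intro segments_count j(1))
    also have "\<dots> \<le> 1" by (rule count_list_distinct[OF dX])
    finally have "count_list M (Pass s) + count_list M (Pass s') \<le> 1" .
    moreover have "\<exists>t. Pass t \<in> set M \<and> (j, z) \<in> set (line_keys (E t))"
    proof (rule expand_keys)
      have "j \<in> crossings l" using realizes_keys[OF El j(2)] .
      then show "j < length l" "(length v + j, z) \<in> set (line_keys (expand (length v) (length l) E M))"
        using set_line_keys_events[OF Tl] unfolding M(1) by (auto simp: crossings_def nth_append)
    qed (rule M(3))
    ultimately show ?thesis
      using j(4) by (metis add_is_0 count_list_0_iff le_antisym not_less_eq_eq One_nat_def le_zero_eq not_less_zero le_simps(3) zero_less_iff_neq_zero)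
  qed
  \<comment> \<open>The direction in which the arc is really passed.\<close>
  define pick where "pick = (\<lambda>(s, s'). if Pass s \<in> set M then s else s')"
  define S where "S = map pick arcs"
  have mem: "x \<in> set M \<longleftrightarrow> 0 < count_list M x" for x
    using count_list_0_iff[of M x] by auto
  have pick: "count_list M (Pass (pick p)) = 1" if "p \<in> set arcs" for p
    using key[of "fst p" "snd p"] that by (auto simp: pick_def case_prod_unfold mem)
  have sel: "pick p = fst p \<or> pick p = snd p" for p by (auto simp: pick_def case_prod_unfold)
  have "list_all2 (\<lambda>s (t, t'). s = t \<or> s = t') (map pick qs) qs" for qs
    using sel by (induction qs) (auto simp: case_prod_unfold)
  then have S_arcs: "list_all2 (\<lambda>s (t, t'). s = t \<or> s = t') S arcs" by (simp add: S_def)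
  have S1: "\<And>s. s \<in> set S \<Longrightarrow> count_list M (Pass s) = 1" using pick by (auto simp: S_def)
  have S2: "distinct S"
    using distinct_arcs unfolding S_def
  proof (induction arcs)
    case (Cons p qs)
    have "pick q \<in> set (concat (map (\<lambda>(s, s'). [s, s']) qs))" if "q \<in> set qs" for q
      using sel[of q] that by (force simp: case_prod_unfold)
    moreover have "pick p \<notin> set (concat (map (\<lambda>(s, s'). [s, s']) qs))"
      using Cons.prems sel[of p] by (auto simp: case_prod_unfold)
    ultimately have "pick p \<notin> pick ` set qs" by (metis imageE)
    then show ?case using Cons by (auto simp: case_prod_unfold)
  qed simp
  let ?Fl = "\<lambda>e :: slot \<Rightarrow> info \<times> 'c. slices_weight l (\<lambda>k z. e (Inl ((1, k), z)))"
  let ?Fr = "\<lambda>e :: slot \<Rightarrow> info \<times> 'c. slices_weight r (\<lambda>k z. e (Inl ((1, \<pi> k), z)))"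
  let ?od = "rest_sum dturn gd M" and ?ou = "rest_sum uturn gu M"
  have insG: "insensitive k G" if "k \<in> fst ` set (X s m n) \<or> k \<in> fst ` set (Y s m n)" for k s m n
    using that by (auto simp: insensitive_def G_def X_def Y_def inner_items_def)
  \<comment> \<open>Passages outside the arcs have the same slots in both diagrams and the others
    are holes, so the outer sums coincide and only the nests differ.\<close>
  have "segments gd gu (holes S X) M = segments gd gu (holes S Y) M"
  proof (rule segments_cong)
    fix s m n assume s: "Pass s \<in> set M"
    show "holes S X s m n = holes S Y s m n"
    proof (cases "s \<in> set S")
      case False
      have "s \<noteq> t \<and> s \<noteq> t'" if t: "(t, t') \<in> set arcs" for t t'
      proof -
        have "pick (t, t') \<noteq> s" using False t by (auto simp: S_def)
        then show ?thesis using s key[OF t] by (auto simp: pick_def mem split: if_splits)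
      qed
      then show ?thesis using False same by (simp add: holes_def X_def Y_def)
    qed (simp add: holes_def)
  qed
  moreover have "nest X ?od ?ou S (\<lambda>e. G e * ?Fl e) = nest Y ?od ?ou S (\<lambda>e. G e * ?Fr e)"
  proof
    fix e
    have "nest X ?od ?ou S (\<lambda>e. G e * ?Fl e) e = G e * nest X ?od ?ou S ?Fl e"
      using insG by (intro nest_factor) blast
    moreover have "nest Y ?od ?ou S (\<lambda>e. G e * ?Fr e) e = G e * nest Y ?od ?ou S ?Fr e"
      using insG by (intro nest_factor) blast
    ultimately show "nest X ?od ?ou S (\<lambda>e. G e * ?Fl e) e = nest Y ?od ?ou S (\<lambda>e. G e * ?Fr e) e"
      using local[OF S_arcs] by (simp add: X_def Y_def)
  qed
  moreover have "state_sum (segments gd gu X M) (\<lambda>e. G e * ?Fl e) e c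
      = state_sum (segments gd gu (holes S X) M) (nest X ?od ?ou S (\<lambda>e. G e * ?Fl e)) e c"
  proof -
    have "insensitive (Inr s) (\<lambda>e. G e * ?Fl e)" for s by (simp add: insensitive_def G_def)
    from nest_holes[OF S1 S2 XY(1) dX _ this] L(3) show ?thesis by (simp add: X_def G_def)
  qed
  moreover have "state_sum (segments gd gu Y M) (\<lambda>e. G e * ?Fr e) e c
      = state_sum (segments gd gu (holes S Y) M) (nest Y ?od ?ou S (\<lambda>e. G e * ?Fr e)) e c"
  proof -
    have "insensitive (Inr s) (\<lambda>e. G e * ?Fr e)" for s by (simp add: insensitive_def G_def)
    from nest_holes[OF S1 S2 XY(2) _ _ this] R(2,3) show ?thesis by (simp add: Y_def G_def)
  qed
  ultimately show "Inv \<Delta> \<epsilon> b binv Td Tu (Diagram (v @ l @ w) u) c = Inv \<Delta> \<epsilon> b binv Td Tu (Diagram (v @ r @ w) u) c"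
    using L(1)[where c = c and e = e] R(1)[where c = c and e = e] by (simp add: X_def Y_def G_def)
qed

end

section \<open>Invariance under the moves\<close>

fun run :: "nat \<Rightarrow> slice list \<Rightarrow> point \<Rightarrow> event list \<times> point" where
  "run 0 w s = ([], s)"
| "run (Suc n) w s = (case next_point w s of None \<Rightarrow> ([], s)
     | Some (vs, s') \<Rightarrow> (case run n w s' of (vs', t) \<Rightarrow> (vs @ vs', t)))"

lemma travel_run: "run n w s = (vs, t) \<Longrightarrow> travel w s vs t"
proof (induction n arbitrary: s vs)
  case (Suc n)
  then show ?case
    by (auto simp: follow_iff intro: travel.intros split: option.splits prod.splits)
qed (auto intro: travel.intros)

text \<open>The bend of (M.1) takes four steps and no other passage below takes more;
  \<open>run\<close> stays put when no step is left.\<close>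

lemma realizesI:
  assumes "\<And>u p. run 4 l (entry_point l (u, p)) = (E (u, p), exit_point l (conn (u, p)))"
  shows "realizes l conn E"
  unfolding realizes_def using travel_run[OF assms] by auto

lemma realizes_Nil: "realizes [] (\<lambda>s. s) (\<lambda>_. [])"
  by (rule realizesI) (simp add: eval_nat_numeral)

context coalgebra begin

lemma nest_multilinear:
  assumes "multilinear K F" "K \<subseteq> range Inl" "\<And>s. s \<in> set S \<Longrightarrow> fst ` set (X s (od s) (ou s)) \<inter> K = {}"
  shows "multilinear K (nest X od ou S F)"
  using assms(3)
proof (induction S)
  case (Cons s S)
  then have IH: "multilinear K (nest X od ou S F)" by simp
  show ?case
    unfolding multilinear_def
  proof (intro ballI allI)
    fix k e and i :: info assume k: "k \<in> K"
    then have "k \<noteq> Inr s" using assms(2) by auto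
    moreover have "k \<notin> fst ` set (X s (od s) (ou s))" using Cons.prems[of s] k by auto
    from lin_state_sum_slot[OF IH k this]
    have "lin (\<lambda>x. state_sum (X s (od s) (ou s)) (nest X od ou S F) (e(k := (i, x))) (snd (e (Inr s))))" .
    ultimately show "lin (\<lambda>x. nest X od ou (s # S) F (e(k := (i, x))))" by simp
  qed
qed (use assms(1) in simp)

lemma nest_one:
  assumes "multilinear {k} (nest X od ou S F)" "X s (od s) (ou s) = [(k, i)]"
  shows "nest X od ou (s # S) F e = nest X od ou S F (e(k := (i, snd (e (Inr s)))))"
proof -
  have "nest X od ou (s # S) F e
      = sw True (snd (e (Inr s))) (\<lambda>x y. nest X od ou S F (e(k := (i, x))) * \<epsilon> y)"
    unfolding nest.simps assms(2) state_sum.simps by (intro sw_cong) (rule mult.commute)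
  also have "\<dots> = nest X od ou S F (e(k := (i, snd (e (Inr s)))))"
    by (rule sw_counit2) (rule multilinearD[OF assms(1)], simp)
  finally show ?thesis .
qed

text \<open>A strand passed downward meets its two lines in reversed order. The flag of
  \<open>sw\<close> records this, so that the slots keep fixed roles for both directions.\<close>

lemma nest_two:
  assumes ml: "multilinear {k, k'} (nest X od ou S F)" and ne: "k \<noteq> k'"
    and X: "X s (od s) (ou s) = (if u then [(k, i), (k', i')] else [(k', i'), (k, i)])"
  shows "nest X od ou (s # S) F e
    = sw u (snd (e (Inr s))) (\<lambda>x y. nest X od ou S F (e(k := (i, x), k' := (i', y))))"
proof -
  let ?N = "nest X od ou S F"
  have *: "state_sum [(h, j), (h', j')] ?N e c = sw True c (\<lambda>x y. ?N (e(h := (j, x), h' := (j', y))))"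
    if h': "h' \<in> {k, k'}" for h h' j j' c
  proof -
    have "sw True y (\<lambda>x' y'. \<epsilon> y' * ?N (e(h := (j, x), h' := (j', x')))) = ?N (e(h := (j, x), h' := (j', y)))" for x y
    proof -
      have "sw True y (\<lambda>x' y'. ?N (e(h := (j, x), h' := (j', x'))) * \<epsilon> y') = ?N (e(h := (j, x), h' := (j', y)))"
        by (rule sw_counit2) (rule multilinearD[OF ml h'])
      then show ?thesis by (simp only: mult.commute)
    qed
    then show ?thesis unfolding state_sum.simps by (intro sw_cong)
  qed
  have tw: "e(k' := v', k := v) = e(k := v, k' := v')" for v v'
    by (rule fun_upd_twist) (use ne in auto)
  show ?thesis
  proof (cases u)
    case True then show ?thesis unfolding nest.simps X by (simp only: if_True) (rule *, simp)
  next
    case False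
    then have "nest X od ou (s # S) F e
       = sw True (snd (e (Inr s))) (\<lambda>x y. ?N (e(k' := (i', x), k := (i, y))))"
      unfolding nest.simps X by (simp only: if_False) (rule *, simp)
    then show ?thesis using False unfolding tw by (simp only: sw_False)
  qed
qed

end

lemma (in coalgebra) nest_two_twice:
  assumes F: "multilinear K F" "K \<subseteq> range Inl" and K: "{a, a', d, d'} \<subseteq> K" "distinct [a, a', d, d']"
    and X: "X s (od s) (ou s) = (if u then [(a, i), (a', i')] else [(a', i'), (a, i)])"
      "X t (od t) (ou t) = (if v then [(d, j), (d', j')] else [(d', j'), (d, j)])"
  shows "nest X od ou [s, t] F e = sw u (snd (e (Inr s))) (\<lambda>x x'. sw v (snd (e (Inr t))) (\<lambda>y y'.
    F (e(a := (i, x), a' := (i', x'), d := (j, y), d' := (j', y')))))"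
proof -
  have "multilinear {a, a'} (nest X od ou [t] F)"
  proof (rule nest_multilinear)
    show "fst ` set (X q (od q) (ou q)) \<inter> {a, a'} = {}" if "q \<in> set [t]" for q
    proof -
      have "q = t" using that by simp
      then show ?thesis using K(2) by (auto simp: X)
    qed
  qed (use multilinear_subset[OF F(1)] K(1) F(2) in auto)
  moreover have "multilinear {d, d'} (nest X od ou [] F)"
    using multilinear_subset[OF F(1), of "{d, d'}"] K by simp
  moreover have "a \<noteq> Inr t" "a' \<noteq> Inr t" using K(1) F(2) by auto
  ultimately show ?thesis using K(2) by (simp add: nest_two[where X = X and s = s and od = od and ou = ou, OF _ _ X(1)] nest_two[where X = X and s = t and od = od and ou = ou, OF _ _ X(2)] del: nest.simps(2))
qed

lemma (in coalgebra) nest_two_thrice: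
  assumes F: "multilinear K F" "K \<subseteq> range Inl"
    and K: "{a, a', d, d', h, h'} \<subseteq> K" "distinct [a, a', d, d', h, h']"
    and X: "X s (od s) (ou s) = (if u then [(a, i), (a', i')] else [(a', i'), (a, i)])"
      "X t (od t) (ou t) = (if v then [(d, j), (d', j')] else [(d', j'), (d, j)])"
      "X r (od r) (ou r) = (if w then [(h, k), (h', k')] else [(h', k'), (h, k)])"
  shows "nest X od ou [s, t, r] F e = sw u (snd (e (Inr s))) (\<lambda>x x'. sw v (snd (e (Inr t))) (\<lambda>y y'.
    sw w (snd (e (Inr r))) (\<lambda>z z'.
    F (e(a := (i, x), a' := (i', x'), d := (j, y), d' := (j', y'), h := (k, z), h' := (k', z'))))))"
proof -
  have "multilinear {a, a'} (nest X od ou [t, r] F)"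
  proof (rule nest_multilinear)
    show "fst ` set (X q (od q) (ou q)) \<inter> {a, a'} = {}" if "q \<in> set [t, r]" for q
    proof -
      have "q = t \<or> q = r" using that by simp
      then have "fst ` set (X q (od q) (ou q)) \<subseteq> {d, d', h, h'}"
        by (rule disjE; simp only: X) (auto split: if_splits)
      then show ?thesis using K(2) by auto
    qed
  qed (use multilinear_subset[OF F(1)] K(1) F(2) in auto)
  moreover have "a \<noteq> Inr t" "a' \<noteq> Inr t" "a \<noteq> Inr r" "a' \<noteq> Inr r" using K(1) F(2) by auto
  moreover have "nest X od ou [t, r] F e = sw v (snd (e (Inr t))) (\<lambda>y y'. sw w (snd (e (Inr r))) (\<lambda>z z'.
    F (e(d := (j, y), d' := (j', y'), h := (k, z), h' := (k', z')))))" for e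
    using K by (intro nest_two_twice[where X = X and s = t and t = r and od = od and ou = ou, OF F _ _ X(2,3)]) auto
  ultimately show ?thesis using K(2) by (simp add: nest_two[where X = X and s = s and od = od and ou = ou, OF _ _ X(1)] del: nest.simps(2))
qed

lemma (in coalgebra) nest_one_twice:
  assumes F: "multilinear K F" "K \<subseteq> range Inl" and K: "{a, d} \<subseteq> K" "a \<noteq> d"
    and X: "X s (od s) (ou s) = [(a, i)]" "X t (od t) (ou t) = [(d, j)]"
  shows "nest X od ou [s, t] F e = F (e(a := (i, snd (e (Inr s))), d := (j, snd (e (Inr t)))))"
proof -
  have "multilinear {a} (nest X od ou [t] F)"
  proof (rule nest_multilinear)
    show "fst ` set (X q (od q) (ou q)) \<inter> {a} = {}" if "q \<in> set [t]" for q
    proof -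
      have "q = t" using that by simp
      then show ?thesis using K(2) by (simp add: X)
    qed
  qed (use multilinear_subset[OF F(1)] K(1) F(2) in auto)
  moreover have "multilinear {d} (nest X od ou [] F)"
    using multilinear_subset[OF F(1), of "{d}"] K by simp
  moreover have "a \<noteq> Inr t" using K(1) F(2) by auto
  ultimately show ?thesis by (simp add: nest_one[where X = X and s = s and od = od and ou = ou, OF _ X(1)]
      nest_one[where X = X and s = t and od = od and ou = ou, OF _ X(2)] del: nest.simps(2))
qed

lemma other_line [simp]:
  "other_line (other_line l) = l" "other_line l \<noteq> l" "l \<noteq> other_line l"
  "other_line l = SWNE \<longleftrightarrow> l = NWSE" "other_line l = NWSE \<longleftrightarrow> l = SWNE" "l \<noteq> SWNE \<longleftrightarrow> l = NWSE"
  by (cases l; simp)+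

definition two_lines :: "bool \<Rightarrow> nat \<Rightarrow> line \<Rightarrow> nat \<Rightarrow> line \<Rightarrow> event list" where
  "two_lines up k l k' l' = (if up then [Cross_Line k l True, Cross_Line k' l' True]
     else [Cross_Line k' l' False, Cross_Line k l False])"

lemma inner_items_two_lines:
  "E s = two_lines up k l k' l' \<Longrightarrow> inner_items id E s m n =
     (if up then [(Inl ((1, k), l), (up, m, n)), (Inl ((1, k'), l'), (up, m, n))]
      else [(Inl ((1, k'), l'), (up, m, n)), (Inl ((1, k), l), (up, m, n))])"
  by (simp add: inner_items_def two_lines_def)

lemma turns_two_lines [simp]: "dturns (two_lines up k l k' l') = 0" "uturns (two_lines up k l k' l') = 0"
  by (simp_all add: two_lines_def)

lemma line_keys_two_lines [simp]: "set (line_keys (two_lines up k l k' l')) = {(k, l), (k', l')}"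
  by (auto simp: two_lines_def)

context oriented_quantum_coalgebra begin

lemma slices_weight_Nil [simp]: "slices_weight [] g = 1"
  by (simp add: slices_weight_def)

lemma slices_weight_Cons [simp]:
  "slices_weight (a # w) g = piece_weight (fst a) (g 0) * slices_weight w (\<lambda>k. g (Suc k))"
  using slices_weight_append[of "[a]" w g] by (simp add: slices_weight_def)

lemma dual_oriented:
  assumes "\<tau> = (\<not> \<sigma>)" "m' = m + (if s = t then 0 else if \<sigma> then 1 else - 1)"
    "n' = n + (if s = t then 0 else if \<sigma> then 1 else - 1)"
  shows "dual_pair s t (tform \<sigma> m n) (tform \<tau> m' n')"
  using dual_same[of s \<sigma> m n] dual_opposite'[of s t \<sigma> m n] unfolding assms by (cases "s = t") simp_all

lemma b_pw: "b (pw m n x) (pw m' n' y) = tform True (m - m') (n - n') x y"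
  and binv_pw: "binv (pw m n x) (pw m' n' y) = tform False (m - m') (n - n') x y"
  using form_pw[of True] form_pw[of False] by (simp_all add: tform_def form_def)

text \<open>All eight cases of the crossing factor in one formula. Parallel lines give
  \<open>b\<close> exactly for an over line SW--NE, antiparallel lines exactly for NW--SE. The
  offsets are the shifts of the brackets, counted negatively when they belong to the under
  line.\<close>

lemma crossing_weight_tform:
  "crossing_weight c ((s, m, n), x) ((t, m', n'), y) = tform ((c = SWNE) = (s = t))
     (m - m' + (if s = t then 0 else if c = SWNE then (if s then 0 else 1) else (if s then - 1 else 0)))
     (n - n' + (if s = t then 0 else if c = SWNE then (if s then 1 else 0) else (if s then 0 else - 1))) x y"
  by (cases c; cases s; cases t; simp add: crossing_weight_def b_pw binv_pw algebra_simps)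

lemma multilinear_middle:
  fixes \<pi> :: "nat \<Rightarrow> nat"
  assumes "inj \<pi>"
  shows "multilinear ((\<lambda>(k, z). Inl ((1, \<pi> k), z)) ` (crossings w \<times> UNIV))
    (\<lambda>e :: slot \<Rightarrow> info \<times> 'c. slices_weight w (\<lambda>k z. e (Inl ((1, \<pi> k), z))))"
proof -
  have "inj (\<lambda>(k, z). Inl ((1, \<pi> k), z) :: slot)" using assms by (auto simp: inj_def)
  from multilinear_slices_weight[OF this, of w] show ?thesis by (simp only: prod.case)
qed

text \<open>The two extrema of the bend cancel in both turning counts, and there is no crossing line
  between them. The bend takes the role of the nonempty part.\<close>

lemma Inv_M1:
  assumes "l = [(Local_Min, Suc i), (Local_Max, i)] \<or> l = [(Local_Min, i), (Local_Max, Suc i)]"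
    and "Diagram (v @ l @ w) u \<in> Tang" "Diagram (v @ [] @ w) u \<in> Tang"
  shows "Inv \<Delta> \<epsilon> b binv Td Tu (Diagram (v @ l @ w) u) = Inv \<Delta> \<epsilon> b binv Td Tu (Diagram (v @ [] @ w) u)"
proof -
  define E where "E = (\<lambda>s :: strand. case s of (up, p) \<Rightarrow> if p = i then
    if l = [(Local_Min, Suc i), (Local_Max, i)] then (if up then [U_minus, U_plus] else [D_minus, D_plus])
    else (if up then [D_plus, D_minus] else [U_plus, U_minus]) else [])"
  have "realizes l (\<lambda>s. s) E"
    using assms(1) by (intro realizesI) (auto simp: E_def eval_nat_numeral)
  then show ?thesis
    using assms(1)
    by (intro Inv_replace[OF assms(2,3) _ _ realizes_Nil _ _ inj_on_id, where arcs = "[]"])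
      (auto simp: E_def inner_items_def)
qed

lemma Inv_M2:
  assumes l: "l = [(Crossing c, i), (Crossing (other_line c), i)]"
    and T: "Diagram (v @ l @ w) u \<in> Tang" "Diagram (v @ [] @ w) u \<in> Tang"
  shows "Inv \<Delta> \<epsilon> b binv Td Tu (Diagram (v @ l @ w) u) = Inv \<Delta> \<epsilon> b binv Td Tu (Diagram (v @ [] @ w) u)"
proof -
  \<comment> \<open>The positions at which the over strand and the under strand enter, the same at
    the bottom and at the top.\<close>
  define px py where "px = (if c = SWNE then i else Suc i)" and "py = (if c = SWNE then Suc i else i)"
  define E where "E = (\<lambda>s :: strand. case s of (up, p) \<Rightarrow>
    if p = px then two_lines up 0 c 1 (other_line c)
    else if p = py then two_lines up 0 (other_line c) 1 c else [])"
  have ne: "px \<noteq> py" by (simp add: px_def py_def)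
  have E: "E (up, px) = two_lines up 0 c 1 (other_line c)" "E (up, py) = two_lines up 0 (other_line c) 1 c" for up
    using ne by (simp_all add: E_def)
  have r: "realizes l (\<lambda>s. s) E"
    by (rule realizesI, cases c) (auto simp: l E_def px_def py_def two_lines_def eval_nat_numeral)
  show ?thesis
  proof (rule Inv_replace[OF T _ r realizes_Nil _ _ inj_on_id,
        where arcs = "[((True, px), (False, px)), ((True, py), (False, py))]"])
    fix s s' assume "(s, s') \<in> set [((True, px), (False, px)), ((True, py), (False, py))]"
    then consider "s = (True, px)" "s' = (False, px)" | "s = (True, py)" "s' = (False, py)" by auto
    then show "s \<noteq> s' \<and> (\<exists>j z. (j, z) \<in> set (line_keys (E s)) \<and> (j, z) \<in> set (line_keys (E s')) \<and>
        (\<forall>t. (j, z) \<in> set (line_keys (E t)) \<longrightarrow> t = s \<or> t = s'))"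
    proof cases
      case 1 then show ?thesis
        by (intro conjI exI[of _ 0] exI[of _ c]) (auto simp: E_def split: if_splits)
    next
      case 2 then show ?thesis
        by (intro conjI exI[of _ 0] exI[of _ "other_line c"]) (use ne in \<open>auto simp: E_def split: if_splits\<close>)
    qed
  next
    fix s m n
    assume *: "\<And>t t'. (t, t') \<in> set [((True, px), (False, px)), ((True, py), (False, py))] \<Longrightarrow> s \<noteq> t \<and> s \<noteq> t'"
    have "E s = []"
      using *[of "(True, px)" "(False, px)"] *[of "(True, py)" "(False, py)"]
      by (cases s; cases "fst s") (simp_all add: E_def)
    then show "inner_items id E s m n = inner_items id (\<lambda>_. []) s m n" by (simp add: inner_items_def)
  next
    fix S od ou and e :: "slot \<Rightarrow> info \<times> 'c"
    assume "list_all2 (\<lambda>s (t, t'). s = t \<or> s = t') S [((True, px), (False, px)), ((True, py), (False, py))]"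
    then obtain s t where S: "S = [(s, px), (t, py)]"
      by (auto simp: list_all2_Cons2)
    let ?x = "(s, px)" and ?y = "(t, py)"
    let ?cx = "snd (e (Inr ?x))" and ?cy = "snd (e (Inr ?y))"
    let ?f = "\<lambda>c. tform ((c = SWNE) = (s = t))
     (od ?x - od ?y + (if s = t then 0 else if c = SWNE then (if s then 0 else 1) else (if s then - 1 else 0)))
     (ou ?x - ou ?y + (if s = t then 0 else if c = SWNE then (if s then 1 else 0) else (if s then 0 else - 1)))"
    have "nest (inner_items id E) od ou S (\<lambda>e. slices_weight l (\<lambda>k z. e (Inl ((1, id k), z)))) e
      = sw s ?cx (\<lambda>x x'. sw t ?cy (\<lambda>y y'. ?f c x y * ?f (other_line c) x' y'))"
      unfolding S
      by (subst nest_two_twice[OF multilinear_middle[OF inj_on_id] _ _ _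
            inner_items_two_lines[of E, OF E(1)] inner_items_two_lines[of E, OF E(2)]])
        (auto simp: l crossings_def crossing_weight_tform less_Suc_eq image_iff)
    also have "\<dots> = \<epsilon> ?cx * \<epsilon> ?cy"
    proof -
      \<comment> \<open>Between the two crossings the offsets differ by exactly the shift of an
        inverse across opposite directions.\<close>
      have "dual_pair s t (?f c) (?f (other_line c))"
        by (rule dual_oriented; cases c; cases s; cases t; simp)
      then show ?thesis by (simp add: dual_pair_def)
    qed
    finally show "nest (inner_items id E) od ou S (\<lambda>e. slices_weight l (\<lambda>k z. e (Inl ((1, k), z)))) e
      = nest (inner_items id (\<lambda>_. [])) od ou S (\<lambda>e. slices_weight [] (\<lambda>k z. e (Inl ((1, id k), z)))) e"
      by (simp add: S inner_items_def)
  qed (use ne in \<open>auto simp: l E_def inner_items_def split: if_splits\<close>)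
qed

text \<open>The line over the two others is \<open>x\<close> and the line under the two others is \<open>z\<close>; they enter at the bottom
  at \<open>px\<close> and \<open>pz\<close>.\<close>

lemma Inv_M3:
  assumes j: "j = (if c = SWNE then i else Suc i)" "j' = (if c = SWNE then Suc i else i)"
    and l: "l = [(Crossing c, j), (Crossing c, j'), (Crossing c, j)]"
    and r: "r = [(Crossing c, j'), (Crossing c, j), (Crossing c, j')]"
    and T: "Diagram (v @ l @ w) u \<in> Tang" "Diagram (v @ r @ w) u \<in> Tang"
  shows "Inv \<Delta> \<epsilon> b binv Td Tu (Diagram (v @ l @ w) u) = Inv \<Delta> \<epsilon> b binv Td Tu (Diagram (v @ r @ w) u)"
proof -
  define px pz where "px = (if c = SWNE then i else Suc (Suc i))" and "pz = (if c = SWNE then Suc (Suc i) else i)"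
  \<comment> \<open>The three strands leave in reversed order, so the line over the others enters at
    \<open>pz\<close> when it comes from the top.\<close>
  define E where "E = (\<lambda>s :: strand. case s of (up, p) \<Rightarrow>
    if p = (if up then px else pz) then two_lines up 0 c 1 c
    else if p = Suc i then two_lines up 0 (other_line c) 2 c
    else if p = (if up then pz else px) then two_lines up 1 (other_line c) 2 (other_line c) else [])"
  define E' where "E' = (\<lambda>s :: strand. case s of (up, p) \<Rightarrow>
    if p = (if up then px else pz) then two_lines up 1 c 2 c
    else if p = Suc i then two_lines up 0 c 2 (other_line c)
    else if p = (if up then pz else px) then two_lines up 0 (other_line c) 1 (other_line c) else [])"
  define conn where "conn = (\<lambda>s :: strand. case s of (up, p) \<Rightarrow>
    (up, if p = i then Suc (Suc i) else if p = Suc (Suc i) then i else p))"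
  define arcs :: "(strand \<times> strand) list" where
    "arcs = [((True, px), (False, pz)), ((True, Suc i), (False, Suc i)), ((True, pz), (False, px))]"
  have ne: "px \<noteq> pz" "px \<noteq> Suc i" "pz \<noteq> Suc i" by (simp_all add: px_def pz_def)
  have E: "E (up, if up then px else pz) = two_lines up 0 c 1 c" "E (up, Suc i) = two_lines up 0 (other_line c) 2 c"
    "E (up, if up then pz else px) = two_lines up 1 (other_line c) 2 (other_line c)" for up
    using ne by (simp_all add: E_def)
  have E': "E' (up, if up then px else pz) = two_lines up 1 c 2 c" "E' (up, Suc i) = two_lines up 0 c 2 (other_line c)"
    "E' (up, if up then pz else px) = two_lines up 0 (other_line c) 1 (other_line c)" for up
    using ne by (simp_all add: E'_def)
  have rl: "realizes l conn E"
    by (rule realizesI, cases c)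
      (auto simp: l j E_def conn_def px_def pz_def two_lines_def eval_nat_numeral)
  have rr: "realizes r conn E'"
    by (rule realizesI, cases c)
      (auto simp: r j E'_def conn_def px_def pz_def two_lines_def eval_nat_numeral)
  show ?thesis
  proof (rule Inv_replace[OF T _ rl rr _ _ inj_on_id, where arcs = arcs])
    fix s s' assume "(s, s') \<in> set arcs"
    then consider "s = (True, px)" "s' = (False, pz)" | "s = (True, Suc i)" "s' = (False, Suc i)"
      | "s = (True, pz)" "s' = (False, px)" by (auto simp: arcs_def)
    then show "s \<noteq> s' \<and> (\<exists>j z. (j, z) \<in> set (line_keys (E s)) \<and> (j, z) \<in> set (line_keys (E s')) \<and>
        (\<forall>t. (j, z) \<in> set (line_keys (E t)) \<longrightarrow> t = s \<or> t = s'))"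
    proof cases
      case 1 then show ?thesis
        by (intro conjI exI[of _ 0] exI[of _ c]) (use ne in \<open>auto simp: E_def split: if_splits\<close>)
    next
      case 2 then show ?thesis
        by (intro conjI exI[of _ 2] exI[of _ c]) (use ne in \<open>auto simp: E_def split: if_splits\<close>)
    next
      case 3 then show ?thesis
        by (intro conjI exI[of _ 2] exI[of _ "other_line c"]) (use ne in \<open>auto simp: E_def split: if_splits\<close>)
    qed
  next
    fix s m n
    assume *: "\<And>t t'. (t, t') \<in> set arcs \<Longrightarrow> s \<noteq> t \<and> s \<noteq> t'"
    have "E s = [] \<and> E' s = []"
      using *[of "(True, px)" "(False, pz)"] *[of "(True, pz)" "(False, px)"] *[of "(True, Suc i)" "(False, Suc i)"]
      by (cases s; cases "fst s") (simp_all add: E_def E'_def arcs_def)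
    then show "inner_items id E s m n = inner_items id E' s m n" by (simp add: inner_items_def)
  next
    fix S od ou and e :: "slot \<Rightarrow> info \<times> 'c"
    assume "list_all2 (\<lambda>s (t, t'). s = t \<or> s = t') S arcs"
    then obtain x y z where *: "S = [x, y, z]" "x = (True, px) \<or> x = (False, pz)"
      "y = (True, Suc i) \<or> y = (False, Suc i)" "z = (True, pz) \<or> z = (False, px)"
      unfolding arcs_def list_all2_Cons2 list_all2_Nil2 by auto
    define s t u where "s = fst x" and "t = fst y" and "u = fst z"
    have S: "S = [(s, if s then px else pz), (t, Suc i), (u, if u then pz else px)]"
      using * by (auto simp: s_def t_def u_def)
    let ?x = "(s, if s then px else pz)" and ?y = "(t, Suc i)" and ?z = "(u, if u then pz else px)"
    let ?cx = "snd (e (Inr ?x))" and ?cy = "snd (e (Inr ?y))" and ?cz = "snd (e (Inr ?z))"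
    define W where "W = (\<lambda>(s :: bool, x :: nat) (t :: bool, y :: nat). tform ((c = SWNE) = (s = t))
     (od (s, x) - od (t, y) + (if s = t then 0 else if c = SWNE then (if s then 0 else 1) else (if s then - 1 else 0)))
     (ou (s, x) - ou (t, y) + (if s = t then 0 else if c = SWNE then (if s then 1 else 0) else (if s then 0 else - 1))))"
    \<comment> \<open>The offset of the crossing of \<open>x\<close> and \<open>z\<close> exceeds
      the sum of the other two offsets by exactly the defect \<open>k\<close> of
      \<open>yang_baxter_oriented\<close>.\<close>
    have "yang_baxter s t u (W ?x ?y) (W ?x ?z) (W ?y ?z)"
      unfolding W_def prod.case
      by (rule yang_baxter_oriented; cases c; cases s; cases t; cases u; simp)
    then have "hexagon s t u (W ?x ?y) (W ?x ?z) (W ?y ?z) ?cx ?cy ?cz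
        = hexagon (\<not> s) (\<not> t) (\<not> u) (W ?x ?y) (W ?x ?z) (W ?y ?z) ?cx ?cy ?cz"
      by (simp add: yang_baxter_def)
    moreover have "nest (inner_items id E) od ou S (\<lambda>e. slices_weight l (\<lambda>k z. e (Inl ((1, id k), z)))) e
      = hexagon s t u (W ?x ?y) (W ?x ?z) (W ?y ?z) ?cx ?cy ?cz"
      unfolding S
      by (subst nest_two_thrice[OF multilinear_middle[OF inj_on_id] _ _ _
            inner_items_two_lines[of E, OF E(1)] inner_items_two_lines[of E, OF E(2)] inner_items_two_lines[of E, OF E(3)]])
        (auto simp: l crossings_def crossing_weight_tform less_Suc_eq image_iff hexagon_def W_def ac_simps)
    \<comment> \<open>In the other triangle every strand meets its two crossings in the opposite
      order, hence the negated flags.\<close>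
    moreover have "nest (inner_items id E') od ou S (\<lambda>e. slices_weight r (\<lambda>k z. e (Inl ((1, id k), z)))) e
      = hexagon (\<not> s) (\<not> t) (\<not> u) (W ?x ?y) (W ?x ?z) (W ?y ?z) ?cx ?cy ?cz"
      unfolding S
      by (subst nest_two_thrice[OF multilinear_middle[OF inj_on_id] _ _ _
            inner_items_two_lines[of E', OF E'(1)] inner_items_two_lines[of E', OF E'(2)] inner_items_two_lines[of E', OF E'(3)]])
        (auto simp: r crossings_def crossing_weight_tform less_Suc_eq image_iff hexagon_def W_def sw_flip[symmetric] ac_simps)
    ultimately show "nest (inner_items id E) od ou S (\<lambda>e. slices_weight l (\<lambda>k z. e (Inl ((1, k), z)))) e
      = nest (inner_items id E') od ou S (\<lambda>e. slices_weight r (\<lambda>k z. e (Inl ((1, id k), z)))) e"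
      by simp
  qed (use ne in \<open>auto simp: l E_def E'_def arcs_def\<close>)
qed

end

lemma run_exchange:
  fixes \<sigma> :: "nat \<Rightarrow> nat"
  assumes \<sigma>: "\<sigma> 0 = 1" "\<sigma> 1 = 0"
    and l: "l = [(e, i), (f, i + ends_above e + p)]" and r: "r = [(f, i + ends_below e + p), (e, i)]"
  shows "\<exists>es u' q'. run 4 l (entry_point l (u, q)) = (es, (if u' then 2 else 0, q', u')) \<and>
    run 4 r (entry_point r (u, q)) = (map (map_crossing \<sigma>) es, (if u' then 2 else 0, q', u'))"
proof -
  have \<sigma>': "\<sigma> (Suc 0) = 0" using \<sigma> by simp
  define m n where "m = (if u then ends_below e else ends_above e)"
    and "n = (if u then ends_below f else ends_above f)"
  have mn: "m = 0 \<or> m = 2" "n = 0 \<or> n = 2" by (cases e; simp add: m_def) (cases f; simp add: n_def)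
  \<comment> \<open>Left of both pieces, at an end of \<open>e\<close>, between the pieces, at an
    end of \<open>f\<close>, or right of both. An extremum has no ends on one side, and its case is
    then void.\<close>
  have "q < i \<or> (m = 2 \<and> (q = i \<or> q = i + 1)) \<or> (\<exists>d. q = i + m + d \<and> d < p) \<or>
     (n = 2 \<and> (q = i + m + p \<or> q = i + m + p + 1)) \<or> (\<exists>d. q = i + m + p + n + d)"
    using mn by presburger
  then consider "q < i" | "m = 2" "q = i" | "m = 2" "q = i + 1" | d where "q = i + m + d" "d < p"
    | "n = 2" "q = i + m + p" | "n = 2" "q = i + m + p + 1" | d where "q = i + m + p + n + d"
    by blast
  then show ?thesis
  proof cases
    case 1
    show ?thesis unfolding l r using 1 by (cases u) (auto simp: eval_nat_numeral)
  next
    case 2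
    then show ?thesis unfolding l r m_def by (cases u; cases e; auto simp: eval_nat_numeral \<sigma> \<sigma>')
  next
    case 3
    then show ?thesis unfolding l r m_def by (cases u; cases e; auto simp: eval_nat_numeral \<sigma> \<sigma>')
  next
    case 4
    then show ?thesis unfolding l r m_def by (cases u; auto simp: eval_nat_numeral \<sigma> \<sigma>')
  next
    case 5
    then show ?thesis unfolding l r m_def n_def by (cases u; cases f; auto simp: eval_nat_numeral \<sigma> \<sigma>')
  next
    case 6
    then show ?thesis unfolding l r m_def n_def by (cases u; cases f; auto simp: eval_nat_numeral \<sigma> \<sigma>')
  next
    case 7
    then show ?thesis unfolding l r m_def n_def by (cases u; auto simp: eval_nat_numeral \<sigma> \<sigma>')
  qed
qed

context oriented_quantum_coalgebra begin

text \<open>The crossing moves from one leg of the arc to the other. The line of the arc changes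
  direction and gains or loses the turn of the maximum, and the offset of the crossing factor
  changes by the same amount, so both sides are the same twisted form.\<close>

lemma Inv_M4_max:
  assumes l: "l = [(Crossing c, i), (Local_Max, Suc i)]"
    and r: "r = [(Crossing (other_line c), Suc i), (Local_Max, i)]"
    and T: "Diagram (v @ l @ w) u \<in> Tang" "Diagram (v @ r @ w) u \<in> Tang"
  shows "Inv \<Delta> \<epsilon> b binv Td Tu (Diagram (v @ l @ w) u) = Inv \<Delta> \<epsilon> b binv Td Tu (Diagram (v @ r @ w) u)"
proof -
  define E where "E = (\<lambda>s :: strand. case s of (up, p) \<Rightarrow>
    if up \<and> p = Suc i then [Cross_Line 0 NWSE True] else if \<not> up \<and> p = i then [Cross_Line 0 NWSE False]
    else if up \<and> p = i then [Cross_Line 0 SWNE True, U_minus]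
    else if up \<and> p = Suc (Suc i) then [D_plus, Cross_Line 0 SWNE False] else [])"
  define E' where "E' = (\<lambda>s :: strand. case s of (up, p) \<Rightarrow>
    if up \<and> p = Suc i then [Cross_Line 0 SWNE True] else if \<not> up \<and> p = i then [Cross_Line 0 SWNE False]
    else if up \<and> p = i then [U_minus, Cross_Line 0 NWSE False]
    else if up \<and> p = Suc (Suc i) then [Cross_Line 0 NWSE True, D_plus] else [])"
  define conn where "conn = (\<lambda>s :: strand. case s of (up, p) \<Rightarrow>
    if up then (if p < i then (True, p) else if p = i then (False, Suc (Suc i)) else if p = Suc i then (True, i)
      else if p = Suc (Suc i) then (False, i) else (True, p - 2))
    else (False, if p < i then p else if p = i then Suc i else Suc (Suc p)))"
  define arcs :: "(strand \<times> strand) list" where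
    "arcs = [((True, Suc i), (False, i)), ((True, i), (True, Suc (Suc i)))]"
  have rl: "realizes l conn E"
    by (rule realizesI) (auto simp: l E_def conn_def eval_nat_numeral)
  have rr: "realizes r conn E'"
    by (rule realizesI) (auto simp: r E'_def conn_def eval_nat_numeral)
  show ?thesis
  proof (rule Inv_replace[OF T _ rl rr _ _ inj_on_id, where arcs = arcs])
    fix s s' assume "(s, s') \<in> set arcs"
    then consider "s = (True, Suc i)" "s' = (False, i)" | "s = (True, i)" "s' = (True, Suc (Suc i))"
      by (auto simp: arcs_def)
    then show "s \<noteq> s' \<and> (\<exists>j z. (j, z) \<in> set (line_keys (E s)) \<and> (j, z) \<in> set (line_keys (E s')) \<and>
        (\<forall>t. (j, z) \<in> set (line_keys (E t)) \<longrightarrow> t = s \<or> t = s'))"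
    proof cases
      case 1 then show ?thesis
        by (intro conjI exI[of _ 0] exI[of _ NWSE]) (auto simp: E_def split: if_splits)
    next
      case 2 then show ?thesis
        by (intro conjI exI[of _ 0] exI[of _ SWNE]) (auto simp: E_def split: if_splits)
    qed
  next
    fix s m n
    assume *: "\<And>t t'. (t, t') \<in> set arcs \<Longrightarrow> s \<noteq> t \<and> s \<noteq> t'"
    have "E s = [] \<and> E' s = []"
      using *[of "(True, Suc i)" "(False, i)"] *[of "(True, i)" "(True, Suc (Suc i))"]
      by (cases s; cases "fst s") (simp_all add: E_def E'_def arcs_def)
    then show "inner_items id E s m n = inner_items id E' s m n" by (simp add: inner_items_def)
  next
    fix S od ou and e :: "slot \<Rightarrow> info \<times> 'c"
    assume "list_all2 (\<lambda>s (t, t'). s = t \<or> s = t') S arcs"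
    then obtain s t where S: "S = [s, t]" "s = (True, Suc i) \<or> s = (False, i)"
      "t = (True, i) \<or> t = (True, Suc (Suc i))"
      unfolding arcs_def list_all2_Cons2 list_all2_Nil2 by auto
    obtain x y where x: "s = (x, if x then Suc i else i)" and y: "t = (True, if y then i else Suc (Suc i))"
      using S(2,3) by (metis (full_types))
    have s: "inner_items id E s (od s) (ou s) = [(Inl ((1, 0), NWSE), (x, od s, ou s))]"
      "inner_items id E' s (od s) (ou s) = [(Inl ((1, 0), SWNE), (x, od s, ou s))]"
      by (cases x; simp add: x inner_items_def E_def E'_def)+
    have t: "inner_items id E t (od t) (ou t) = [(Inl ((1, 0), SWNE), (y, od t, if y then ou t - 1 else ou t))]"
      "inner_items id E' t (od t) (ou t) = [(Inl ((1, 0), NWSE), (\<not> y, if y then od t else od t + 1, ou t))]"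
      by (cases y; simp add: y inner_items_def E_def E'_def)+
    let ?L = "\<lambda>e :: slot \<Rightarrow> info \<times> 'c. slices_weight l (\<lambda>k z. e (Inl ((1, id k), z)))"
    let ?R = "\<lambda>e :: slot \<Rightarrow> info \<times> 'c. slices_weight r (\<lambda>k z. e (Inl ((1, id k), z)))"
    have "nest (inner_items id E) od ou [s, t] ?L e = ?L (e(Inl ((1, 0), NWSE) := ((x, od s, ou s), snd (e (Inr s))),
        Inl ((1, 0), SWNE) := ((y, od t, if y then ou t - 1 else ou t), snd (e (Inr t)))))"
      by (rule nest_one_twice[where X = "inner_items id E" and s = s and t = t and od = od and ou = ou,
            OF multilinear_middle[OF inj_on_id] _ _ _ s(1) t(1)])
        (auto simp: l crossings_def image_iff)
    moreover have "nest (inner_items id E') od ou [s, t] ?R e = ?R (e(Inl ((1, 0), SWNE) := ((x, od s, ou s), snd (e (Inr s))),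
        Inl ((1, 0), NWSE) := ((\<not> y, if y then od t else od t + 1, ou t), snd (e (Inr t)))))"
      by (rule nest_one_twice[where X = "inner_items id E'" and s = s and t = t and od = od and ou = ou,
            OF multilinear_middle[OF inj_on_id] _ _ _ s(2) t(2)])
        (auto simp: r crossings_def image_iff)
    ultimately show "nest (inner_items id E) od ou S (\<lambda>e. slices_weight l (\<lambda>k z. e (Inl ((1, k), z)))) e
      = nest (inner_items id E') od ou S (\<lambda>e. slices_weight r (\<lambda>k z. e (Inl ((1, id k), z)))) e"
      unfolding S(1) by (cases c; cases x; cases y; simp add: l r crossing_weight_tform algebra_simps)
  qed (auto simp: l E_def E'_def arcs_def)
qed

text \<open>The same compensation as for the maximum, with the turn of the minimum and the arc
  entered from above.\<close>

lemma Inv_M4_min: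
  assumes l: "l = [(Local_Min, Suc i), (Crossing c, i)]"
    and r: "r = [(Local_Min, i), (Crossing (other_line c), Suc i)]"
    and T: "Diagram (v @ l @ w) u \<in> Tang" "Diagram (v @ r @ w) u \<in> Tang"
  shows "Inv \<Delta> \<epsilon> b binv Td Tu (Diagram (v @ l @ w) u) = Inv \<Delta> \<epsilon> b binv Td Tu (Diagram (v @ r @ w) u)"
proof -
  define E where "E = (\<lambda>s :: strand. case s of (up, p) \<Rightarrow>
    if up \<and> p = i then [Cross_Line 1 SWNE True] else if \<not> up \<and> p = Suc i then [Cross_Line 1 SWNE False]
    else if \<not> up \<and> p = i then [Cross_Line 1 NWSE False, U_plus]
    else if \<not> up \<and> p = Suc (Suc i) then [D_minus, Cross_Line 1 NWSE True] else [])"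
  define E' where "E' = (\<lambda>s :: strand. case s of (up, p) \<Rightarrow>
    if up \<and> p = i then [Cross_Line 1 NWSE True] else if \<not> up \<and> p = Suc i then [Cross_Line 1 NWSE False]
    else if \<not> up \<and> p = i then [U_plus, Cross_Line 1 SWNE True]
    else if \<not> up \<and> p = Suc (Suc i) then [Cross_Line 1 SWNE False, D_minus] else [])"
  define conn where "conn = (\<lambda>s :: strand. case s of (up, p) \<Rightarrow>
    if \<not> up then (if p < i then (False, p) else if p = i then (True, Suc (Suc i)) else if p = Suc i then (False, i)
      else if p = Suc (Suc i) then (True, i) else (False, p - 2))
    else (True, if p < i then p else if p = i then Suc i else Suc (Suc p)))"
  define arcs :: "(strand \<times> strand) list" where
    "arcs = [((True, i), (False, Suc i)), ((False, i), (False, Suc (Suc i)))]"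
  have rl: "realizes l conn E"
    by (rule realizesI) (auto simp: l E_def conn_def eval_nat_numeral)
  have rr: "realizes r conn E'"
    by (rule realizesI) (auto simp: r E'_def conn_def eval_nat_numeral)
  show ?thesis
  proof (rule Inv_replace[OF T _ rl rr _ _ inj_on_id, where arcs = arcs])
    fix s s' assume "(s, s') \<in> set arcs"
    then consider "s = (True, i)" "s' = (False, Suc i)" | "s = (False, i)" "s' = (False, Suc (Suc i))"
      by (auto simp: arcs_def)
    then show "s \<noteq> s' \<and> (\<exists>j z. (j, z) \<in> set (line_keys (E s)) \<and> (j, z) \<in> set (line_keys (E s')) \<and>
        (\<forall>t. (j, z) \<in> set (line_keys (E t)) \<longrightarrow> t = s \<or> t = s'))"
    proof cases
      case 1 then show ?thesis
        by (intro conjI exI[of _ 1] exI[of _ SWNE]) (auto simp: E_def split: if_splits)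
    next
      case 2 then show ?thesis
        by (intro conjI exI[of _ 1] exI[of _ NWSE]) (auto simp: E_def split: if_splits)
    qed
  next
    fix s m n
    assume *: "\<And>t t'. (t, t') \<in> set arcs \<Longrightarrow> s \<noteq> t \<and> s \<noteq> t'"
    have "E s = [] \<and> E' s = []"
      using *[of "(True, i)" "(False, Suc i)"] *[of "(False, i)" "(False, Suc (Suc i))"]
      by (cases s; cases "fst s") (simp_all add: E_def E'_def arcs_def)
    then show "inner_items id E s m n = inner_items id E' s m n" by (simp add: inner_items_def)
  next
    fix S od ou and e :: "slot \<Rightarrow> info \<times> 'c"
    assume "list_all2 (\<lambda>s (t, t'). s = t \<or> s = t') S arcs"
    then obtain s t where S: "S = [s, t]" "s = (True, i) \<or> s = (False, Suc i)"
      "t = (False, i) \<or> t = (False, Suc (Suc i))"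
      unfolding arcs_def list_all2_Cons2 list_all2_Nil2 by auto
    obtain x y where x: "s = (x, if x then i else Suc i)" and y: "t = (False, if y then i else Suc (Suc i))"
      using S(2,3) by (metis (full_types))
    have s: "inner_items id E s (od s) (ou s) = [(Inl ((1, 1), SWNE), (x, od s, ou s))]"
      "inner_items id E' s (od s) (ou s) = [(Inl ((1, 1), NWSE), (x, od s, ou s))]"
      by (cases x; simp add: x inner_items_def E_def E'_def)+
    have t: "inner_items id E t (od t) (ou t) = [(Inl ((1, 1), NWSE), (\<not> y, od t, if y then ou t + 1 else ou t))]"
      "inner_items id E' t (od t) (ou t) = [(Inl ((1, 1), SWNE), (y, if y then od t else od t - 1, ou t))]"
      by (cases y; simp add: y inner_items_def E_def E'_def)+
    let ?L = "\<lambda>e :: slot \<Rightarrow> info \<times> 'c. slices_weight l (\<lambda>k z. e (Inl ((1, id k), z)))"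
    let ?R = "\<lambda>e :: slot \<Rightarrow> info \<times> 'c. slices_weight r (\<lambda>k z. e (Inl ((1, id k), z)))"
    have "nest (inner_items id E) od ou [s, t] ?L e = ?L (e(Inl ((1, 1), SWNE) := ((x, od s, ou s), snd (e (Inr s))),
        Inl ((1, 1), NWSE) := ((\<not> y, od t, if y then ou t + 1 else ou t), snd (e (Inr t)))))"
      by (rule nest_one_twice[where X = "inner_items id E" and s = s and t = t and od = od and ou = ou,
            OF multilinear_middle[OF inj_on_id] _ _ _ s(1) t(1)])
        (auto simp: l crossings_def image_iff)
    moreover have "nest (inner_items id E') od ou [s, t] ?R e = ?R (e(Inl ((1, 1), NWSE) := ((x, od s, ou s), snd (e (Inr s))),
        Inl ((1, 1), SWNE) := ((y, if y then od t else od t - 1, ou t), snd (e (Inr t)))))"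
      by (rule nest_one_twice[where X = "inner_items id E'" and s = s and t = t and od = od and ou = ou,
            OF multilinear_middle[OF inj_on_id] _ _ _ s(2) t(2)])
        (auto simp: r crossings_def image_iff)
    ultimately show "nest (inner_items id E) od ou S (\<lambda>e. slices_weight l (\<lambda>k z. e (Inl ((1, k), z)))) e
      = nest (inner_items id E') od ou S (\<lambda>e. slices_weight r (\<lambda>k z. e (Inl ((1, id k), z)))) e"
      unfolding S(1) by (cases c; cases x; cases y; simp add: l r crossing_weight_tform algebra_simps)
  qed (auto simp: l E_def E'_def arcs_def)
qed

text \<open>Every passage keeps its events up to the numbers of the two slices. Choosing
  \<open>\<pi>\<close> as their exchange makes all slots agree, so no arc has to be
  resolved.\<close>

lemma Inv_height_exchange:
  assumes l: "l = [(e, i), (f, i + ends_above e + p)]" and r: "r = [(f, i + ends_below e + p), (e, i)]"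
    and T: "Diagram (v @ l @ w) u \<in> Tang" "Diagram (v @ r @ w) u \<in> Tang"
  shows "Inv \<Delta> \<epsilon> b binv Td Tu (Diagram (v @ l @ w) u) = Inv \<Delta> \<epsilon> b binv Td Tu (Diagram (v @ r @ w) u)"
proof -
  define \<sigma> :: "nat \<Rightarrow> nat" where "\<sigma> = (\<lambda>k. if k = 0 then 1 else if k = 1 then 0 else k)"
  have \<sigma>\<sigma>: "\<sigma> (\<sigma> k) = k" for k by (simp add: \<sigma>_def)
  have \<sigma>: "inj \<sigma>" by (rule inj_on_inverseI[of _ \<sigma>]) (rule \<sigma>\<sigma>)
  have "\<forall>s. \<exists>es t. run 4 l (entry_point l s) = (es, exit_point l t) \<and>
    run 4 r (entry_point r s) = (map (map_crossing \<sigma>) es, exit_point r t)"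
  proof
    fix s :: strand
    have "\<exists>es u' q'. run 4 l (entry_point l (fst s, snd s)) = (es, (if u' then 2 else 0, q', u')) \<and>
      run 4 r (entry_point r (fst s, snd s)) = (map (map_crossing \<sigma>) es, (if u' then 2 else 0, q', u'))"
      by (rule run_exchange[OF _ _ l r]) (simp_all add: \<sigma>_def)
    then obtain es u' q' where *: "run 4 l (entry_point l s) = (es, (if u' then 2 else 0, q', u'))"
      "run 4 r (entry_point r s) = (map (map_crossing \<sigma>) es, (if u' then 2 else 0, q', u'))"
      by auto
    have "exit_point l (u', q') = (if u' then 2 else 0, q', u')" "exit_point r (u', q') = (if u' then 2 else 0, q', u')"
      by (simp_all add: l r)
    then show "\<exists>es t. run 4 l (entry_point l s) = (es, exit_point l t) \<and>
      run 4 r (entry_point r s) = (map (map_crossing \<sigma>) es, exit_point r t)"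
      using * by metis
  qed
  then obtain E conn where run: "\<And>s. run 4 l (entry_point l s) = (E s, exit_point l (conn s))"
    "\<And>s. run 4 r (entry_point r s) = (map (map_crossing \<sigma>) (E s), exit_point r (conn s))"
    by metis
  define E' where "E' = (\<lambda>s. map (map_crossing \<sigma>) (E s))"
  have rl: "realizes l conn E" by (rule realizesI) (rule run)
  have rr: "realizes r conn E'" by (rule realizesI) (simp only: run E'_def)
  show ?thesis
  proof (rule Inv_replace[OF T _ rl rr _ _ \<sigma>, where arcs = "[]"])
    fix S od ou and e :: "slot \<Rightarrow> info \<times> 'c"
    assume "list_all2 (\<lambda>s (t, t'). s = t \<or> s = t') S ([] :: (strand \<times> strand) list)"
    then show "nest (inner_items id E) od ou S (\<lambda>e. slices_weight l (\<lambda>k z. e (Inl ((1, k), z)))) e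
      = nest (inner_items \<sigma> E') od ou S (\<lambda>e. slices_weight r (\<lambda>k z. e (Inl ((1, \<sigma> k), z)))) e"
      by (simp add: l r \<sigma>_def)
  qed (auto simp: l E'_def inner_items_def items_map_crossing \<sigma>\<sigma> comp_def case_prod_unfold)
qed

lemma Inv_local_move:
  assumes "local_move l r" and T: "Diagram (v @ l @ w) u \<in> Tang" "Diagram (v @ r @ w) u \<in> Tang"
  shows "Inv \<Delta> \<epsilon> b binv Td Tu (Diagram (v @ l @ w) u) = Inv \<Delta> \<epsilon> b binv Td Tu (Diagram (v @ r @ w) u)"
  using assms(1)
proof cases
  case (M1 i) then show ?thesis using Inv_M1[of r i v w u] T by simp
next
  case (M1_mirror i) then show ?thesis using Inv_M1[of r i v w u] T by simp
next
  case (M2 i) then show ?thesis using Inv_M2[of r SWNE i v w u] T by simp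
next
  case (M2_rev i) then show ?thesis using Inv_M2[of r NWSE i v w u] T by simp
next
  case (M3 i) then show ?thesis using Inv_M3[of "Suc i" NWSE i i r l v w u] T by simp
next
  case (M3_rev i) then show ?thesis using Inv_M3[of i SWNE i "Suc i" l r v w u] T by simp
next
  case (M4_max i) then show ?thesis using Inv_M4_max[of l SWNE i r v w u] T by simp
next
  case (M4_min i) then show ?thesis using Inv_M4_min[of l i NWSE r v w u] T by simp
next
  case (M4_max_rev i) then show ?thesis using Inv_M4_max[of l NWSE i r v w u] T by simp
next
  case (M4_min_rev i) then show ?thesis using Inv_M4_min[of l i SWNE r v w u] T by simp
qed

lemma Inv_isotopy_step:
  assumes "isotopy_step T T'"
  shows "Inv \<Delta> \<epsilon> b binv Td Tu T = Inv \<Delta> \<epsilon> b binv Td Tu T'"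
  using assms
proof cases
  case (1 l r v w u)
  from 1(3) show ?thesis
  proof
    assume "height_exchange l r"
    then obtain e f i p where "l = [(e, i), (f, i + ends_above e + p)]" "r = [(f, i + ends_below e + p), (e, i)]"
      by cases
    from Inv_height_exchange[OF this 1(4,5)] show ?thesis by (simp only: 1(1,2))
  next
    assume "local_move l r"
    from Inv_local_move[OF this 1(4,5)] show ?thesis by (simp only: 1(1,2))
  qed
qed

end

theorem theorem4:
  fixes scale :: "'k::field \<Rightarrow> 'c::ab_group_add \<Rightarrow> 'c"
    and \<Delta> :: "'c \<Rightarrow> ('c \<times> 'c) list"
    and \<epsilon> :: "'c \<Rightarrow> 'k"
    and b binv :: "'c \<Rightarrow> 'c \<Rightarrow> 'k"
    and Td Tu :: "'c \<Rightarrow> 'c"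
    and T T' :: diagram
  assumes "oriented_quantum_coalgebra scale \<Delta> \<epsilon> b binv Td Tu"
    and "T \<in> Tang" and "T' \<in> Tang"
    and "regularly_isotopic T T'"
  shows "Inv \<Delta> \<epsilon> b binv Td Tu T = Inv \<Delta> \<epsilon> b binv Td Tu T'"
  using assms(4) unfolding regularly_isotopic_def
proof (induction rule: equivclp_induct)
  \<comment> \<open>A step of the equivalence closure may be an isotopy step in either direction;
    equality of the invariants is symmetric.\<close>
  case (step T' T'')
  then show ?case
    using oriented_quantum_coalgebra.Inv_isotopy_step[OF assms(1)] by metis
qed simp

end
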